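(* Let $T$ be a self-adjoint and boundedly invertible operator in the Hilbert space $(H,(\cdot,\cdot))$ and let $E$ denote the corresponding spectral measure allowing the representation $T=\int_{-\infty}^\infty\lambda\,dE(\lambda)$. Let $(K,[\cdot,\cdot])$ be a Krein space completion of $(\operatorname{dom}T,(T\cdot,\cdot))$ which is continuously embedded in $(H,(\cdot,\cdot))$, and let $A=T|_{\operatorname{dom}A}$ with $\operatorname{dom}A=T^{-1}(K)$ (i.e. $(K,[\cdot,\cdot],A)\in\mathcal N_T$). Then the restrictions $$E_K(\Delta):=E(\Delta)|_K\qquad(\Delta\in\Sigma)$$ define the eigenspectral function $E_K$ of $A$ in $(K,[\cdot,\cdot])$.
   Context: All spaces are complex. "Boundedly invertible" means having an everywhere defined bounded inverse. $(K,[\cdot,\cdot])$ is a Krein space if $K=K^+\oplus K^-$ (direct, $[\cdot,\cdot]$-orthogonal) with $(K^+,[\cdot,\cdot])$ and $(K^-,-[\cdot,\cdot])$ Hilbert spaces. With the projections $P^\pm$ onto $K^\pm$, $J:=P^+-P^-$ is a fundamental symmetry and $\{\cdot,\cdot\}:=[J\cdot,\cdot]$ is a Hilbert space inner product on $K$; its topology (independent of $J$) is the topology of $K$. A densely defined operator $A$ in $K$ is J-self-adjoint (J-non-negative) if $JA$ is self-adjoint (non-negative) in $(K,\{\cdot,\cdot\})$. A Krein space $(K,[\cdot,\cdot])$ is a Krein space completion of $(\operatorname{dom}T,(T\cdot,\cdot))$ if $\operatorname{dom}T$ is a dense subspace of $K$ and $[\cdot,\cdot]$ coincides with $(T\cdot,\cdot)$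 on $\operatorname{dom}T$. $\mathcal N_T$ is the set of all triples $(K,[\cdot,\cdot],A)$ as in the claim; each such $A$ is J-self-adjoint, J-non-negative and boundedly invertible in $(K,[\cdot,\cdot])$. Eigenspectral function. Let $A$ be J-self-adjoint, J-non-negative and boundedly invertible in a Krein space $K$, and let $\Sigma$ be the semiring of all bounded intervals in $\mathbb R$ and their complements. The eigenspectral function of $A$ (Langer) is the mapping from $\Sigma$ to $L(K)$ (the bounded operators on $K$) which assigns to a non-empty bounded interval $\Delta$ with endpoints $\alpha\le\beta$ the operator $$f\mapsto\lim_{\epsilon\searrow0}\lim_{\delta\searrow0}-\frac1{2\pi i}\int_{C^\delta_{\Delta_\epsilon}}(A-\lambda)^{-1}f\,d\lambda\quad(f\in K)$$ (integral and limits in the topology of $K$; the limits exist by Langer's theorem), where $\Delta_\epsilon=[\alpha\mp\epsilon,\beta\pm\epsilon]$, the upper (lower) sign being taken at an endpoint if that endpoint belongs (does not belong) to $\Delta$ ($\Delta_\epsilon=\emptyset$ if the left end exceeds the right end), and for $\Delta'=[\alpha',\beta']$, $C^\delta_{\Delta'}$ is the positively oriented polygon $\beta'+i,\alpha'+i,\alpha'-i,\beta'-i,\beta'+i$ with the segments between $\alpha'+i\delta$ and $\alpha'-i\delta$ and between $\beta'-i\delta$ and $\beta'+i\delta$ removed. It assigns $0$ to $\emptyset$, and to an unbounded $\Delta\in\Sigma$ the identity minus the operator assigned to $\mathbb R\setminus\Delta$. *)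

theory Defs
  imports "HOL-Analysis.Analysis"
begin

section \<open>Complex Hilbert spaces\<close>

text \<open>
  All sesquilinear forms are linear in the first and conjugate linear in the second argument.
  Norm and topology of a complex Hilbert space are those of its underlying real Hilbert space.
\<close>

class complex_vector = real_vector +
  fixes scaleC :: "complex \<Rightarrow> 'a \<Rightarrow> 'a" (infixr \<open>*\<^sub>C\<close> 75)
  assumes scaleC_add_right: "c *\<^sub>C (x + y) = c *\<^sub>C x + c *\<^sub>C y"
    and scaleC_add_left: "(c + d) *\<^sub>C x = c *\<^sub>C x + d *\<^sub>C x"
    and scaleC_scaleC: "c *\<^sub>C d *\<^sub>C x = (c * d) *\<^sub>C x"
    and scaleC_one: "1 *\<^sub>C x = x"
    and scaleR_scaleC: "r *\<^sub>R x = complex_of_real r *\<^sub>C x"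

class chilbert_space = complex_vector + real_inner + banach +
  fixes cinner :: "'a \<Rightarrow> 'a \<Rightarrow> complex"
  assumes cinner_add_left: "cinner (x + y) z = cinner x z + cinner y z"
    and cinner_scaleC_left: "cinner (c *\<^sub>C x) y = c * cinner x y"
    and cinner_commute: "cinner y x = cnj (cinner x y)"
    and inner_eq_Re_cinner: "inner x y = Re (cinner x y)"

abbreviation csubspace :: "'a::complex_vector set \<Rightarrow> bool" where
  "csubspace \<equiv> module.subspace scaleC"

text \<open>
  Forms and operators on subspaces. A form or an operator on \<open>S\<close> is given by a total function of
  which only the values on \<open>S\<close> (for an operator: on its domain) matter.
\<close>

definition hermitian_form_on :: "'a::complex_vector set \<Rightarrow> ('a \<Rightarrow> 'a \<Rightarrow> complex) \<Rightarrow> bool" where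
  "hermitian_form_on S ip \<longleftrightarrow>
     (\<forall>x\<in>S. \<forall>y\<in>S. \<forall>z\<in>S. ip (x + y) z = ip x z + ip y z) \<and>
     (\<forall>c. \<forall>x\<in>S. \<forall>y\<in>S. ip (c *\<^sub>C x) y = c * ip x y) \<and>
     (\<forall>x\<in>S. \<forall>y\<in>S. ip y x = cnj (ip x y))"

definition ip_norm :: "('a \<Rightarrow> 'a \<Rightarrow> complex) \<Rightarrow> 'a \<Rightarrow> real" where
  "ip_norm ip x = sqrt (Re (ip x x))"

text \<open>
  The locale \<open>Metric_space\<close> demands non-negativity and symmetry also off the carrier, where \<open>ip\<close>
  is arbitrary; hence the case distinction.
\<close>

definition ip_dist :: "'a::complex_vector set \<Rightarrow> ('a \<Rightarrow> 'a \<Rightarrow> complex) \<Rightarrow> 'a \<Rightarrow> 'a \<Rightarrow> real" where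
  "ip_dist S ip x y = (if x \<in> S \<and> y \<in> S then ip_norm ip (x - y) else 0)"

definition ip_topology :: "'a::complex_vector set \<Rightarrow> ('a \<Rightarrow> 'a \<Rightarrow> complex) \<Rightarrow> 'a topology" where
  "ip_topology S ip = Metric_space.mtopology S (ip_dist S ip)"

definition hilbert_space_on :: "'a::complex_vector set \<Rightarrow> ('a \<Rightarrow> 'a \<Rightarrow> complex) \<Rightarrow> bool" where
  "hilbert_space_on S ip \<longleftrightarrow>
     csubspace S \<and> hermitian_form_on S ip \<and> (\<forall>x\<in>S. x \<noteq> 0 \<longrightarrow> 0 < Re (ip x x)) \<and>
     Metric_space.mcomplete S (ip_dist S ip)"


section \<open>Operators\<close>

text \<open>An operator in \<open>S\<close> is given by its domain \<open>D\<close> and a function \<open>A\<close>.\<close>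

definition linear_operator :: "'a::complex_vector set \<Rightarrow> 'a set \<Rightarrow> ('a \<Rightarrow> 'a) \<Rightarrow> bool" where
  "linear_operator S D A \<longleftrightarrow>
     csubspace D \<and> D \<subseteq> S \<and> A ` D \<subseteq> S \<and>
     (\<forall>x\<in>D. \<forall>y\<in>D. A (x + y) = A x + A y) \<and> (\<forall>c. \<forall>x\<in>D. A (c *\<^sub>C x) = c *\<^sub>C A x)"

definition densely_defined ::
    "'a::complex_vector set \<Rightarrow> ('a \<Rightarrow> 'a \<Rightarrow> complex) \<Rightarrow> 'a set \<Rightarrow> ('a \<Rightarrow> 'a) \<Rightarrow> bool" where
  "densely_defined S ip D A \<longleftrightarrow> linear_operator S D A \<and> ip_topology S ip closure_of D = S"

definition adjoint_graph ::
    "'a set \<Rightarrow> ('a \<Rightarrow> 'a \<Rightarrow> complex) \<Rightarrow> 'a set \<Rightarrow> ('a \<Rightarrow> 'a) \<Rightarrow> ('a \<times> 'a) set" where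
  "adjoint_graph S ip D A = {(y, z) \<in> S \<times> S. \<forall>x\<in>D. ip (A x) y = ip x z}"

definition self_adjoint ::
    "'a::complex_vector set \<Rightarrow> ('a \<Rightarrow> 'a \<Rightarrow> complex) \<Rightarrow> 'a set \<Rightarrow> ('a \<Rightarrow> 'a) \<Rightarrow> bool" where
  "self_adjoint S ip D A \<longleftrightarrow>
     densely_defined S ip D A \<and> adjoint_graph S ip D A = (\<lambda>x. (x, A x)) ` D"

definition non_negative ::
    "('a \<Rightarrow> 'a \<Rightarrow> complex) \<Rightarrow> 'a set \<Rightarrow> ('a \<Rightarrow> 'a) \<Rightarrow> bool" where
  "non_negative ip D A \<longleftrightarrow> (\<forall>x\<in>D. ip (A x) x \<in> \<real>\<^sub>\<ge>\<^sub>0)"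

definition bounded_operator ::
    "'a::complex_vector set \<Rightarrow> ('a \<Rightarrow> 'a \<Rightarrow> complex) \<Rightarrow> ('a \<Rightarrow> 'a) \<Rightarrow> bool" where
  "bounded_operator S ip B \<longleftrightarrow>
     linear_operator S S B \<and> (\<exists>c. \<forall>x\<in>S. ip_norm ip (B x) \<le> c * ip_norm ip x)"

definition boundedly_invertible ::
    "'a::complex_vector set \<Rightarrow> ('a \<Rightarrow> 'a \<Rightarrow> complex) \<Rightarrow> 'a set \<Rightarrow> ('a \<Rightarrow> 'a) \<Rightarrow> bool" where
  "boundedly_invertible S ip D A \<longleftrightarrow>
     (\<exists>B. bounded_operator S ip B \<and> (\<forall>y\<in>S. B y \<in> D \<and> A (B y) = y) \<and> (\<forall>x\<in>D. B (A x) = x))"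

text \<open>\<open>(A - \<lambda>)\<^sup>-\<^sup>1 f\<close>; only meaningful for \<open>\<lambda>\<close> in the resolvent set of \<open>A\<close>.\<close>

definition resolvent :: "'a::complex_vector set \<Rightarrow> ('a \<Rightarrow> 'a) \<Rightarrow> complex \<Rightarrow> 'a \<Rightarrow> 'a" where
  "resolvent D A l f = inv_into D (\<lambda>x. A x - l *\<^sub>C x) f"


section \<open>Spectral measures\<close>

definition orthogonal_projection :: "('a::chilbert_space \<Rightarrow> 'a) \<Rightarrow> bool" where
  "orthogonal_projection P \<longleftrightarrow>
     linear_operator UNIV UNIV P \<and> P \<circ> P = P \<and> (\<forall>x y. cinner (P x) y = cinner x (P y))"

definition spectral_measure :: "(real set \<Rightarrow> 'a::chilbert_space \<Rightarrow> 'a) \<Rightarrow> bool" where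
  "spectral_measure E \<longleftrightarrow>
     (\<forall>\<Delta>\<in>sets borel. orthogonal_projection (E \<Delta>)) \<and> E UNIV = id \<and>
     (\<forall>\<Delta> :: nat \<Rightarrow> real set. range \<Delta> \<subseteq> sets borel \<and> disjoint_family \<Delta> \<longrightarrow>
        (\<forall>x. (\<lambda>n. E (\<Delta> n) x) sums E (\<Union>n. \<Delta> n) x))"

text \<open>The finite positive measure \<open>(E(\<cdot>)x, x)\<close>.\<close>

definition scalar_measure :: "(real set \<Rightarrow> 'a::chilbert_space \<Rightarrow> 'a) \<Rightarrow> 'a \<Rightarrow> real measure" where
  "scalar_measure E x = measure_of UNIV (sets borel) (\<lambda>\<Delta>. ennreal (Re (cinner (E \<Delta> x) x)))"

text \<open>
  \<open>T = \<integral> \<lambda> dE(\<lambda>)\<close>: the domain consists of all \<open>x\<close> with \<open>\<integral> \<lambda>\<^sup>2 d(E(\<lambda>)x, x) < \<infinity>\<close>, and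
  \<open>(Tx, x) = \<integral> \<lambda> d(E(\<lambda>)x, x)\<close> there, which by polarization determines the linear operator \<open>T\<close>.
\<close>

definition spectral_representation ::
    "(real set \<Rightarrow> 'a \<Rightarrow> 'a) \<Rightarrow> 'a::chilbert_space set \<Rightarrow> ('a \<Rightarrow> 'a) \<Rightarrow> bool" where
  "spectral_representation E D T \<longleftrightarrow>
     D = {x. integrable (scalar_measure E x) (\<lambda>t. t\<^sup>2)} \<and>
     (\<forall>x\<in>D. cinner (T x) x = complex_of_real (\<integral>t. t \<partial>scalar_measure E x))"


section \<open>Krein spaces\<close>

definition fundamental_decomposition ::
    "'a::complex_vector set \<Rightarrow> ('a \<Rightarrow> 'a \<Rightarrow> complex) \<Rightarrow> 'a set \<Rightarrow> 'a set \<Rightarrow> bool" where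
  "fundamental_decomposition K kip Kp Km \<longleftrightarrow>
     hermitian_form_on K kip \<and>
     K = {x + y | x y. x \<in> Kp \<and> y \<in> Km} \<and> Kp \<inter> Km = {0} \<and>
     (\<forall>x\<in>Kp. \<forall>y\<in>Km. kip x y = 0) \<and>
     hilbert_space_on Kp kip \<and> hilbert_space_on Km (\<lambda>x y. - kip x y)"

definition krein_space :: "'a::complex_vector set \<Rightarrow> ('a \<Rightarrow> 'a \<Rightarrow> complex) \<Rightarrow> bool" where
  "krein_space K kip \<longleftrightarrow> (\<exists>Kp Km. fundamental_decomposition K kip Kp Km)"

definition fundamental_symmetry ::
    "'a::complex_vector set \<Rightarrow> ('a \<Rightarrow> 'a \<Rightarrow> complex) \<Rightarrow> ('a \<Rightarrow> 'a) \<Rightarrow> bool" where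
  "fundamental_symmetry K kip J \<longleftrightarrow>
     (\<exists>Kp Km. fundamental_decomposition K kip Kp Km \<and> (\<forall>x\<in>Kp. \<forall>y\<in>Km. J (x + y) = x - y))"

definition J_form :: "('a \<Rightarrow> 'a \<Rightarrow> complex) \<Rightarrow> ('a \<Rightarrow> 'a) \<Rightarrow> 'a \<Rightarrow> 'a \<Rightarrow> complex" where
  "J_form kip J x y = kip (J x) y"

text \<open>
  The topology of a Krein space does not depend on the fundamental symmetry \<open>J\<close>; the notions below
  nevertheless carry \<open>J\<close> as a parameter.
\<close>

definition krein_topology ::
    "'a::complex_vector set \<Rightarrow> ('a \<Rightarrow> 'a \<Rightarrow> complex) \<Rightarrow> ('a \<Rightarrow> 'a) \<Rightarrow> 'a topology" where
  "krein_topology K kip J = ip_topology K (J_form kip J)"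

definition J_self_adjoint ::
    "'a::complex_vector set \<Rightarrow> ('a \<Rightarrow> 'a \<Rightarrow> complex) \<Rightarrow> ('a \<Rightarrow> 'a) \<Rightarrow> 'a set \<Rightarrow> ('a \<Rightarrow> 'a) \<Rightarrow> bool" where
  "J_self_adjoint K kip J D A \<longleftrightarrow>
     densely_defined K (J_form kip J) D A \<and> self_adjoint K (J_form kip J) D (J \<circ> A)"

definition J_non_negative ::
    "'a::complex_vector set \<Rightarrow> ('a \<Rightarrow> 'a \<Rightarrow> complex) \<Rightarrow> ('a \<Rightarrow> 'a) \<Rightarrow> 'a set \<Rightarrow> ('a \<Rightarrow> 'a) \<Rightarrow> bool" where
  "J_non_negative K kip J D A \<longleftrightarrow>
     densely_defined K (J_form kip J) D A \<and> non_negative (J_form kip J) D (J \<circ> A)"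

text \<open>\<open>K\<close> is a Krein space completion of \<open>D\<close>, the domain of \<open>T\<close>, with the form \<open>(T\<cdot>, \<cdot>)\<close>.\<close>

definition krein_space_completion ::
    "'a::chilbert_space set \<Rightarrow> ('a \<Rightarrow> 'a \<Rightarrow> complex) \<Rightarrow> ('a \<Rightarrow> 'a) \<Rightarrow> 'a set \<Rightarrow> ('a \<Rightarrow> 'a) \<Rightarrow> bool" where
  "krein_space_completion K kip J D T \<longleftrightarrow>
     krein_space K kip \<and> fundamental_symmetry K kip J \<and>
     csubspace D \<and> D \<subseteq> K \<and> krein_topology K kip J closure_of D = K \<and>
     (\<forall>x\<in>D. \<forall>y\<in>D. kip x y = cinner (T x) y)"


section \<open>The eigenspectral function\<close>

text \<open>
  Integrals over line segments and over chains of segments, taken in a topology \<open>X\<close> given on a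
  subspace. The limit along \<open>division_filter\<close> is the library's integral (cf. \<open>has_integral_cbox\<close>)
  with the type's topology replaced by \<open>X\<close>.
\<close>

definition has_segment_integral ::
    "'a::complex_vector topology \<Rightarrow> (complex \<Rightarrow> 'a) \<Rightarrow> complex \<times> complex \<Rightarrow> 'a \<Rightarrow> bool" where
  "has_segment_integral X g s v \<longleftrightarrow>
     limitin X
       (\<lambda>p. \<Sum>(t, I)\<in>p. measure lborel I *\<^sub>R ((snd s - fst s) *\<^sub>C g (linepath (fst s) (snd s) t)))
       v (division_filter (cbox 0 (1::real)))"

definition has_chain_integral ::
    "'a::complex_vector topology \<Rightarrow> (complex \<Rightarrow> 'a) \<Rightarrow> (complex \<times> complex) list \<Rightarrow> 'a \<Rightarrow> bool" where
  "has_chain_integral X g ss v \<longleftrightarrow>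
     (\<exists>vs. list_all2 (has_segment_integral X g) ss vs \<and> v = sum_list vs)"

text \<open>
  The contour \<open>C\<^sup>\<delta>\<close> of the interval \<open>[a, b]\<close>: the polygon \<open>b + i, a + i, a - i, b - i, b + i\<close> without
  the segments between \<open>a + i\<delta>\<close> and \<open>a - i\<delta>\<close> and between \<open>b - i\<delta>\<close> and \<open>b + i\<delta>\<close> (for \<open>0 < \<delta> < 1\<close>).
\<close>

definition contour :: "real \<Rightarrow> real \<Rightarrow> real \<Rightarrow> (complex \<times> complex) list" where
  "contour a b \<delta> =
     (if b < a then []
      else [(Complex b \<delta>, Complex b 1), (Complex b 1, Complex a 1), (Complex a 1, Complex a \<delta>),
            (Complex a (- \<delta>), Complex a (- 1)), (Complex a (- 1), Complex b (- 1)),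
            (Complex b (- 1), Complex b (- \<delta>))])"

definition left_end :: "real set \<Rightarrow> real \<Rightarrow> real" where
  "left_end \<Delta> \<epsilon> = (if Inf \<Delta> \<in> \<Delta> then Inf \<Delta> - \<epsilon> else Inf \<Delta> + \<epsilon>)"

definition right_end :: "real set \<Rightarrow> real \<Rightarrow> real" where
  "right_end \<Delta> \<epsilon> = (if Sup \<Delta> \<in> \<Delta> then Sup \<Delta> + \<epsilon> else Sup \<Delta> - \<epsilon>)"

definition bounded_intervals :: "real set set" where
  "bounded_intervals = {\<Delta>. is_interval \<Delta> \<and> bounded \<Delta>}"

definition Sigma_semiring :: "real set set" where
  "Sigma_semiring = bounded_intervals \<union> uminus ` bounded_intervals"

text \<open>
  \<open>v = lim\<^sub>\<epsilon> lim\<^sub>\<delta> -1/(2\<pi>i) \<integral> (A - \<lambda>)\<^sup>-\<^sup>1 f d\<lambda>\<close>, including the existence of the integrals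
  (for small \<open>\<delta>\<close>) and of both limits in the topology \<open>X\<close>.
\<close>

definition eigenspectral_limit ::
    "'a::complex_vector topology \<Rightarrow> 'a set \<Rightarrow> ('a \<Rightarrow> 'a) \<Rightarrow> real set \<Rightarrow> 'a \<Rightarrow> 'a \<Rightarrow> bool" where
  "eigenspectral_limit X D A \<Delta> f v \<longleftrightarrow>
     (\<exists>L. limitin X L v (at_right 0) \<and>
       (\<forall>\<^sub>F \<epsilon> in at_right 0. \<exists>I.
          (\<forall>\<^sub>F \<delta> in at_right 0.
             has_chain_integral X (\<lambda>l. resolvent D A l f)
               (contour (left_end \<Delta> \<epsilon>) (right_end \<Delta> \<epsilon>) \<delta>) (I \<delta>)) \<and>
          limitin X (\<lambda>\<delta>. (- 1 / (2 * of_real pi * \<i>)) *\<^sub>C I \<delta>) (L \<epsilon>) (at_right 0)))"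

text \<open>\<open>F\<close> is the eigenspectral function of \<open>A\<close>; its values off \<open>Sigma_semiring\<close> are irrelevant.\<close>

definition eigenspectral_function ::
    "'a::complex_vector set \<Rightarrow> ('a \<Rightarrow> 'a \<Rightarrow> complex) \<Rightarrow> ('a \<Rightarrow> 'a) \<Rightarrow> 'a set \<Rightarrow> ('a \<Rightarrow> 'a) \<Rightarrow>
       (real set \<Rightarrow> 'a \<Rightarrow> 'a) \<Rightarrow> bool" where
  "eigenspectral_function K kip J D A F \<longleftrightarrow>
     krein_space K kip \<and> fundamental_symmetry K kip J \<and>
     J_self_adjoint K kip J D A \<and> J_non_negative K kip J D A \<and>
     boundedly_invertible K (J_form kip J) D A \<and>
     (\<forall>\<Delta>\<in>Sigma_semiring. bounded_operator K (J_form kip J) (F \<Delta>)) \<and>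
     (\<forall>f\<in>K. F {} f = 0) \<and>
     (\<forall>\<Delta>\<in>bounded_intervals. \<Delta> \<noteq> {} \<longrightarrow>
        (\<forall>f\<in>K. eigenspectral_limit (krein_topology K kip J) D A \<Delta> f (F \<Delta> f))) \<and>
     (\<forall>\<Delta>\<in>Sigma_semiring. \<not> bounded \<Delta> \<longrightarrow> (\<forall>f\<in>K. F \<Delta> f = f - F (- \<Delta>) f))"

end

theory Submission
  imports Defs
begin

text \<open>
  Write \<open>(\<cdot>, \<cdot>)\<close> for the inner product of \<open>H\<close> and \<open>[\<cdot>, \<cdot>]\<close> for the form of \<open>K\<close>. Everything
  rests on one estimate. The identity \<open>[y, x] = (y, T x)\<close>, known for \<open>y \<in> domT\<close>, extends to all
  \<open>y \<in> K\<close> by density (\<open>kip_T\<close>). For \<open>x \<in> domT\<close> it gives, as \<open>J\<close> is isometric in \<open>K\<close> and \<open>K\<close>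
  is continuously embedded in \<open>H\<close>,
  \<open>\<parallel>x\<parallel>\<^sub>K\<^sup>2 = [J x, x] = (J x, T x) \<le> c \<parallel>x\<parallel>\<^sub>K \<parallel>T x\<parallel>\<close>, that is,
  \<open>\<parallel>x\<parallel>\<^sub>K \<le> c \<parallel>T x\<parallel>\<close> (\<open>knorm_le\<close>). So a limit in the topology of \<open>K\<close> holds as soon as the
  images under \<open>T\<close> converge in \<open>H\<close> (\<open>limitin_K\<close>), and the possibly intricate topology of \<open>K\<close>
  need not be known any better. The estimate also yields that \<open>T\<^sup>-\<^sup>1\<close> restricts to a bounded inverse of
  \<open>A\<close>, from which \<open>A\<close> is seen to be J-self-adjoint and J-non-negative.

  Convergence of images under \<open>T\<close> is a question about functions. A bounded Borel function
  \<open>\<phi>\<close> has an integral \<open>fcalc \<phi> f\<close> with respect to \<open>E\<close>, and \<open>\<phi> \<mapsto> fcalc \<phi> f\<close> is isometric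
  for the norm of \<open>L\<^sup>2((E(\<cdot>)f, f))\<close>. If \<open>\<phi>(t)\<close> and \<open>t \<phi>(t)\<close> are bounded, then \<open>T (fcalc \<phi> f)\<close>
  is the integral of \<open>t \<phi>(t)\<close> (\<open>T_fcalc_eq\<close>). In particular the resolvent of \<open>A\<close>, a restriction of the
  resolvent of \<open>T\<close>, is given by \<open>1 / (t - \<lambda>)\<close>, and the contour integral over \<open>C\<^sup>\<delta>\<close> by an
  elementary function: with the factor \<open>-1 / (2 \<pi> i)\<close> it is
  \<open>(sgn (b - t) - sgn (a - t)) / 2 - (arctan (\<delta> / (b - t)) - arctan (\<delta> / (a - t))) / \<pi>\<close>
  (\<open>contour_seg_int\<close>). Multiplied by \<open>t\<close> it stays bounded uniformly in \<open>\<delta>\<close>, and as \<open>\<delta>\<close>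
  tends to \<open>0\<close> it converges to the indicator function of \<open>[a, b]\<close> with the value \<open>1 / 2\<close> at the end
  points. The shifts of the end points by \<open>\<epsilon>\<close> remove these halves: as \<open>\<epsilon>\<close> tends to \<open>0\<close> the
  indicator function of \<open>\<Delta>\<close> results, whose integral is \<open>E(\<Delta>) f\<close>. Both limits are instances of
  dominated convergence.
\<close>

section \<open>Hermitian forms on subspaces\<close>

interpretation cvec: vector_space "scaleC :: complex \<Rightarrow> 'a::complex_vector \<Rightarrow> 'a"
  by unfold_locales (simp_all add: scaleC_add_right scaleC_add_left scaleC_scaleC scaleC_one)

lemma csubspace_scaleR: "csubspace S \<Longrightarrow> x \<in> S \<Longrightarrow> r *\<^sub>R x \<in> S"
  unfolding scaleR_scaleC by (rule cvec.subspace_scale)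

lemma csubspace_minus: "csubspace S \<Longrightarrow> x \<in> S \<Longrightarrow> y \<in> S \<Longrightarrow> x - y \<in> S"
  by (rule cvec.subspace_diff)

text \<open>
  The form of a Krein space is indefinite, so positivity is split off. A positive form on a subspace
  brings its own norm and topology, which in general are not those of the ambient space.
\<close>

locale carrier_form =
  fixes S :: "'a::complex_vector set" and ip :: "'a \<Rightarrow> 'a \<Rightarrow> complex"
  assumes S_sub: "csubspace S"
    and herm: "hermitian_form_on S ip"
begin

lemmas S_closed [simp, intro] =
  cvec.subspace_0[OF S_sub] cvec.subspace_add[OF S_sub] cvec.subspace_diff[OF S_sub]
  cvec.subspace_neg[OF S_sub] cvec.subspace_scale[OF S_sub] csubspace_scaleR[OF S_sub]

lemma ip_add_left: "x \<in> S \<Longrightarrow> y \<in> S \<Longrightarrow> z \<in> S \<Longrightarrow> ip (x + y) z = ip x z + ip y z"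
  and ip_scale_left: "x \<in> S \<Longrightarrow> z \<in> S \<Longrightarrow> ip (c *\<^sub>C x) z = c * ip x z"
  and ip_commute: "x \<in> S \<Longrightarrow> z \<in> S \<Longrightarrow> ip z x = cnj (ip x z)"
  using herm unfolding hermitian_form_on_def by blast+

lemma ip_add_right: "x \<in> S \<Longrightarrow> y \<in> S \<Longrightarrow> z \<in> S \<Longrightarrow> ip z (x + y) = ip z x + ip z y"
  using ip_commute[of "x + y" z] ip_commute[of x z] ip_commute[of y z] by (simp add: ip_add_left)

lemma ip_scale_right: "x \<in> S \<Longrightarrow> z \<in> S \<Longrightarrow> ip z (c *\<^sub>C x) = cnj c * ip z x"
  using ip_commute[of "c *\<^sub>C x" z] ip_commute[of x z] by (simp add: ip_scale_left)

lemma ip_zero [simp]: "z \<in> S \<Longrightarrow> ip 0 z = 0" "z \<in> S \<Longrightarrow> ip z 0 = 0"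
  using ip_scale_left[of 0 z 0] ip_scale_right[of 0 z 0] by auto

lemma ip_neg: "x \<in> S \<Longrightarrow> z \<in> S \<Longrightarrow> ip (- x) z = - ip x z" "x \<in> S \<Longrightarrow> z \<in> S \<Longrightarrow> ip z (- x) = - ip z x"
  using ip_scale_left[of x z "-1"] ip_scale_right[of x z "-1"] by (auto simp: cvec.scale_minus_left)

lemma ip_diff_left: "x \<in> S \<Longrightarrow> y \<in> S \<Longrightarrow> z \<in> S \<Longrightarrow> ip (x - y) z = ip x z - ip y z"
  and ip_diff_right: "x \<in> S \<Longrightarrow> y \<in> S \<Longrightarrow> z \<in> S \<Longrightarrow> ip z (x - y) = ip z x - ip z y"
  using ip_add_left[of x "- y" z] ip_add_right[of x "- y" z] by (auto simp: ip_neg)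

lemma ip_self_real: "x \<in> S \<Longrightarrow> ip x x = complex_of_real (Re (ip x x))"
  by (metis Reals_cnj_iff ip_commute of_real_Re)

end

locale carrier_ip = carrier_form +
  assumes pos: "x \<in> S \<Longrightarrow> x \<noteq> 0 \<Longrightarrow> 0 < Re (ip x x)"
begin

abbreviation nrm :: "'a \<Rightarrow> real" where "nrm \<equiv> ip_norm ip"

lemma ip_self_nonneg: "x \<in> S \<Longrightarrow> 0 \<le> Re (ip x x)"
  using pos[of x] by (cases "x = 0") auto

lemma nrm_nonneg [simp]: "x \<in> S \<Longrightarrow> 0 \<le> nrm x"
  by (simp add: ip_norm_def ip_self_nonneg)

lemma nrm_sq: "x \<in> S \<Longrightarrow> (nrm x)\<^sup>2 = Re (ip x x)"
  by (simp add: ip_norm_def ip_self_nonneg)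

lemma ip_self: "x \<in> S \<Longrightarrow> ip x x = complex_of_real ((nrm x)\<^sup>2)"
  by (metis nrm_sq ip_self_real)

lemma nrm_eq_0: "x \<in> S \<Longrightarrow> nrm x = 0 \<longleftrightarrow> x = 0"
  using pos[of x] by (cases "x = 0") (auto simp: ip_norm_def)

lemma Cauchy_Schwarz_ip:
  assumes x: "x \<in> S" and y: "y \<in> S"
  shows "cmod (ip x y) \<le> nrm x * nrm y"
proof (cases "y = 0")
  case True
  then show ?thesis using x by (simp add: nrm_eq_0)
next
  case False
  define a b z where "a = Re (ip x x)" and "b = Re (ip y y)" and "z = ip x y"
  have b: "b > 0" using pos[OF y False] by (simp add: b_def)
  \<comment> \<open>The value of \<open>s\<close> that minimizes \<open>ip (x + s y) (x + s y)\<close>.\<close>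
  define s where "s = - z / complex_of_real b"
  have "0 \<le> Re (ip (x + s *\<^sub>C y) (x + s *\<^sub>C y))"
    using x y by (intro ip_self_nonneg) auto
  also have "ip (x + s *\<^sub>C y) (x + s *\<^sub>C y) = ip x x + cnj s * z + s * cnj z + s * cnj s * ip y y"
    using x y ip_commute[of x y]
    by (simp add: ip_add_left ip_add_right ip_scale_left ip_scale_right z_def algebra_simps)
  also have "\<dots> = of_real a + cnj s * z + s * cnj z + s * cnj s * of_real b"
    by (simp only: a_def b_def ip_self_real[OF x, symmetric] ip_self_real[OF y, symmetric])
  also have "\<dots> = of_real (a - (cmod z)\<^sup>2 / b)"
    using b complex_norm_square[of z]
    by (simp add: s_def field_simps power2_eq_square)
  finally have "(cmod z)\<^sup>2 / b \<le> a" by simp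
  then have "(cmod z)\<^sup>2 \<le> a * b" using b by (simp add: field_simps)
  also have "\<dots> = (nrm x * nrm y)\<^sup>2"
    using nrm_sq[OF x] nrm_sq[OF y] by (simp add: a_def b_def power_mult_distrib)
  finally show ?thesis unfolding z_def by (rule power2_le_imp_le) (use x y in simp)
qed

lemma nrm_triangle:
  assumes x: "x \<in> S" and y: "y \<in> S"
  shows "nrm (x + y) \<le> nrm x + nrm y"
proof (rule power2_le_imp_le)
  have "(nrm (x + y))\<^sup>2 = Re (ip x x) + Re (ip y y) + 2 * Re (ip x y)"
    using x y ip_commute[of x y] by (simp add: nrm_sq ip_add_left ip_add_right)
  also have "\<dots> \<le> (nrm x)\<^sup>2 + (nrm y)\<^sup>2 + 2 * (nrm x * nrm y)"
    using Cauchy_Schwarz_ip[OF x y] complex_Re_le_cmod[of "ip x y"] x y by (simp add: nrm_sq)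
  also have "\<dots> = (nrm x + nrm y)\<^sup>2" by (simp add: power2_sum)
  finally show "(nrm (x + y))\<^sup>2 \<le> (nrm x + nrm y)\<^sup>2" .
qed (use x y in simp)

lemma nrm_scaleC: "x \<in> S \<Longrightarrow> nrm (c *\<^sub>C x) = cmod c * nrm x"
proof (rule power2_eq_imp_eq)
  assume x: "x \<in> S"
  have "ip (c *\<^sub>C x) (c *\<^sub>C x) = (c * cnj c) * ip x x"
    using x by (simp add: ip_scale_left ip_scale_right)
  also have "\<dots> = complex_of_real ((cmod c)\<^sup>2 * Re (ip x x))"
    by (subst ip_self_real[OF x]) (simp flip: complex_norm_square)
  finally show "(nrm (c *\<^sub>C x))\<^sup>2 = (cmod c * nrm x)\<^sup>2"
    using x by (simp add: nrm_sq power_mult_distrib)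
qed (use S_closed in auto)

lemma nrm_minus_commute: "x \<in> S \<Longrightarrow> y \<in> S \<Longrightarrow> nrm (x - y) = nrm (y - x)"
  using nrm_scaleC[of "y - x" "-1"] by (simp add: cvec.scale_minus_left)

lemma Metric_space_ip: "Metric_space S (ip_dist S ip)"
proof
  fix x y z
  show "0 \<le> ip_dist S ip x y" by (simp add: ip_dist_def)
  show "ip_dist S ip x y = ip_dist S ip y x" by (simp add: ip_dist_def nrm_minus_commute)
  show "x \<in> S \<Longrightarrow> y \<in> S \<Longrightarrow> (ip_dist S ip x y = 0) = (x = y)"
    by (simp add: ip_dist_def nrm_eq_0)
  show "ip_dist S ip x z \<le> ip_dist S ip x y + ip_dist S ip y z"
    if "x \<in> S" "y \<in> S" "z \<in> S"
    using nrm_triangle[of "x - y" "y - z"] that by (simp add: ip_dist_def)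
qed

lemma topspace_ip [simp]: "topspace (ip_topology S ip) = S"
  by (simp add: ip_topology_def Metric_space.topspace_mtopology[OF Metric_space_ip])

lemma limitin_ip:
  "limitin (ip_topology S ip) g l F \<longleftrightarrow>
     l \<in> S \<and> (\<forall>\<^sub>F x in F. g x \<in> S) \<and> ((\<lambda>x. nrm (g x - l)) \<longlongrightarrow> 0) F"
proof -
  have "((\<lambda>x. ip_dist S ip (g x) l) \<longlongrightarrow> 0) F \<longleftrightarrow> ((\<lambda>x. nrm (g x - l)) \<longlongrightarrow> 0) F"
    if "l \<in> S" "\<forall>\<^sub>F x in F. g x \<in> S"
    using that by (intro tendsto_cong) (auto elim!: eventually_mono simp: ip_dist_def)
  then show ?thesis
    unfolding ip_topology_def Metric_space.limitin_metric_dist_null[OF Metric_space_ip] by blast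
qed

lemma closure_of_ip:
  assumes "D \<subseteq> S"
  shows "ip_topology S ip closure_of D = S \<longleftrightarrow> (\<forall>x\<in>S. \<forall>e>0. \<exists>y\<in>D. nrm (y - x) < e)"
proof -
  have "ip_topology S ip closure_of D = {x \<in> S. \<forall>e>0. \<exists>y\<in>D. nrm (y - x) < e}"
    unfolding ip_topology_def Metric_space.metric_closure_of[OF Metric_space_ip]
      Metric_space.in_mball[OF Metric_space_ip]
    using assms by (auto simp: ip_dist_def nrm_minus_commute subset_iff) blast
  then show ?thesis by (simp add: set_eq_iff) blast
qed

end

section \<open>Complex Hilbert spaces\<close>

interpretation H: carrier_ip "UNIV :: 'a::chilbert_space set" cinner
proof
  show "csubspace (UNIV :: 'a set)" by (simp add: cvec.subspace_UNIV)
  show "hermitian_form_on (UNIV :: 'a set) cinner"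
    by (auto simp: hermitian_form_on_def cinner_add_left cinner_scaleC_left intro: cinner_commute)
  show "0 < Re (cinner x x)" if "x \<noteq> 0" for x :: 'a
    using that by (simp flip: inner_eq_Re_cinner)
qed

lemma ip_norm_cinner [simp]: "ip_norm cinner x = norm x"
  by (simp add: ip_norm_def norm_eq_sqrt_inner inner_eq_Re_cinner)

lemma norm_scaleC [simp]: "norm (c *\<^sub>C x) = cmod c * norm (x :: 'a::chilbert_space)"
  using H.nrm_scaleC[of x c] by simp

lemma cinner_self: "cinner x x = complex_of_real ((norm x)\<^sup>2)"
  using H.ip_self[of x] by simp

lemmas cinner_simps =
  H.ip_add_left[OF UNIV_I UNIV_I UNIV_I] H.ip_add_right[OF UNIV_I UNIV_I UNIV_I]
  H.ip_diff_left[OF UNIV_I UNIV_I UNIV_I] H.ip_diff_right[OF UNIV_I UNIV_I UNIV_I]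
  H.ip_scale_left[OF UNIV_I UNIV_I] H.ip_scale_right[OF UNIV_I UNIV_I]
  H.ip_neg[OF UNIV_I UNIV_I]

lemma bounded_bilinear_cinner: "bounded_bilinear (cinner :: 'a::chilbert_space \<Rightarrow> 'a \<Rightarrow> complex)"
proof (rule bounded_bilinear.intro)
  show "\<exists>K. \<forall>a b :: 'a. cmod (cinner a b) \<le> norm a * norm b * K"
  proof (intro exI[of _ 1] allI)
    fix a b :: 'a
    show "cmod (cinner a b) \<le> norm a * norm b * 1" using H.Cauchy_Schwarz_ip[of a b] by simp
  qed
qed (auto simp: cinner_simps scaleR_scaleC scaleR_conv_of_real)

lemma bounded_linear_scaleC: "bounded_linear (\<lambda>x :: 'a::chilbert_space. c *\<^sub>C x)"
  by (rule bounded_linear_intro[of _ "cmod c"])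
     (auto simp: scaleC_add_right scaleR_scaleC scaleC_scaleC mult.commute)

lemmas tendsto_cinner [tendsto_intros] = bounded_bilinear.tendsto[OF bounded_bilinear_cinner]
lemmas tendsto_scaleC [tendsto_intros] = bounded_linear.tendsto[OF bounded_linear_scaleC]

text \<open>
  Polarization: replacing \<open>x\<close> by \<open>\<i> x\<close> changes the sign between the two mixed terms, so both
  vanish.
\<close>

lemma sesquilinear_zero_if_diagonal_zero:
  fixes Q :: "'a::chilbert_space \<Rightarrow> 'a"
  assumes V: "csubspace V"
    and add: "\<And>x y. x \<in> V \<Longrightarrow> y \<in> V \<Longrightarrow> Q (x + y) = Q x + Q y"
    and scale: "\<And>c x. x \<in> V \<Longrightarrow> Q (c *\<^sub>C x) = c *\<^sub>C Q x"
    and diag: "\<And>x. x \<in> V \<Longrightarrow> cinner (Q x) x = 0"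
    and x: "x \<in> V" and y: "y \<in> V"
  shows "cinner (Q x) y = 0"
proof -
  have expand: "cinner (Q u) v + cinner (Q v) u = 0" if u: "u \<in> V" and v: "v \<in> V" for u v
  proof -
    have "0 = cinner (Q (u + v)) (u + v)"
      using diag[OF cvec.subspace_add[OF V u v]] by (rule sym)
    also have "\<dots> = cinner (Q u) u + cinner (Q u) v + (cinner (Q v) u + cinner (Q v) v)"
      by (simp only: add[OF u v] cinner_simps add_ac)
    finally show ?thesis using diag[OF u] diag[OF v] by simp
  qed
  have "\<i> *\<^sub>C x \<in> V" by (rule cvec.subspace_scale[OF V x])
  from expand[OF this y] have "\<i> * (cinner (Q x) y - cinner (Q y) x) = 0"
    unfolding scale[OF x] cinner_simps by (simp add: algebra_simps)
  with expand[OF x y] show ?thesis by simp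
qed

section \<open>Spectral measures\<close>

locale spectral =
  fixes E :: "real set \<Rightarrow> 'a::chilbert_space \<Rightarrow> 'a"
  assumes spectral_measure: "spectral_measure E"
begin

lemma E_proj: "B \<in> sets borel \<Longrightarrow> orthogonal_projection (E B)"
  and E_UNIV [simp]: "E UNIV x = x"
  and E_sums: "range D \<subseteq> sets borel \<Longrightarrow> disjoint_family D \<Longrightarrow> (\<lambda>n. E (D n) x) sums E (\<Union>n. D n) x"
  using spectral_measure by (auto simp: spectral_measure_def)

lemma E_add: "B \<in> sets borel \<Longrightarrow> E B (x + y) = E B x + E B y"
  and E_scale: "B \<in> sets borel \<Longrightarrow> E B (c *\<^sub>C x) = c *\<^sub>C E B x"
  and E_idem: "B \<in> sets borel \<Longrightarrow> E B (E B x) = E B x"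
  and E_sym: "B \<in> sets borel \<Longrightarrow> cinner (E B x) y = cinner x (E B y)"
  using E_proj[of B] by (auto simp: orthogonal_projection_def linear_operator_def fun_eq_iff)

lemma E_empty [simp]: "E {} x = 0"
proof -
  have "summable (\<lambda>n :: nat. E {} x)"
    using E_sums[of "\<lambda>_. {}" x] by (auto simp: disjoint_family_on_def sums_iff)
  then show ?thesis by (simp add: summable_const_iff)
qed

lemma E_Un:
  assumes "A \<in> sets borel" "B \<in> sets borel" "A \<inter> B = {}"
  shows "E (A \<union> B) x = E A x + E B x"
proof -
  have "(\<lambda>n. E (binaryset A B n) x) sums E (\<Union>n. binaryset A B n) x"
    using assms by (intro E_sums) (auto simp: binaryset_def disjoint_family_on_def)
  moreover have "(\<lambda>n. E (binaryset A B n) x) sums (E A x + E B x)"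
    using sums_finite[of "{0, Suc 0}" "\<lambda>n. E (binaryset A B n) x"] by (simp add: binaryset_def)
  ultimately show ?thesis by (simp add: UN_binaryset_eq sums_unique2)
qed

lemma E_compl: "B \<in> sets borel \<Longrightarrow> E (- B) x = x - E B x"
  using E_Un[of B "- B" x] by (simp add: algebra_simps)

lemma cinner_E_self: "B \<in> sets borel \<Longrightarrow> cinner (E B x) x = complex_of_real ((norm (E B x))\<^sup>2)"
  using E_sym[of B "E B x" x] by (simp add: E_idem cinner_self)

text \<open>
  A vector in the range of \<open>E B\<close> is annihilated by \<open>E (- B)\<close>, which is the sum of the positive
  operators \<open>E A\<close> and \<open>E (- B - A)\<close>; so each of the two annihilates it.
\<close>

lemma E_disjoint:
  assumes A: "A \<in> sets borel" and B: "B \<in> sets borel" and "A \<inter> B = {}"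
  shows "E A (E B x) = 0"
proof -
  define y where "y = E B x"
  have "E (- B) y = 0" using B by (simp add: y_def E_compl E_idem)
  moreover have "E (- B) y = E A y + E (- B - A) y"
    using E_Un[of A "- B - A" y] A B assms(3) by (simp add: Un_absorb1 Un_Diff_cancel disjoint_eq_subset_Compl)
  ultimately have "cinner (E A y) y + cinner (E (- B - A) y) y = 0"
    by (metis H.ip_zero(1) UNIV_I cinner_add_left)
  moreover have "- B - A \<in> sets borel" using A B by auto
  ultimately have "complex_of_real ((norm (E A y))\<^sup>2 + (norm (E (- B - A) y))\<^sup>2) = 0"
    using A by (simp add: cinner_E_self)
  then show ?thesis by (simp add: y_def sum_power2_eq_zero_iff flip: of_real_add of_real_power)
qed

lemma E_Int:
  assumes A: "A \<in> sets borel" and B: "B \<in> sets borel"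
  shows "E A (E B x) = E (A \<inter> B) x"
proof -
  have "E A (E B x) = E (A \<inter> B) (E B x) + E (A - B) (E B x)"
    using E_Un[of "A \<inter> B" "A - B" "E B x"] A B by (simp add: Int_Diff_Un Int_Diff_disjoint)
  moreover have "E (A - B) (E B x) = 0" using A B by (intro E_disjoint) auto
  moreover have "E B x = E (A \<inter> B) x + E (B - A) x"
    using E_Un[of "B \<inter> A" "B - A" x] A B by (simp add: Int_commute[of A B] Int_Diff_Un Int_Diff_disjoint)
  moreover have "E (A \<inter> B) (E (A \<inter> B) x + E (B - A) x) = E (A \<inter> B) x"
    using A B E_disjoint[of "A \<inter> B" "B - A" x] by (auto simp: E_add E_idem)
  ultimately show ?thesis by simp
qed

lemma norm_E_le: "B \<in> sets borel \<Longrightarrow> norm (E B x) \<le> norm x"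
proof -
  assume B: "B \<in> sets borel"
  have "cmod (cinner (E B x) x) \<le> norm (E B x) * norm x"
    using H.Cauchy_Schwarz_ip[of "E B x" x] by simp
  then have "norm (E B x) * norm (E B x) \<le> norm (E B x) * norm x"
    using B by (simp add: cinner_E_self power2_eq_square norm_mult)
  then show ?thesis by (cases "norm (E B x) = 0") auto
qed

lemma bounded_linear_E: "B \<in> sets borel \<Longrightarrow> bounded_linear (E B)"
  by (rule bounded_linear_intro[of _ 1]) (auto simp: E_add E_scale scaleR_scaleC norm_E_le)

subsection \<open>The scalar measures\<close>

abbreviation \<mu> :: "'a \<Rightarrow> real measure" where "\<mu> \<equiv> scalar_measure E"

lemma space_scalar [simp]: "space (\<mu> x) = UNIV"
  and sets_scalar [simp, measurable_cong]: "sets (\<mu> x) = sets borel"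
  by (simp_all add: scalar_measure_def space_measure_of_conv sets.sigma_sets_eq[of borel, simplified])

lemma emeasure_scalar:
  assumes "B \<in> sets borel"
  shows "emeasure (\<mu> x) B = ennreal ((norm (E B x))\<^sup>2)"
proof -
  have eq: "Re (cinner (E B x) x) = (norm (E B x))\<^sup>2" if "B \<in> sets borel" for B
    by (simp only: cinner_E_self[OF that] Re_complex_of_real)
  have "countably_additive (sets borel) (\<lambda>B. ennreal (Re (cinner (E B x) x)))"
  proof (rule countably_additiveI)
    fix D :: "nat \<Rightarrow> real set"
    assume D: "range D \<subseteq> sets borel" "disjoint_family D" "\<Union> (range D) \<in> sets borel"
    have "(\<lambda>n. Re (cinner (E (D n) x) x)) sums Re (cinner (E (\<Union>n. D n) x) x)"
      using bounded_linear.sums[OF bounded_linear_compose[OF bounded_linear_Re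
            bounded_bilinear.bounded_linear_left[OF bounded_bilinear_cinner]] E_sums[OF D(1,2)]]
      by simp
    then show "(\<Sum>n. ennreal (Re (cinner (E (D n) x) x))) = ennreal (Re (cinner (E (\<Union> (range D)) x) x))"
      using D by (intro suminf_ennreal_eq) (auto simp: eq range_subsetD)
  qed
  moreover have "positive (sets borel) (\<lambda>B. ennreal (Re (cinner (E B x) x)))"
    by (simp add: positive_def)
  ultimately have "emeasure (\<mu> x) B = ennreal (Re (cinner (E B x) x))"
    using assms by (intro emeasure_measure_of[OF scalar_measure_def]) auto
  then show ?thesis using assms by (simp add: eq)
qed

sublocale scalar: finite_measure "\<mu> x" for x
  by (rule finite_measureI) (simp add: emeasure_scalar)

lemma measure_scalar: "B \<in> sets borel \<Longrightarrow> measure (\<mu> x) B = (norm (E B x))\<^sup>2"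
  by (simp add: measure_def emeasure_scalar)

lemma cinner_E_E:
  assumes A: "A \<in> sets borel" and B: "B \<in> sets borel"
  shows "cinner (E A x) (E B x) = complex_of_real (measure (\<mu> x) (A \<inter> B))"
proof -
  have "cinner (E A x) (E B x) = cinner (E (B \<inter> A) x) x"
    using A B E_sym[of B "E A x" x] by (simp add: E_Int)
  then show ?thesis using A B by (simp add: cinner_E_self measure_scalar Int_commute)
qed

end

subsection \<open>Bounded Borel functions and step functions\<close>

definition bounded_borel :: "(real \<Rightarrow> complex) \<Rightarrow> bool" where
  "bounded_borel \<phi> \<longleftrightarrow> \<phi> \<in> borel_measurable borel \<and> (\<exists>M. \<forall>t. cmod (\<phi> t) \<le> M)"

lemma bounded_borelI:
  "\<phi> \<in> borel_measurable borel \<Longrightarrow> (\<And>t. cmod (\<phi> t) \<le> M) \<Longrightarrow> bounded_borel \<phi>"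
  by (auto simp: bounded_borel_def)

lemma bounded_borel_measurable [measurable_dest]: "bounded_borel \<phi> \<Longrightarrow> \<phi> \<in> borel_measurable borel"
  by (simp add: bounded_borel_def)

lemma bounded_borel_const [simp]: "bounded_borel (\<lambda>_. c)"
  by (rule bounded_borelI) auto

lemma bounded_borel_indicator [simp]: "B \<in> sets borel \<Longrightarrow> bounded_borel (indicator B)"
  by (rule bounded_borelI[of _ 1]) (auto simp: indicator_def)

lemma bounded_borel_add:
  assumes "bounded_borel \<phi>" "bounded_borel \<psi>"
  shows "bounded_borel (\<lambda>t. \<phi> t + \<psi> t)"
proof -
  obtain M N where "\<And>t. cmod (\<phi> t) \<le> M" "\<And>t. cmod (\<psi> t) \<le> N"
    using assms by (auto simp: bounded_borel_def)
  then show ?thesis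
    using assms by (intro bounded_borelI[of _ "M + N"]) (auto intro: norm_triangle_le add_mono)
qed

lemma bounded_borel_mult:
  assumes "bounded_borel \<phi>" "bounded_borel \<psi>"
  shows "bounded_borel (\<lambda>t. \<phi> t * \<psi> t)"
proof -
  obtain M N where MN: "\<And>t. cmod (\<phi> t) \<le> M" "\<And>t. cmod (\<psi> t) \<le> N"
    using assms by (auto simp: bounded_borel_def)
  have "cmod (\<phi> t * \<psi> t) \<le> M * N" for t
    using MN[of t] mult_mono[of "cmod (\<phi> t)" M "cmod (\<psi> t)" N] order_trans[OF norm_ge_zero MN(1)]
    by (simp add: norm_mult)
  then show ?thesis
    using assms by (intro bounded_borelI[of _ "M * N"]) auto
qed

lemma bounded_borel_scale: "bounded_borel \<phi> \<Longrightarrow> bounded_borel (\<lambda>t. c * \<phi> t)"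
  by (rule bounded_borel_mult) auto

lemma bounded_borel_diff:
  assumes "bounded_borel \<phi>" "bounded_borel \<psi>"
  shows "bounded_borel (\<lambda>t. \<phi> t - \<psi> t)"
  using bounded_borel_add[OF assms(1) bounded_borel_scale[OF assms(2), of "-1"]] by simp

lemma bounded_borel_cnj: "bounded_borel \<phi> \<Longrightarrow> bounded_borel (\<lambda>t. cnj (\<phi> t))"
  using measurable_compose[OF _ borel_measurable_continuous_onI[OF continuous_on_cnj[OF continuous_on_id]], of \<phi> borel]
  by (auto simp: bounded_borel_def)

lemmas bounded_borel_intros = bounded_borel_const bounded_borel_indicator bounded_borel_add
  bounded_borel_mult bounded_borel_diff bounded_borel_cnj

text \<open>
  A step function is given by a list of weighted sets, which may overlap and repeat. Sums and products
  with indicator functions are then operations on lists, and no normal form has to be maintained.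
\<close>

type_synonym step_list = "(complex \<times> real set) list"

definition step_fun :: "step_list \<Rightarrow> real \<Rightarrow> complex" where
  "step_fun l t = (\<Sum>(c, B)\<leftarrow>l. c * indicator B t)"

definition borel_steps :: "step_list \<Rightarrow> bool" where
  "borel_steps l \<longleftrightarrow> (\<forall>(c, B)\<in>set l. B \<in> sets borel)"

lemma step_fun_simps [simp]:
  "step_fun [] t = 0"
  "step_fun ((c, B) # l) t = c * indicator B t + step_fun l t"
  "step_fun (l @ m) t = step_fun l t + step_fun m t"
  by (simp_all add: step_fun_def)

lemma borel_steps_simps [simp]:
  "borel_steps []"
  "borel_steps ((c, B) # l) \<longleftrightarrow> B \<in> sets borel \<and> borel_steps l"
  "borel_steps (l @ m) \<longleftrightarrow> borel_steps l \<and> borel_steps m"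
  by (auto simp: borel_steps_def)

lemma bounded_borel_step_fun: "borel_steps l \<Longrightarrow> bounded_borel (step_fun l)"
proof (induction l)
  case Nil
  have "step_fun [] = (\<lambda>_. 0)" by auto
  then show ?case by simp
next
  case (Cons p l)
  obtain c B where p: "p = (c, B)" by force
  have "step_fun (p # l) = (\<lambda>t. c * indicator B t + step_fun l t)" by (auto simp: p)
  then show ?case using Cons by (simp add: p bounded_borel_intros)
qed

text \<open>
  Rounding real and imaginary part down to multiples of a small number leaves only finitely many
  values.
\<close>

lemma ex_step_fun_approx:
  assumes \<phi>: "bounded_borel \<phi>" and e: "e > 0"
  obtains l where "borel_steps l" "\<And>t. cmod (step_fun l t - \<phi> t) \<le> e"
proof -
  define k where "k = e / 2"
  have k: "k > 0" using e by (simp add: k_def)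
  define g where "g t = Complex (k * \<lfloor>Re (\<phi> t) / k\<rfloor>) (k * \<lfloor>Im (\<phi> t) / k\<rfloor>)" for t
  obtain M where M: "\<And>t. cmod (\<phi> t) \<le> M" using \<phi> by (auto simp: bounded_borel_def)
  have [measurable]: "\<phi> \<in> borel_measurable borel" using \<phi> by (rule bounded_borel_measurable)
  have meas: "g \<in> borel_measurable borel"
    unfolding g_def Complex_eq by measurable
  have round: "\<bar>k * \<lfloor>x / k\<rfloor> - x\<bar> \<le> k" for x
  proof -
    have "x - k * \<lfloor>x / k\<rfloor> = k * frac (x / k)" using k by (simp add: frac_def algebra_simps)
    then show ?thesis using k frac_lt_1[of "x / k"] by (simp add: abs_minus_commute)
  qed
  have close: "cmod (g t - \<phi> t) \<le> e" for t
    using cmod_le[of "g t - \<phi> t"] round[of "Re (\<phi> t)"] round[of "Im (\<phi> t)"]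
    by (simp add: g_def k_def)
  define N where "N = \<lceil>M / k\<rceil> + 1"
  have fl: "\<lfloor>x / k\<rfloor> \<in> {-N..N}" if "\<bar>x\<bar> \<le> M" for x
  proof -
    have "x / k \<le> M / k" "- (M / k) \<le> x / k"
      using that k by (auto simp: abs_le_iff field_simps)
    then show ?thesis unfolding N_def atLeastAtMost_iff by linarith
  qed
  have "g t \<in> (\<lambda>(i, j). Complex (k * real_of_int i) (k * real_of_int j)) ` ({-N..N} \<times> {-N..N})" for t
  proof (rule image_eqI)
    show "g t = (\<lambda>(i, j). Complex (k * real_of_int i) (k * real_of_int j))
        (\<lfloor>Re (\<phi> t) / k\<rfloor>, \<lfloor>Im (\<phi> t) / k\<rfloor>)" by (simp add: g_def)
    show "(\<lfloor>Re (\<phi> t) / k\<rfloor>, \<lfloor>Im (\<phi> t) / k\<rfloor>) \<in> {-N..N} \<times> {-N..N}"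
      using fl[OF order_trans[OF abs_Re_le_cmod M]] fl[OF order_trans[OF abs_Im_le_cmod M]] by blast
  qed
  then have "range g \<subseteq> (\<lambda>(i, j). Complex (k * real_of_int i) (k * real_of_int j)) ` ({-N..N} \<times> {-N..N})"
    by blast
  then have fin: "finite (range g)" by (rule finite_subset) simp
  obtain zs where zs: "set zs = range g" "distinct zs" using finite_distinct_list[OF fin] by auto
  define l where "l = map (\<lambda>z. (z, g -` {z})) zs"
  have "step_fun l t = g t" for t
  proof -
    have "step_fun l t = (\<Sum>z\<in>range g. z * indicator (g -` {z}) t)"
      using zs by (simp add: step_fun_def l_def comp_def sum_list_distinct_conv_sum_set)
    also have "\<dots> = (\<Sum>z\<in>range g. if z = g t then z else 0)"
      by (intro sum.cong) (auto simp: indicator_def)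
    also have "\<dots> = g t" using fin by (simp add: sum.delta)
    finally show ?thesis .
  qed
  moreover have "g -` {z} \<in> sets borel" for z
    using measurable_sets[OF meas, of "{z}"] by simp
  then have "borel_steps l" by (auto simp: borel_steps_def l_def)
  ultimately show ?thesis using that[of l] close by simp
qed

section \<open>The functional calculus\<close>

context spectral
begin

lemma integrable_bounded_borel: "bounded_borel \<phi> \<Longrightarrow> integrable (\<mu> f) \<phi>"
  by (auto simp: bounded_borel_def intro!: scalar.integrable_const_bound)

definition step_op :: "step_list \<Rightarrow> 'a \<Rightarrow> 'a" where
  "step_op l f = (\<Sum>(c, B)\<leftarrow>l. c *\<^sub>C E B f)"

lemma step_op_simps [simp]:
  "step_op [] f = 0"
  "step_op ((c, B) # l) f = c *\<^sub>C E B f + step_op l f"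
  "step_op (l @ m) f = step_op l f + step_op m f"
  by (simp_all add: step_op_def)

text \<open>
  Both sides are sesquilinear, so this is the identity \<open>(E A f, E B f) = \<mu> f (A \<inter> B)\<close>.
\<close>

lemma cinner_step_op:
  assumes "borel_steps l" "borel_steps m"
  shows "cinner (step_op l f) (step_op m f) = (\<integral>t. step_fun l t * cnj (step_fun m t) \<partial>\<mu> f)"
  using assms(1)
proof (induction l)
  case (Cons p l)
  obtain c A where p: "p = (c, A)" by force
  have A: "A \<in> sets borel" and l: "borel_steps l" using Cons.prems by (auto simp: p)
  have "cinner (c *\<^sub>C E A f) (step_op m f) = (\<integral>t. c * indicator A t * cnj (step_fun m t) \<partial>\<mu> f)"
    using assms(2)
  proof (induction m)
    case (Cons q m)
    obtain d B where q: "q = (d, B)" by force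
    have B: "B \<in> sets borel" and m: "borel_steps m" using Cons.prems by (auto simp: q)
    have "(\<integral>t. c * indicator A t * cnj (d * indicator B t) \<partial>\<mu> f)
        = (\<integral>t. indicator (A \<inter> B) t *\<^sub>R (c * cnj d) \<partial>\<mu> f)"
      by (intro Bochner_Integration.integral_cong) (auto simp: indicator_def)
    also have "\<dots> = cinner (c *\<^sub>C E A f) (d *\<^sub>C E B f)"
      using A B by (simp add: cinner_simps cinner_E_E scaleR_conv_of_real)
    finally have 1: "(\<integral>t. c * indicator A t * cnj (d * indicator B t) \<partial>\<mu> f)
      = cinner (c *\<^sub>C E A f) (d *\<^sub>C E B f)" .
    have "(\<integral>t. c * indicator A t * cnj (d * indicator B t) + c * indicator A t * cnj (step_fun m t) \<partial>\<mu> f)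
      = (\<integral>t. c * indicator A t * cnj (d * indicator B t) \<partial>\<mu> f)
        + (\<integral>t. c * indicator A t * cnj (step_fun m t) \<partial>\<mu> f)"
      using A B m by (intro Bochner_Integration.integral_add integrable_bounded_borel)
        (auto intro!: bounded_borel_intros bounded_borel_step_fun)
    then show ?case unfolding 1 using Cons.IH[OF m]
      by (simp add: q H.ip_add_right distrib_left)
  qed simp
  moreover have "(\<integral>t. c * indicator A t * cnj (step_fun m t) + step_fun l t * cnj (step_fun m t) \<partial>\<mu> f)
    = (\<integral>t. c * indicator A t * cnj (step_fun m t) \<partial>\<mu> f)
      + (\<integral>t. step_fun l t * cnj (step_fun m t) \<partial>\<mu> f)"
    using A l assms(2) by (intro Bochner_Integration.integral_add integrable_bounded_borel)
      (auto intro!: bounded_borel_intros bounded_borel_step_fun)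
  ultimately show ?case using Cons.IH[OF l] by (simp add: p cinner_add_left distrib_right)
qed simp

lemma norm_step_op_le:
  assumes l: "borel_steps l" and e: "\<And>t. cmod (step_fun l t) \<le> e"
  shows "norm (step_op l f) \<le> e * norm f"
proof (rule power2_le_imp_le)
  have e0: "e \<ge> 0" using order_trans[OF norm_ge_zero e] .
  then show "0 \<le> e * norm f" by simp
  have bb: "bounded_borel (\<lambda>t. step_fun l t * cnj (step_fun l t))"
    using l by (intro bounded_borel_intros bounded_borel_step_fun)
  have "(norm (step_op l f))\<^sup>2 = cmod (cinner (step_op l f) (step_op l f))"
    by (simp add: cinner_self norm_power)
  also have "\<dots> \<le> (\<integral>t. cmod (step_fun l t * cnj (step_fun l t)) \<partial>\<mu> f)"
    unfolding cinner_step_op[OF l l] by (rule integral_norm_bound)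
  also have "\<dots> \<le> (\<integral>t. e\<^sup>2 \<partial>\<mu> f)"
    using e e0 by (intro integral_mono integrable_norm[OF integrable_bounded_borel[OF bb]])
      (auto simp: norm_mult power2_eq_square intro!: mult_mono)
  also have "\<dots> = (e * norm f)\<^sup>2" by (simp add: measure_scalar power_mult_distrib)
  finally show "(norm (step_op l f))\<^sup>2 \<le> (e * norm f)\<^sup>2" .
qed

definition step_map :: "(complex \<Rightarrow> complex) \<Rightarrow> (real set \<Rightarrow> real set) \<Rightarrow> step_list \<Rightarrow> step_list" where
  "step_map u v l = map (\<lambda>(c, B). (u c, v B)) l"

lemma step_scale:
  "borel_steps l \<Longrightarrow> borel_steps (step_map ((*) c) id l)"
  "step_fun (step_map ((*) c) id l) t = c * step_fun l t"
  "step_op (step_map ((*) c) id l) f = c *\<^sub>C step_op l f"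
  by (induction l)
    (auto simp: step_map_def algebra_simps scaleC_add_right scaleC_scaleC)

lemma step_restrict:
  assumes A: "A \<in> sets borel"
  shows "borel_steps l \<Longrightarrow> borel_steps (step_map id ((\<inter>) A) l)"
    and "step_fun (step_map id ((\<inter>) A) l) t = indicator A t * step_fun l t"
    and "borel_steps l \<Longrightarrow> step_op (step_map id ((\<inter>) A) l) f = E A (step_op l f)"
proof -
  have "E A 0 = 0" using E_scale[OF A, of 0 0] by simp
  then show "borel_steps l \<Longrightarrow> borel_steps (step_map id ((\<inter>) A) l)"
    and "step_fun (step_map id ((\<inter>) A) l) t = indicator A t * step_fun l t"
    and "borel_steps l \<Longrightarrow> step_op (step_map id ((\<inter>) A) l) f = E A (step_op l f)"
    using A by (induction l)
      (auto simp: step_map_def algebra_simps E_add E_scale E_Int indicator_inter_arith)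
qed

lemma step_op_diff_le:
  assumes l: "borel_steps l" and m: "borel_steps m" and e: "\<And>t. cmod (step_fun l t - step_fun m t) \<le> e"
  shows "norm (step_op l f - step_op m f) \<le> e * norm f"
  using norm_step_op_le[of "l @ step_map ((*) (-1)) id m" e f] l m e
  by (simp add: step_scale cvec.scale_minus_left)

text \<open>
  Since the norm of \<open>step_op l f\<close> is at most \<open>sup |step_fun l|\<close> times that of \<open>f\<close>, uniform approximation by
  step functions defines the integral of a bounded Borel function.
\<close>

definition steps :: "(real \<Rightarrow> complex) \<Rightarrow> nat \<Rightarrow> step_list" where
  "steps \<phi> n = (SOME l. borel_steps l \<and> (\<forall>t. cmod (step_fun l t - \<phi> t) \<le> 1 / Suc n))"

definition fcalc :: "(real \<Rightarrow> complex) \<Rightarrow> 'a \<Rightarrow> 'a" where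
  "fcalc \<phi> f = lim (\<lambda>n. step_op (steps \<phi> n) f)"

lemma
  assumes "bounded_borel \<phi>"
  shows borel_steps_steps: "borel_steps (steps \<phi> n)"
    and steps_close: "cmod (step_fun (steps \<phi> n) t - \<phi> t) \<le> 1 / Suc n"
proof -
  have "\<exists>l. borel_steps l \<and> (\<forall>t. cmod (step_fun l t - \<phi> t) \<le> 1 / Suc n)"
    using ex_step_fun_approx[OF assms, of "1 / Suc n"] by (metis divide_pos_pos of_nat_0_less_iff zero_less_Suc zero_less_one)
  from someI_ex[OF this] show "borel_steps (steps \<phi> n)" "cmod (step_fun (steps \<phi> n) t - \<phi> t) \<le> 1 / Suc n"
    by (auto simp: steps_def)
qed

lemma step_op_steps_tendsto:
  assumes \<phi>: "bounded_borel \<phi>"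
  shows "(\<lambda>n. step_op (steps \<phi> n) f) \<longlonglongrightarrow> fcalc \<phi> f"
proof -
  have bd: "norm (step_op (steps \<phi> m) f - step_op (steps \<phi> n) f) \<le> (1 / Suc m + 1 / Suc n) * norm f" for m n
  proof (intro step_op_diff_le borel_steps_steps[OF \<phi>])
    fix t
    show "cmod (step_fun (steps \<phi> m) t - step_fun (steps \<phi> n) t) \<le> 1 / Suc m + 1 / Suc n"
      using norm_triangle_ineq4[of "step_fun (steps \<phi> m) t - \<phi> t" "step_fun (steps \<phi> n) t - \<phi> t"]
        steps_close[OF \<phi>, of m t] steps_close[OF \<phi>, of n t] by simp
  qed
  have "Cauchy (\<lambda>n. step_op (steps \<phi> n) f)"
  proof (rule metric_CauchyI)
    fix e :: real
    assume e: "e > 0"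
    have "(\<lambda>n. 2 * norm f / Suc n) \<longlonglongrightarrow> 0"
      using tendsto_mult[OF tendsto_const LIMSEQ_inverse_real_of_nat, of "2 * norm f"]
      by (simp add: divide_inverse)
    then obtain N where N: "2 * norm f / Suc N < e"
      using e by (metis (no_types, lifting) eventually_sequentially order_refl order_tendstoD(2))
    have "dist (step_op (steps \<phi> m) f) (step_op (steps \<phi> n) f) < e" if "m \<ge> N" "n \<ge> N" for m n
    proof -
      have "1 / Suc m + 1 / Suc n \<le> 1 / Suc N + 1 / Suc N"
        using that by (intro add_mono divide_left_mono) auto
      then have "(1 / Suc m + 1 / Suc n) * norm f \<le> (1 / Suc N + 1 / Suc N) * norm f"
        by (rule mult_right_mono) simp
      with bd[of m n] N show ?thesis by (simp add: dist_norm)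
    qed
    then show "\<exists>M. \<forall>m\<ge>M. \<forall>n\<ge>M. dist (step_op (steps \<phi> m) f) (step_op (steps \<phi> n) f) < e" by blast
  qed
  then show ?thesis unfolding fcalc_def using Cauchy_convergent convergent_LIMSEQ_iff by blast
qed

lemma step_op_fcalc_le:
  assumes \<phi>: "bounded_borel \<phi>" and l: "borel_steps l"
    and e: "\<And>t. cmod (step_fun l t - \<phi> t) \<le> e"
  shows "norm (step_op l f - fcalc \<phi> f) \<le> e * norm f"
proof (rule LIMSEQ_le)
  show "(\<lambda>n. norm (step_op l f - step_op (steps \<phi> n) f)) \<longlonglongrightarrow> norm (step_op l f - fcalc \<phi> f)"
    by (intro tendsto_intros step_op_steps_tendsto \<phi>)
  have "(\<lambda>n. (e + inverse (real (Suc n))) * norm f) \<longlonglongrightarrow> (e + 0) * norm f"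
    by (intro tendsto_intros LIMSEQ_inverse_real_of_nat)
  then show "(\<lambda>n. (e + 1 / Suc n) * norm f) \<longlonglongrightarrow> e * norm f" by (simp add: divide_inverse)
  have "norm (step_op l f - step_op (steps \<phi> n) f) \<le> (e + 1 / Suc n) * norm f" for n
  proof (intro step_op_diff_le l borel_steps_steps[OF \<phi>])
    fix t
    show "cmod (step_fun l t - step_fun (steps \<phi> n) t) \<le> e + 1 / Suc n"
      using norm_triangle_ineq4[of "step_fun l t - \<phi> t" "step_fun (steps \<phi> n) t - \<phi> t"]
        e[of t] steps_close[OF \<phi>, of n t] by simp
  qed
  then show "\<exists>N. \<forall>n\<ge>N. norm (step_op l f - step_op (steps \<phi> n) f) \<le> (e + 1 / Suc n) * norm f" by blast
qed

lemma step_op_tendsto_fcalc: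
  assumes \<phi>: "bounded_borel \<phi>" and l: "\<And>n. borel_steps (l n)"
    and r: "\<And>n t. cmod (step_fun (l n) t - \<phi> t) \<le> r n" "r \<longlonglongrightarrow> 0"
  shows "(\<lambda>n. step_op (l n) f) \<longlonglongrightarrow> fcalc \<phi> f"
proof (rule LIM_zero_cancel, rule Lim_null_comparison)
  show "\<forall>\<^sub>F n in sequentially. norm (step_op (l n) f - fcalc \<phi> f) \<le> r n * norm f"
    using step_op_fcalc_le[OF \<phi> l r(1)] by simp
  show "(\<lambda>n. r n * norm f) \<longlonglongrightarrow> 0" using tendsto_mult_left_zero[OF r(2)] .
qed

lemma inverse_Suc_tendsto: "(\<lambda>n. c * (1 / real (Suc n))) \<longlonglongrightarrow> 0"
  using tendsto_mult[OF tendsto_const LIMSEQ_inverse_real_of_nat, of c] by (simp add: divide_inverse)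

lemma fcalc_step_fun: "borel_steps l \<Longrightarrow> fcalc (step_fun l) f = step_op l f"
  using step_op_fcalc_le[of "step_fun l" l 0 f] by (simp add: bounded_borel_step_fun)

lemma fcalc_indicator: "B \<in> sets borel \<Longrightarrow> fcalc (indicator B) f = E B f"
proof -
  have "step_fun [(1, B)] = indicator B" by (simp add: fun_eq_iff)
  then show "B \<in> sets borel \<Longrightarrow> ?thesis" using fcalc_step_fun[of "[(1, B)]" f] by (simp add: scaleC_one)
qed

lemma fcalc_1: "fcalc (\<lambda>_. 1) f = f"
proof -
  have "indicator UNIV = (\<lambda>_ :: real. 1 :: complex)" by (simp add: fun_eq_iff)
  then show ?thesis using fcalc_indicator[of UNIV f] by simp
qed

lemma fcalc_add:
  assumes "bounded_borel \<phi>" "bounded_borel \<psi>"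
  shows "fcalc (\<lambda>t. \<phi> t + \<psi> t) f = fcalc \<phi> f + fcalc \<psi> f"
proof (rule LIMSEQ_unique)
  show "(\<lambda>n. step_op (steps \<phi> n @ steps \<psi> n) f) \<longlonglongrightarrow> fcalc (\<lambda>t. \<phi> t + \<psi> t) f"
  proof (rule step_op_tendsto_fcalc)
    show "cmod (step_fun (steps \<phi> n @ steps \<psi> n) t - (\<phi> t + \<psi> t)) \<le> 2 * (1 / real (Suc n))" for n t
      using norm_triangle_ineq[of "step_fun (steps \<phi> n) t - \<phi> t" "step_fun (steps \<psi> n) t - \<psi> t"]
        steps_close[OF assms(1), of n t] steps_close[OF assms(2), of n t]
      by (simp add: algebra_simps)
    show "(\<lambda>n. 2 * (1 / real (Suc n))) \<longlonglongrightarrow> 0" by (rule inverse_Suc_tendsto)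
  qed (use assms in \<open>auto intro: bounded_borel_add borel_steps_steps\<close>)
  show "(\<lambda>n. step_op (steps \<phi> n @ steps \<psi> n) f) \<longlonglongrightarrow> fcalc \<phi> f + fcalc \<psi> f"
    using assms by (simp add: tendsto_add step_op_steps_tendsto)
qed

lemma fcalc_scale:
  assumes "bounded_borel \<phi>"
  shows "fcalc (\<lambda>t. c * \<phi> t) f = c *\<^sub>C fcalc \<phi> f"
proof (rule LIMSEQ_unique)
  show "(\<lambda>n. step_op (step_map ((*) c) id (steps \<phi> n)) f) \<longlonglongrightarrow> fcalc (\<lambda>t. c * \<phi> t) f"
  proof (rule step_op_tendsto_fcalc)
    show "cmod (step_fun (step_map ((*) c) id (steps \<phi> n)) t - c * \<phi> t) \<le> cmod c * (1 / real (Suc n))" for n t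
      using mult_left_mono[OF steps_close[OF assms, of n t], of "cmod c"]
      by (simp add: step_scale norm_mult flip: right_diff_distrib)
    show "(\<lambda>n. cmod c * (1 / real (Suc n))) \<longlonglongrightarrow> 0" by (rule inverse_Suc_tendsto)
  qed (use assms in \<open>auto intro: bounded_borel_scale borel_steps_steps step_scale\<close>)
  show "(\<lambda>n. step_op (step_map ((*) c) id (steps \<phi> n)) f) \<longlonglongrightarrow> c *\<^sub>C fcalc \<phi> f"
    using assms by (simp add: step_scale tendsto_scaleC step_op_steps_tendsto)
qed

lemma fcalc_diff:
  assumes "bounded_borel \<phi>" "bounded_borel \<psi>"
  shows "fcalc (\<lambda>t. \<phi> t - \<psi> t) f = fcalc \<phi> f - fcalc \<psi> f"
  using fcalc_add[OF assms(1) bounded_borel_scale[OF assms(2)], of "-1" f] fcalc_scale[OF assms(2), of "-1" f]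
  by (simp add: cvec.scale_minus_left)

lemma fcalc_sum_list:
  assumes "\<And>\<phi>. \<phi> \<in> set \<phi>s \<Longrightarrow> bounded_borel \<phi>"
  shows "(\<Sum>\<phi>\<leftarrow>\<phi>s. fcalc \<phi> f) = fcalc (\<lambda>t. \<Sum>\<phi>\<leftarrow>\<phi>s. \<phi> t) f \<and> bounded_borel (\<lambda>t. \<Sum>\<phi>\<leftarrow>\<phi>s. \<phi> t)"
  using assms
proof (induction \<phi>s)
  case Nil
  show ?case using fcalc_scale[of "\<lambda>_. 0" 0 f] by simp
next
  case (Cons \<phi> \<phi>s)
  then show ?case by (simp add: fcalc_add bounded_borel_add)
qed

text \<open>
  The limit of the identity for step functions. It makes \<open>\<phi> \<mapsto> fcalc \<phi> f\<close> isometric for the norm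
  of \<open>L\<^sup>2(\<mu> f)\<close>, so that questions of convergence become questions about integrals.
\<close>

lemma cinner_fcalc:
  assumes \<phi>: "bounded_borel \<phi>" and \<psi>: "bounded_borel \<psi>"
  shows "cinner (fcalc \<phi> f) (fcalc \<psi> f) = (\<integral>t. \<phi> t * cnj (\<psi> t) \<partial>\<mu> f)"
proof (rule LIMSEQ_unique)
  let ?l = "steps \<phi>" and ?m = "steps \<psi>"
  show "(\<lambda>n. cinner (step_op (?l n) f) (step_op (?m n) f)) \<longlonglongrightarrow> cinner (fcalc \<phi> f) (fcalc \<psi> f)"
    by (intro tendsto_intros step_op_steps_tendsto \<phi> \<psi>)
  obtain M N where MN: "\<And>t. cmod (\<phi> t) \<le> M" "\<And>t. cmod (\<psi> t) \<le> N"
    using \<phi> \<psi> by (auto simp: bounded_borel_def)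
  have bd: "cmod (step_fun (steps \<xi> n) t) \<le> L + 1" if "bounded_borel \<xi>" "\<And>t. cmod (\<xi> t) \<le> L" for \<xi> L n t
  proof -
    have "1 / real (Suc n) \<le> 1" by simp
    then show ?thesis
      using norm_triangle_sub[of "step_fun (steps \<xi> n) t" "\<xi> t"] steps_close[OF that(1), of n t] that(2)[of t]
      by linarith
  qed
  have pt: "(\<lambda>n. step_fun (steps \<xi> n) t) \<longlonglongrightarrow> \<xi> t" if "bounded_borel \<xi>" for \<xi> t
  proof (rule LIM_zero_cancel, rule Lim_null_comparison)
    show "\<forall>\<^sub>F n in sequentially. norm (step_fun (steps \<xi> n) t - \<xi> t) \<le> 1 * (1 / real (Suc n))"
      using steps_close[OF that] by simp
  qed (rule inverse_Suc_tendsto)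
  have "(\<lambda>n. \<integral>t. step_fun (?l n) t * cnj (step_fun (?m n) t) \<partial>\<mu> f) \<longlonglongrightarrow> (\<integral>t. \<phi> t * cnj (\<psi> t) \<partial>\<mu> f)"
  proof (rule integral_dominated_convergence[where w = "\<lambda>_. (M + 1) * (N + 1)"])
    show "(\<lambda>t. \<phi> t * cnj (\<psi> t)) \<in> borel_measurable (\<mu> f)"
      using \<phi> \<psi> by (intro borel_measurable_integrable integrable_bounded_borel bounded_borel_intros)
    show "(\<lambda>t. step_fun (?l n) t * cnj (step_fun (?m n) t)) \<in> borel_measurable (\<mu> f)" for n
      using \<phi> \<psi> by (intro borel_measurable_integrable integrable_bounded_borel bounded_borel_intros
          bounded_borel_step_fun borel_steps_steps)
    show "integrable (\<mu> f) (\<lambda>_. (M + 1) * (N + 1))" by simp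
    show "AE t in \<mu> f. (\<lambda>n. step_fun (?l n) t * cnj (step_fun (?m n) t)) \<longlonglongrightarrow> \<phi> t * cnj (\<psi> t)"
      using \<phi> \<psi> by (intro AE_I2 tendsto_intros pt)
    show "AE t in \<mu> f. norm (step_fun (?l n) t * cnj (step_fun (?m n) t)) \<le> (M + 1) * (N + 1)" for n
      using bd[OF \<phi> MN(1)] bd[OF \<psi> MN(2)] order_trans[OF norm_ge_zero bd[OF \<phi> MN(1)]]
      by (intro AE_I2) (auto simp: norm_mult intro!: mult_mono)
  qed
  then show "(\<lambda>n. cinner (step_op (?l n) f) (step_op (?m n) f)) \<longlonglongrightarrow> (\<integral>t. \<phi> t * cnj (\<psi> t) \<partial>\<mu> f)"
    using cinner_step_op[OF borel_steps_steps[OF \<phi>] borel_steps_steps[OF \<psi>]] by simp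
qed

lemma norm_fcalc: "bounded_borel \<phi> \<Longrightarrow> (norm (fcalc \<phi> f))\<^sup>2 = (\<integral>t. (cmod (\<phi> t))\<^sup>2 \<partial>\<mu> f)"
proof -
  assume \<phi>: "bounded_borel \<phi>"
  have "complex_of_real ((norm (fcalc \<phi> f))\<^sup>2) = (\<integral>t. complex_of_real ((cmod (\<phi> t))\<^sup>2) \<partial>\<mu> f)"
    unfolding cinner_self[symmetric] complex_norm_square by (rule cinner_fcalc[OF \<phi> \<phi>])
  then show ?thesis unfolding integral_complex_of_real of_real_eq_iff .
qed

lemma norm_fcalc_le:
  assumes "bounded_borel \<phi>" "\<And>t. cmod (\<phi> t) \<le> M"
  shows "norm (fcalc \<phi> f) \<le> M * norm f"
proof (rule power2_le_imp_le)
  have M: "M \<ge> 0" using order_trans[OF norm_ge_zero assms(2)] .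
  then show "0 \<le> M * norm f" by simp
  have bb: "bounded_borel (\<lambda>t. \<phi> t * \<phi> t)" using assms(1) by (intro bounded_borel_intros)
  have "(norm (fcalc \<phi> f))\<^sup>2 \<le> (\<integral>t. M\<^sup>2 \<partial>\<mu> f)"
    unfolding norm_fcalc[OF assms(1)]
  proof (rule integral_mono)
    show "integrable (\<mu> f) (\<lambda>t. (cmod (\<phi> t))\<^sup>2)"
      using integrable_norm[OF integrable_bounded_borel[OF bb]] by (simp add: norm_mult power2_eq_square)
  qed (use assms(2) M in \<open>auto intro: power_mono\<close>)
  also have "\<dots> = (M * norm f)\<^sup>2" by (simp add: measure_scalar power_mult_distrib)
  finally show "(norm (fcalc \<phi> f))\<^sup>2 \<le> (M * norm f)\<^sup>2" .
qed

text \<open>By the isometry this is dominated convergence in \<open>L\<^sup>2(\<mu> f)\<close>.\<close>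

lemma fcalc_tendsto:
  fixes \<phi> :: "nat \<Rightarrow> real \<Rightarrow> complex"
  assumes \<phi>: "\<And>n. bounded_borel (\<phi> n)" and \<psi>: "bounded_borel \<psi>"
    and bound: "\<And>n t. cmod (\<phi> n t) \<le> M" and pt: "\<And>t. (\<lambda>n. \<phi> n t) \<longlonglongrightarrow> \<psi> t"
  shows "(\<lambda>n. fcalc (\<phi> n) f) \<longlonglongrightarrow> fcalc \<psi> f"
proof -
  have \<psi>M: "cmod (\<psi> t) \<le> M" for t
    by (rule LIMSEQ_le_const2[OF tendsto_norm[OF pt]]) (use bound in auto)
  have bb: "bounded_borel (\<lambda>t. \<phi> n t - \<psi> t)" for n using \<phi> \<psi> by (rule bounded_borel_diff)
  have "(\<lambda>n. \<integral>t. (cmod (\<phi> n t - \<psi> t))\<^sup>2 \<partial>\<mu> f) \<longlonglongrightarrow> (\<integral>t. 0 \<partial>\<mu> f)"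
  proof (rule integral_dominated_convergence[where w = "\<lambda>_. (2 * M)\<^sup>2"])
    show "(\<lambda>t. (cmod (\<phi> n t - \<psi> t))\<^sup>2) \<in> borel_measurable (\<mu> f)" for n
      using bounded_borel_measurable[OF bb[of n]] by measurable
    show "AE t in \<mu> f. (\<lambda>n. (cmod (\<phi> n t - \<psi> t))\<^sup>2) \<longlonglongrightarrow> 0"
      using pt by (auto intro!: AE_I2 tendsto_null_power tendsto_norm_zero LIM_zero)
    show "AE t in \<mu> f. norm ((cmod (\<phi> n t - \<psi> t))\<^sup>2) \<le> (2 * M)\<^sup>2" for n
    proof (rule AE_I2)
      fix t
      have "cmod (\<phi> n t - \<psi> t) \<le> 2 * M"
        using norm_triangle_ineq4[of "\<phi> n t" "\<psi> t"] bound[of n t] \<psi>M[of t] by simp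
      then have "(cmod (\<phi> n t - \<psi> t))\<^sup>2 \<le> (2 * M)\<^sup>2" by (rule power_mono) simp
      then show "norm ((cmod (\<phi> n t - \<psi> t))\<^sup>2) \<le> (2 * M)\<^sup>2" by simp
    qed
  qed auto
  then have "(\<lambda>n. (norm (fcalc (\<phi> n) f - fcalc \<psi> f))\<^sup>2) \<longlonglongrightarrow> 0"
    by (simp add: norm_fcalc[OF bb] flip: fcalc_diff[OF \<phi> \<psi>])
  then have "(\<lambda>n. norm (fcalc (\<phi> n) f - fcalc \<psi> f)) \<longlonglongrightarrow> 0"
    by (simp add: power_tendsto_0_iff)
  then show ?thesis by (rule LIM_zero_cancel[OF tendsto_norm_zero_cancel])
qed

lemma fcalc_tendsto_at_right_0:
  fixes \<phi> :: "real \<Rightarrow> real \<Rightarrow> complex"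
  assumes \<phi>: "\<forall>\<^sub>F e in at_right 0. bounded_borel (\<phi> e) \<and> (\<forall>t. cmod (\<phi> e t) \<le> M)"
    and \<psi>: "bounded_borel \<psi>"
    and pt: "\<And>t. ((\<lambda>e. \<phi> e t) \<longlongrightarrow> \<psi> t) (at_right 0)"
  shows "((\<lambda>e. fcalc (\<phi> e) f) \<longlongrightarrow> fcalc \<psi> f) (at_right 0)"
  unfolding tendsto_at_iff_sequentially
proof (intro allI impI)
  fix X :: "nat \<Rightarrow> real"
  assume X: "\<forall>i. X i \<in> {0<..} - {0}" "X \<longlonglongrightarrow> 0"
  then have lim: "filterlim X (at_right 0) sequentially"
    by (auto simp: filterlim_at less_imp_neq[THEN not_sym])
  obtain N where N: "\<And>n. n \<ge> N \<Longrightarrow> bounded_borel (\<phi> (X n)) \<and> (\<forall>t. cmod (\<phi> (X n) t) \<le> M)"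
    using eventually_compose_filterlim[OF \<phi> lim] by (auto simp: eventually_sequentially)
  have "(\<lambda>n. fcalc (\<phi> (X (n + N))) f) \<longlonglongrightarrow> fcalc \<psi> f"
    using N \<psi> LIMSEQ_ignore_initial_segment[OF filterlim_compose[OF pt lim]]
    by (intro fcalc_tendsto[where M = M]) auto
  then show "((\<lambda>e. fcalc (\<phi> e) f) \<circ> X) \<longlonglongrightarrow> fcalc \<psi> f"
    unfolding comp_def by (rule LIMSEQ_offset)
qed

lemma fcalc_E:
  assumes A: "A \<in> sets borel" and \<phi>: "bounded_borel \<phi>"
  shows "E A (fcalc \<phi> f) = fcalc (\<lambda>t. indicator A t * \<phi> t) f"
proof (rule LIMSEQ_unique)
  show "(\<lambda>n. step_op (step_map id ((\<inter>) A) (steps \<phi> n)) f) \<longlonglongrightarrow> fcalc (\<lambda>t. indicator A t * \<phi> t) f"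
  proof (rule step_op_tendsto_fcalc)
    show "cmod (step_fun (step_map id ((\<inter>) A) (steps \<phi> n)) t - indicator A t * \<phi> t) \<le> 1 * (1 / real (Suc n))" for n t
      using steps_close[OF \<phi>, of n t] by (auto simp: step_restrict[OF A] indicator_def)
    show "(\<lambda>n. 1 * (1 / real (Suc n))) \<longlonglongrightarrow> 0" by (rule inverse_Suc_tendsto)
  qed (use A \<phi> in \<open>auto intro: bounded_borel_intros borel_steps_steps step_restrict\<close>)
  show "(\<lambda>n. step_op (step_map id ((\<inter>) A) (steps \<phi> n)) f) \<longlonglongrightarrow> E A (fcalc \<phi> f)"
    using bounded_linear.tendsto[OF bounded_linear_E[OF A] step_op_steps_tendsto[OF \<phi>]]
    by (simp add: step_restrict[OF A] borel_steps_steps[OF \<phi>])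
qed

text \<open>
  For a step function \<open>\<psi>\<close> multiplicativity follows from \<open>fcalc_E\<close> by linearity; both sides depend
  continuously on \<open>\<psi>\<close> in the supremum norm.
\<close>

lemma fcalc_mult:
  assumes \<psi>: "bounded_borel \<psi>" and \<phi>: "bounded_borel \<phi>"
  shows "fcalc \<psi> (fcalc \<phi> f) = fcalc (\<lambda>t. \<psi> t * \<phi> t) f"
proof (rule LIMSEQ_unique)
  show "(\<lambda>n. step_op (steps \<psi> n) (fcalc \<phi> f)) \<longlonglongrightarrow> fcalc \<psi> (fcalc \<phi> f)"
    using \<psi> by (rule step_op_steps_tendsto)
  have eq: "step_op l (fcalc \<phi> f) = fcalc (\<lambda>t. step_fun l t * \<phi> t) f" if "borel_steps l" for l
    using that
  proof (induction l)
    case Nil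
    show ?case using fcalc_scale[of "\<lambda>_. 0" 0 f] by simp
  next
    case (Cons p l)
    obtain c A where p: "p = (c, A)" by force
    have A: "A \<in> sets borel" and l: "borel_steps l" using Cons.prems by (auto simp: p)
    have "fcalc (\<lambda>t. c * (indicator A t * \<phi> t) + step_fun l t * \<phi> t) f
        = c *\<^sub>C fcalc (\<lambda>t. indicator A t * \<phi> t) f + fcalc (\<lambda>t. step_fun l t * \<phi> t) f"
      using A l \<phi> by (simp add: fcalc_add fcalc_scale bounded_borel_intros bounded_borel_step_fun)
    then show ?case using Cons.IH[OF l] by (simp add: p fcalc_E[OF A \<phi>] algebra_simps)
  qed
  obtain M where M: "\<And>t. cmod (\<phi> t) \<le> M" using \<phi> by (auto simp: bounded_borel_def)
  have "(\<lambda>n. fcalc (\<lambda>t. step_fun (steps \<psi> n) t * \<phi> t) f - fcalc (\<lambda>t. \<psi> t * \<phi> t) f) \<longlonglongrightarrow> 0"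
  proof (rule Lim_null_comparison[OF always_eventually[OF allI]])
    fix n
    have bb: "bounded_borel (\<lambda>t. step_fun (steps \<psi> n) t * \<phi> t)" "bounded_borel (\<lambda>t. \<psi> t * \<phi> t)"
      using \<phi> \<psi> by (auto intro!: bounded_borel_intros bounded_borel_step_fun borel_steps_steps)
    have "cmod (step_fun (steps \<psi> n) t * \<phi> t - \<psi> t * \<phi> t) \<le> 1 / Suc n * M" for t
      using mult_mono[OF steps_close[OF \<psi>, of n t] M[of t]]
      by (simp add: norm_mult flip: left_diff_distrib)
    from norm_fcalc_le[OF bounded_borel_diff[OF bb] this, of f, unfolded fcalc_diff[OF bb]]
    show "norm (fcalc (\<lambda>t. step_fun (steps \<psi> n) t * \<phi> t) f - fcalc (\<lambda>t. \<psi> t * \<phi> t) f) \<le> M * norm f * (1 / Suc n)"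
      by (simp add: mult_ac)
  qed (rule inverse_Suc_tendsto)
  then show "(\<lambda>n. step_op (steps \<psi> n) (fcalc \<phi> f)) \<longlonglongrightarrow> fcalc (\<lambda>t. \<psi> t * \<phi> t) f"
    by (simp add: eq borel_steps_steps[OF \<psi>] LIM_zero_iff)
qed

lemma step_op_add: "borel_steps l \<Longrightarrow> step_op l (f + g) = step_op l f + step_op l g"
  and step_op_scale: "borel_steps l \<Longrightarrow> step_op l (c *\<^sub>C f) = c *\<^sub>C step_op l f"
  by (induction l) (auto simp: E_add E_scale scaleC_add_right scaleC_scaleC mult.commute add_ac)

lemma fcalc_vector_add: "bounded_borel \<phi> \<Longrightarrow> fcalc \<phi> (f + g) = fcalc \<phi> f + fcalc \<phi> g"
  and fcalc_vector_scale: "bounded_borel \<phi> \<Longrightarrow> fcalc \<phi> (c *\<^sub>C f) = c *\<^sub>C fcalc \<phi> f"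
proof -
  assume \<phi>: "bounded_borel \<phi>"
  note lim = step_op_steps_tendsto[OF \<phi>]
  show "fcalc \<phi> (f + g) = fcalc \<phi> f + fcalc \<phi> g"
    using LIMSEQ_unique[OF lim[of "f + g"]] tendsto_add[OF lim[of f] lim[of g]]
    by (simp add: step_op_add borel_steps_steps[OF \<phi>])
  show "fcalc \<phi> (c *\<^sub>C f) = c *\<^sub>C fcalc \<phi> f"
    using LIMSEQ_unique[OF lim[of "c *\<^sub>C f"]] tendsto_scaleC[OF lim[of f]]
    by (simp add: step_op_scale borel_steps_steps[OF \<phi>])
qed

end

section \<open>Self-adjoint operators with a spectral measure\<close>

locale spectral_operator = spectral E for E :: "real set \<Rightarrow> 'a::chilbert_space \<Rightarrow> 'a" +
  fixes domT :: "'a set" and T :: "'a \<Rightarrow> 'a"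
  assumes sa: "self_adjoint UNIV cinner domT T"
    and rep: "spectral_representation E domT T"
begin

lemma T_linear: "linear_operator UNIV domT T"
  using sa by (simp add: self_adjoint_def densely_defined_def)

lemma domT_sub: "csubspace domT"
  and T_add: "x \<in> domT \<Longrightarrow> y \<in> domT \<Longrightarrow> T (x + y) = T x + T y"
  and T_scale: "x \<in> domT \<Longrightarrow> T (c *\<^sub>C x) = c *\<^sub>C T x"
  using T_linear by (auto simp: linear_operator_def)

lemma T_diff: "x \<in> domT \<Longrightarrow> y \<in> domT \<Longrightarrow> T (x - y) = T x - T y"
  using T_add[of x "- y"] T_scale[of y "-1"] cvec.subspace_neg[OF domT_sub, of y]
  by (simp add: cvec.scale_minus_left)

lemma T_graph: "(x \<in> domT \<and> T x = y) \<longleftrightarrow> (\<forall>u\<in>domT. cinner (T u) x = cinner u y)"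
proof -
  have "adjoint_graph UNIV cinner domT T = (\<lambda>x. (x, T x)) ` domT"
    using sa by (simp add: self_adjoint_def)
  then have "(x, y) \<in> adjoint_graph UNIV cinner domT T \<longleftrightarrow> (x, y) \<in> (\<lambda>x. (x, T x)) ` domT"
    by simp
  then show ?thesis by (auto simp: adjoint_graph_def)
qed

lemma T_sym: "x \<in> domT \<Longrightarrow> y \<in> domT \<Longrightarrow> cinner (T x) y = cinner x (T y)"
  using T_graph[of y "T y"] by blast

text \<open>
  The graph of a self-adjoint operator is that of an adjoint, and the condition defining an adjoint is
  preserved under limits.
\<close>

lemma T_closed:
  assumes "\<And>n. x n \<in> domT" "x \<longlonglongrightarrow> a" "(\<lambda>n. T (x n)) \<longlonglongrightarrow> b"
  shows "a \<in> domT \<and> T a = b"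
  unfolding T_graph
proof
  fix u assume u: "u \<in> domT"
  have "(\<lambda>n. cinner (T u) (x n)) \<longlonglongrightarrow> cinner (T u) a" by (intro tendsto_intros assms)
  moreover have "(\<lambda>n. cinner u (T (x n))) \<longlonglongrightarrow> cinner u b" by (intro tendsto_intros assms)
  ultimately show "cinner (T u) a = cinner u b"
    using LIMSEQ_unique by (simp add: T_sym[OF u assms(1)])
qed

abbreviation window :: "nat \<Rightarrow> real set" where "window n \<equiv> {- real n..real n}"

lemma bounded_borel_times_window:
  assumes "bounded_borel \<phi>"
  shows "bounded_borel (\<lambda>t. indicator (window n) t * (complex_of_real t * \<phi> t))"
proof -
  have "bounded_borel (\<lambda>t. indicator (window n) t * complex_of_real t)"
    by (rule bounded_borelI[of _ "real n"]) (auto simp: indicator_def)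
  from bounded_borel_mult[OF this assms] show ?thesis by (simp add: mult.assoc)
qed

lemma window_tendsto:
  assumes "bounded_borel \<phi>"
  shows "(\<lambda>n. fcalc (\<lambda>t. indicator (window n) t * \<phi> t) f) \<longlonglongrightarrow> fcalc \<phi> f"
proof -
  obtain M where M: "\<And>t. cmod (\<phi> t) \<le> M" using assms by (auto simp: bounded_borel_def)
  show ?thesis
  proof (rule fcalc_tendsto[where M = M])
    show "bounded_borel (\<lambda>t. indicator (window n) t * \<phi> t)" for n
      using assms by (intro bounded_borel_intros) auto
    show "cmod (indicator (window n) t * \<phi> t) \<le> M" for n t
      using M[of t] order_trans[OF norm_ge_zero M[of t]] by (simp add: indicator_def)
    show "(\<lambda>n. indicator (window n) t * \<phi> t) \<longlonglongrightarrow> \<phi> t" for t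
    proof (rule tendsto_eventually)
      have "indicator (window n) t * \<phi> t = \<phi> t" if "n \<ge> nat \<lceil>\<bar>t\<bar>\<rceil>" for n
        using that by (simp add: indicator_def) linarith
      then show "\<forall>\<^sub>F n in sequentially. indicator (window n) t * \<phi> t = \<phi> t"
        unfolding eventually_sequentially by blast
    qed
  qed fact
qed

lemma E_window_tendsto: "(\<lambda>n. E (window n) f) \<longlonglongrightarrow> f"
  using window_tendsto[of "\<lambda>_. 1" f] by (simp add: fcalc_1 fcalc_indicator)

text \<open>
  For \<open>x\<close> in the range of \<open>E (window n)\<close> the measure \<open>\<mu> x\<close> is carried by the window, where \<open>t\<^sup>2\<close> is
  bounded.
\<close>

lemma E_window_dom_diag:
  defines "\<theta> \<equiv> \<lambda>n t. indicator (window n) t * complex_of_real t"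
  assumes x: "E (window n) x = x"
  shows "x \<in> domT \<and> cinner (T x) x = cinner (fcalc (\<theta> n) x) x"
proof -
  have AE: "AE t in \<mu> x. t \<in> window n"
  proof (rule AE_I)
    have "E (- window n) x = 0" using x by (simp add: E_compl)
    then show "emeasure (\<mu> x) (- window n) = 0" by (simp add: emeasure_scalar)
  qed auto
  have "integrable (\<mu> x) (\<lambda>t. t\<^sup>2)"
  proof (rule scalar.integrable_const_bound)
    show "AE t in \<mu> x. norm (t\<^sup>2) \<le> (real n)\<^sup>2"
      using AE by eventually_elim (auto simp: abs_le_square_iff[symmetric])
  qed auto
  then have dom: "x \<in> domT" using rep by (simp add: spectral_representation_def)
  have bb: "bounded_borel (\<theta> n)" using bounded_borel_times_window[of "\<lambda>_. 1" n] by (simp add: \<theta>_def)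
  have "cinner (T x) x = (\<integral>t. complex_of_real t \<partial>\<mu> x)"
    using rep dom by (simp add: spectral_representation_def)
  also have "\<dots> = (\<integral>t. \<theta> n t \<partial>\<mu> x)"
  proof (rule integral_cong_AE)
    show "AE t in \<mu> x. complex_of_real t = \<theta> n t" using AE by eventually_elim (simp add: \<theta>_def)
    show "\<theta> n \<in> borel_measurable (\<mu> x)" by (intro borel_measurable_integrable integrable_bounded_borel bb)
  qed auto
  also have "\<dots> = cinner (fcalc (\<theta> n) x) x"
    using cinner_fcalc[OF bb, of "\<lambda>_. 1" x] by (simp add: fcalc_1)
  finally show ?thesis using dom by simp
qed

text \<open>
  The integral representation of \<open>T\<close> speaks about the values of its quadratic form only. On the range of
  \<open>E (window n)\<close> the operator \<open>T\<close> and its candidate have the same quadratic form, so by polarization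
  they differ by a vector orthogonal to that range; as the ranges increase to a dense set and the
  candidates are compatible, the difference is zero.
\<close>

lemma T_E_window: "E (window n) f \<in> domT \<and>
  T (E (window n) f) = fcalc (\<lambda>t. indicator (window n) t * complex_of_real t) f"
proof -
  define \<theta> where "\<theta> n t = indicator (window n) t * complex_of_real t" for n t
  have bb: "bounded_borel (\<theta> n)" for n
    using bounded_borel_times_window[of "\<lambda>_. 1" n] by (simp add: \<theta>_def[abs_def])
  have EE: "E (window n) (E (window m) x) = E (window n) x" if "n \<le> m" for n m x
    using that by (simp add: E_Int Int_absorb2)
  have \<theta>E: "fcalc (\<theta> m) (E (window n) x) = fcalc (\<theta> n) x" if "n \<le> m" for n m x
  proof -
    have "(\<lambda>t. \<theta> m t * indicator (window n) t) = \<theta> n"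
      using that by (auto simp: \<theta>_def indicator_def fun_eq_iff)
    then show ?thesis using fcalc_mult[OF bb bounded_borel_indicator, of "window n" m x]
      by (simp add: fcalc_indicator)
  qed
  define x where "x = E (window n) f"
  have x: "E (window m) x = x" if "n \<le> m" for m
    using that by (simp add: x_def E_Int Int_absorb1)
  define z where "z = T x - fcalc (\<theta> n) x"
  have "cinner z (E (window m) y) = 0" if m: "n \<le> m" for m y
  proof -
    let ?V = "{v. E (window m) v = v}"
    have V: "csubspace ?V"
      by (auto simp: cvec.subspace_def E_add E_scale intro: E_scale[of "window m" 0 0, simplified])
    have dom: "v \<in> domT" if "v \<in> ?V" for v using E_window_dom_diag[of m v] that by simp
    have "cinner (T x - fcalc (\<theta> m) x) (E (window m) y) = 0"
    proof (rule sesquilinear_zero_if_diagonal_zero[OF V, where Q = "\<lambda>v. T v - fcalc (\<theta> m) v"])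
      show "cinner (T v - fcalc (\<theta> m) v) v = 0" if "v \<in> ?V" for v
        using E_window_dom_diag[of m v] that by (simp add: cinner_simps \<theta>_def[abs_def])
      show "T (u + v) - fcalc (\<theta> m) (u + v) = T u - fcalc (\<theta> m) u + (T v - fcalc (\<theta> m) v)"
        if "u \<in> ?V" "v \<in> ?V" for u v
        using dom[OF that(1)] dom[OF that(2)] by (simp add: T_add fcalc_vector_add[OF bb])
      show "T (c *\<^sub>C v) - fcalc (\<theta> m) (c *\<^sub>C v) = c *\<^sub>C (T v - fcalc (\<theta> m) v)" if "v \<in> ?V" for c v
        using dom[OF that] by (simp add: T_scale fcalc_vector_scale[OF bb] cvec.scale_right_diff_distrib)
      show "x \<in> ?V" using x[OF m] by simp
      show "E (window m) y \<in> ?V" by (simp add: E_idem)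
    qed
    moreover have "fcalc (\<theta> m) x = fcalc (\<theta> n) x"
      using \<theta>E[OF m, of x] x[of n] by simp
    ultimately show ?thesis by (simp add: z_def)
  qed
  then have "\<forall>\<^sub>F m in sequentially. cinner z (E (window m) z) = 0"
    unfolding eventually_sequentially by blast
  from tendsto_eventually[OF this] have "cinner z z = 0"
    by (rule LIMSEQ_unique[rotated]) (intro tendsto_intros E_window_tendsto)
  then have "T x = fcalc (\<theta> n) x" by (simp add: cinner_self z_def)
  also have "\<dots> = fcalc (\<theta> n) f" by (simp add: x_def \<theta>E)
  finally show ?thesis using E_window_dom_diag[of n x] x[of n] by (simp add: x_def \<theta>_def[abs_def])
qed

text \<open>
  The truncations \<open>E (window n) (fcalc \<phi> f)\<close> are covered by the preceding lemma; since \<open>T\<close> is closed,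
  the statement carries over to their limit.
\<close>

lemma
  assumes \<phi>: "bounded_borel \<phi>" and t\<phi>: "bounded_borel (\<lambda>t. complex_of_real t * \<phi> t)"
  shows fcalc_in_domT: "fcalc \<phi> f \<in> domT"
    and T_fcalc_eq: "T (fcalc \<phi> f) = fcalc (\<lambda>t. complex_of_real t * \<phi> t) f"
proof -
  have bb: "bounded_borel (\<lambda>t. indicator (window n) t * complex_of_real t)" for n
    using bounded_borel_times_window[of "\<lambda>_. 1" n] by simp
  have "fcalc \<phi> f \<in> domT \<and> T (fcalc \<phi> f) = fcalc (\<lambda>t. complex_of_real t * \<phi> t) f"
  proof (rule T_closed)
    show "E (window n) (fcalc \<phi> f) \<in> domT" for n using T_E_window by blast
    show "(\<lambda>n. E (window n) (fcalc \<phi> f)) \<longlonglongrightarrow> fcalc \<phi> f" by (rule E_window_tendsto)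
    have "T (E (window n) (fcalc \<phi> f)) = fcalc (\<lambda>t. indicator (window n) t * (complex_of_real t * \<phi> t)) f" for n
      using T_E_window[of n "fcalc \<phi> f"] fcalc_mult[OF bb \<phi>, of n f] by (simp add: mult.assoc)
    then show "(\<lambda>n. T (E (window n) (fcalc \<phi> f))) \<longlonglongrightarrow> fcalc (\<lambda>t. complex_of_real t * \<phi> t) f"
      using window_tendsto[OF t\<phi>] by simp
  qed
  then show "fcalc \<phi> f \<in> domT" "T (fcalc \<phi> f) = fcalc (\<lambda>t. complex_of_real t * \<phi> t) f" by auto
qed

end

subsection \<open>The resolvent\<close>

lemma cmod_diff_ge_Im: "\<bar>Im l\<bar> \<le> cmod (complex_of_real t - l)"
  using abs_Im_le_cmod[of "complex_of_real t - l"] by simp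

lemma of_real_neq_nonreal: "Im l \<noteq> 0 \<Longrightarrow> complex_of_real t - l \<noteq> 0"
  by (auto simp: complex_eq_iff)

lemma resolvent_fun_le: "Im l \<noteq> 0 \<Longrightarrow> cmod (1 / (complex_of_real t - l)) \<le> 1 / \<bar>Im l\<bar>"
  using cmod_diff_ge_Im[of l t] by (simp add: norm_divide frac_le)

lemma bounded_borel_resolvent:
  assumes "Im l \<noteq> 0"
  shows "bounded_borel (\<lambda>t. 1 / (complex_of_real t - l))"
  using resolvent_fun_le[OF assms] by (intro bounded_borelI) measurable

text \<open>
  This identity shows that \<open>t / (t - l)\<close> is bounded, so that the functional calculus applies to \<open>T\<close> times the
  resolvent.
\<close>

lemma times_resolvent_fun:
  assumes "Im l \<noteq> 0"
  shows "complex_of_real t * (1 / (complex_of_real t - l)) = 1 + l * (1 / (complex_of_real t - l))"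
  using of_real_neq_nonreal[OF assms, of t] by (simp add: field_simps)

lemma bounded_borel_times_resolvent:
  assumes "Im l \<noteq> 0"
  shows "bounded_borel (\<lambda>t. complex_of_real t * (1 / (complex_of_real t - l)))"
  unfolding times_resolvent_fun[OF assms]
  by (intro bounded_borel_add bounded_borel_scale bounded_borel_resolvent assms bounded_borel_const)

context spectral_operator
begin

text \<open>
  An eigenvalue of a symmetric operator is real because \<open>(T x, x)\<close> is.
\<close>

lemma T_minus_inj:
  assumes l: "Im l \<noteq> 0" and x: "x \<in> domT" and eq: "T x = l *\<^sub>C x"
  shows "x = 0"
proof -
  have "l * cinner x x = cnj l * cinner x x"
    using T_sym[OF x x] by (simp add: eq cinner_simps)
  then show ?thesis using l by (auto simp: cinner_self complex_eq_iff)
qed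

lemma T_minus_fcalc:
  assumes l: "Im l \<noteq> 0"
  defines "R \<equiv> \<lambda>t. 1 / (complex_of_real t - l)"
  shows "fcalc R f \<in> domT" "T (fcalc R f) - l *\<^sub>C fcalc R f = f"
proof -
  note R = bounded_borel_resolvent[OF l, folded R_def]
  note tR = bounded_borel_times_resolvent[OF l, folded R_def]
  show "fcalc R f \<in> domT" by (rule fcalc_in_domT) (use R tR in \<open>simp_all add: R_def\<close>)
  have "T (fcalc R f) = fcalc (\<lambda>t. 1 + l * R t) f"
    by (subst T_fcalc_eq) (use R tR in \<open>simp_all add: R_def times_resolvent_fun[OF l, simplified]\<close>)
  also have "\<dots> = f + l *\<^sub>C fcalc R f"
    using R by (simp add: fcalc_add bounded_borel_scale fcalc_scale fcalc_1)
  finally show "T (fcalc R f) - l *\<^sub>C fcalc R f = f" by simp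
qed

end

section \<open>Krein spaces\<close>

lemma
  assumes "fundamental_symmetry K kip J"
  shows fundamental_symmetry_form: "carrier_form K kip"
    and fundamental_symmetry_J_in: "\<And>x. x \<in> K \<Longrightarrow> J x \<in> K"
    and fundamental_symmetry_J_J: "\<And>x. x \<in> K \<Longrightarrow> J (J x) = x"
    and fundamental_symmetry_J_add: "\<And>x y. x \<in> K \<Longrightarrow> y \<in> K \<Longrightarrow> J (x + y) = J x + J y"
    and fundamental_symmetry_J_scale: "\<And>c x. x \<in> K \<Longrightarrow> J (c *\<^sub>C x) = c *\<^sub>C J x"
    and fundamental_symmetry_J_sym: "\<And>x y. x \<in> K \<Longrightarrow> y \<in> K \<Longrightarrow> kip (J x) y = kip x (J y)"
    and fundamental_symmetry_J_form: "carrier_ip K (J_form kip J)"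
proof -
  obtain Kp Km where dec: "fundamental_decomposition K kip Kp Km"
    and J: "\<And>p m. p \<in> Kp \<Longrightarrow> m \<in> Km \<Longrightarrow> J (p + m) = p - m"
    using assms by (auto simp: fundamental_symmetry_def)
  have herm: "hermitian_form_on K kip" and K: "K = {p + m | p m. p \<in> Kp \<and> m \<in> Km}"
    and orth: "\<And>p m. p \<in> Kp \<Longrightarrow> m \<in> Km \<Longrightarrow> kip p m = 0"
    and hp: "hilbert_space_on Kp kip" and hm: "hilbert_space_on Km (\<lambda>x y. - kip x y)"
    using dec by (auto simp: fundamental_decomposition_def)
  have p: "csubspace Kp" "\<And>x. x \<in> Kp \<Longrightarrow> x \<noteq> 0 \<Longrightarrow> 0 < Re (kip x x)"
    using hp by (auto simp: hilbert_space_on_def)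
  have m: "csubspace Km" "\<And>x. x \<in> Km \<Longrightarrow> x \<noteq> 0 \<Longrightarrow> Re (kip x x) < 0"
    using hm by (auto simp: hilbert_space_on_def)
  have "csubspace K" unfolding K by (rule cvec.subspace_sums[OF p(1) m(1)])
  then interpret carrier_form K kip using herm by unfold_locales
  show "carrier_form K kip" ..
  have Kp: "x \<in> K" if "x \<in> Kp" for x
    unfolding K using that cvec.subspace_0[OF m(1)] by force
  have Km: "x \<in> K" if "x \<in> Km" for x
    unfolding K using that cvec.subspace_0[OF p(1)] by force
  have orth': "kip y x = 0" if "x \<in> Kp" "y \<in> Km" for x y
    using ip_commute[of x y] orth[OF that] Kp Km that by simp
  have dec: thesis
    if x: "x \<in> K" and "\<And>u v. u \<in> Kp \<Longrightarrow> v \<in> Km \<Longrightarrow> u \<in> K \<Longrightarrow> v \<in> K \<Longrightarrow> x = u + v \<Longrightarrow> J x = u - v \<Longrightarrow> thesis"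
    for x thesis
  proof -
    from x obtain u v where "u \<in> Kp" "v \<in> Km" "x = u + v" unfolding K by blast
    then show thesis using that(2)[of u v] Kp Km J by simp
  qed
  show J_in: "J x \<in> K" if "x \<in> K" for x
    by (rule dec[OF that]) simp
  show J_J: "J (J x) = x" if "x \<in> K" for x
  proof -
    from that obtain u v where uv: "u \<in> Kp" "v \<in> Km" "x = u + v" "J x = u - v" by (rule dec)
    have "J (u + - v) = u - - v" using uv cvec.subspace_neg[OF m(1)] by (intro J)
    then show ?thesis using uv by simp
  qed
  show J_add: "J (x + y) = J x + J y" if xy: "x \<in> K" "y \<in> K" for x y
  proof -
    from xy(1) obtain u v where uv: "u \<in> Kp" "v \<in> Km" "x = u + v" "J x = u - v" by (rule dec)
    from xy(2) obtain u' v' where uv': "u' \<in> Kp" "v' \<in> Km" "y = u' + v'" "J y = u' - v'" by (rule dec)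
    have "J ((u + u') + (v + v')) = (u + u') - (v + v')"
      using uv uv' cvec.subspace_add[OF p(1)] cvec.subspace_add[OF m(1)] by (intro J)
    moreover have "(u + u') + (v + v') = x + y" using uv uv' by (simp add: add_ac)
    ultimately show ?thesis using uv uv' by simp
  qed
  show J_scale: "J (c *\<^sub>C x) = c *\<^sub>C J x" if x: "x \<in> K" for c x
  proof -
    from x obtain u v where uv: "u \<in> Kp" "v \<in> Km" "x = u + v" "J x = u - v" by (rule dec)
    have "J (c *\<^sub>C u + c *\<^sub>C v) = c *\<^sub>C u - c *\<^sub>C v"
      using uv cvec.subspace_scale[OF p(1)] cvec.subspace_scale[OF m(1)] by (intro J)
    then show ?thesis using uv by (simp add: scaleC_add_right cvec.scale_right_diff_distrib)
  qed
  show J_sym: "kip (J x) y = kip x (J y)" if xy: "x \<in> K" "y \<in> K" for x y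
  proof -
    from xy(1) obtain u v where uv: "u \<in> Kp" "v \<in> Km" "u \<in> K" "v \<in> K" "x = u + v" "J x = u - v" by (rule dec)
    from xy(2) obtain u' v' where uv': "u' \<in> Kp" "v' \<in> Km" "u' \<in> K" "v' \<in> K" "y = u' + v'" "J y = u' - v'" by (rule dec)
    show ?thesis using uv uv'
      by (simp add: ip_add_left ip_add_right ip_diff_left ip_diff_right orth orth')
  qed
  show "carrier_ip K (J_form kip J)"
  proof
    show "hermitian_form_on K (J_form kip J)"
      unfolding hermitian_form_on_def J_form_def
    proof (intro conjI ballI allI)
      show "kip (J (x + y)) z = kip (J x) z + kip (J y) z" if "x \<in> K" "y \<in> K" "z \<in> K" for x y z
        using that J_in by (simp add: J_add ip_add_left)
      show "kip (J (c *\<^sub>C x)) y = c * kip (J x) y" if "x \<in> K" "y \<in> K" for c x y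
        using that J_in by (simp add: J_scale ip_scale_left)
      show "kip (J y) x = cnj (kip (J x) y)" if "x \<in> K" "y \<in> K" for x y
        using J_sym[OF that] ip_commute[OF that(1) J_in[OF that(2)]] by simp
    qed
    show "0 < Re (J_form kip J x x)" if x: "x \<in> K" and "x \<noteq> 0" for x
    proof -
      from x obtain u v where uv: "u \<in> Kp" "v \<in> Km" "u \<in> K" "v \<in> K" "x = u + v" "J x = u - v" by (rule dec)
      have "J_form kip J x x = kip u u - kip v v"
        using uv by (simp add: J_form_def ip_add_right ip_diff_left orth orth')
      moreover have "0 \<le> Re (kip u u)" "Re (kip v v) \<le> 0"
        using p(2)[OF uv(1)] m(2)[OF uv(2)] by (cases "u = 0"; cases "v = 0"; force)+
      moreover have "u \<noteq> 0 \<or> v \<noteq> 0" using \<open>x \<noteq> 0\<close> uv by auto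
      ultimately show ?thesis using p(2)[OF uv(1)] m(2)[OF uv(2)] by auto
    qed
  qed fact
qed

section \<open>The Krein space completion\<close>

locale krein_setting = spectral_operator E domT T
  for E :: "real set \<Rightarrow> 'h::chilbert_space \<Rightarrow> 'h" and domT T +
  fixes K :: "'h set" and kip :: "'h \<Rightarrow> 'h \<Rightarrow> complex" and J :: "'h \<Rightarrow> 'h"
    and A :: "'h \<Rightarrow> 'h" and domA :: "'h set"
  assumes binv: "boundedly_invertible UNIV cinner domT T"
    and compl: "krein_space_completion K kip J domT T"
    and cont: "continuous_map (krein_topology K kip J) euclidean (\<lambda>x. x)"
    and domA: "domA = {x \<in> domT. T x \<in> K}"
    and A: "A = restrict T domA"
begin

lemma fs: "fundamental_symmetry K kip J"
  and domT_K: "x \<in> domT \<Longrightarrow> x \<in> K"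
  and dense: "krein_topology K kip J closure_of domT = K"
  and kip_domT: "x \<in> domT \<Longrightarrow> y \<in> domT \<Longrightarrow> kip x y = cinner (T x) y"
  using compl by (auto simp: krein_space_completion_def)

lemmas J_in [simp, intro] = fundamental_symmetry_J_in[OF fs]
lemmas J_J [simp] = fundamental_symmetry_J_J[OF fs]
lemmas J_add = fundamental_symmetry_J_add[OF fs]
lemmas J_scale = fundamental_symmetry_J_scale[OF fs]
lemmas J_sym = fundamental_symmetry_J_sym[OF fs]

sublocale kf: carrier_form K kip by (rule fundamental_symmetry_form[OF fs])
sublocale kj: carrier_ip K "J_form kip J" by (rule fundamental_symmetry_J_form[OF fs])

abbreviation knorm :: "'h \<Rightarrow> real" where "knorm \<equiv> ip_norm (J_form kip J)"

lemma knorm_J: "x \<in> K \<Longrightarrow> knorm (J x) = knorm x"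
  by (simp add: ip_norm_def J_form_def J_sym)

lemma kip_le: "x \<in> K \<Longrightarrow> y \<in> K \<Longrightarrow> cmod (kip x y) \<le> knorm x * knorm y"
  using kj.Cauchy_Schwarz_ip[of "J x" y] by (simp add: J_form_def knorm_J)

lemma kip_zeroD:
  assumes "x \<in> K" "\<And>y. y \<in> K \<Longrightarrow> kip y x = 0"
  shows "x = 0"
  using assms(2)[of "J x"] kj.pos[OF assms(1)] assms(1) by (force simp: J_form_def)

lemma ex_norm_le_knorm: "\<exists>c>0. \<forall>x\<in>K. norm x \<le> c * knorm x"
proof -
  let ?X = "ip_topology K (J_form kip J)"
  have "openin ?X {x \<in> topspace ?X. x \<in> ball 0 1}"
    using cont unfolding krein_topology_def
    by (rule openin_continuous_map_preimage) (simp add: open_openin[symmetric])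
  then have "openin ?X {x \<in> K. norm x < 1}" by simp
  moreover have "0 \<in> {x \<in> K. norm x < 1}" by simp
  ultimately obtain r where r: "r > 0"
    and sub: "Metric_space.mball K (ip_dist K (J_form kip J)) 0 r \<subseteq> {x \<in> K. norm x < 1}"
    unfolding ip_topology_def Metric_space.openin_mtopology[OF kj.Metric_space_ip] by meson
  have ball: "norm x < 1" if "x \<in> K" "knorm x < r" for x
  proof -
    have "x \<in> Metric_space.mball K (ip_dist K (J_form kip J)) 0 r"
      using that kj.nrm_minus_commute[of 0 x]
      by (simp add: Metric_space.in_mball[OF kj.Metric_space_ip] ip_dist_def)
    with sub show ?thesis by blast
  qed
  have "norm x \<le> 2 / r * knorm x" if x: "x \<in> K" for x
  proof (cases "x = 0")
    case False
    then have k: "knorm x > 0" using kj.nrm_eq_0[OF x] kj.nrm_nonneg[OF x] by linarith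
    define c where "c = complex_of_real (r / 2 / knorm x)"
    have c: "cmod c = r / 2 / knorm x" using r k by (simp add: c_def norm_divide)
    have "knorm (c *\<^sub>C x) < r" using x r k by (simp add: kj.nrm_scaleC c)
    then have "norm (c *\<^sub>C x) < 1" using x by (intro ball) auto
    then show ?thesis using r k by (simp add: c field_simps)
  qed (simp add: ip_norm_def)
  then show ?thesis using r by (intro exI[of _ "2 / r"]) auto
qed

definition embedding_const :: real where "embedding_const = (SOME c. c > 0 \<and> (\<forall>x\<in>K. norm x \<le> c * knorm x))"

lemma embedding_const_pos: "embedding_const > 0" and norm_le_knorm: "x \<in> K \<Longrightarrow> norm x \<le> embedding_const * knorm x"
  using someI_ex[OF ex_norm_le_knorm] by (auto simp: embedding_const_def)

lemma domT_dense: "x \<in> K \<Longrightarrow> e > 0 \<Longrightarrow> \<exists>y\<in>domT. knorm (y - x) < e"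
  using dense kj.closure_of_ip[of domT] domT_K by (auto simp: krein_topology_def)

text \<open>
  The identity \<open>kip y x = (T y, x) = (y, T x)\<close> on \<open>domT\<close> extends to \<open>y \<in> K\<close>, since both
  outer members are continuous in \<open>y\<close> for the topology of \<open>K\<close>.
\<close>

lemma kip_T:
  assumes y: "y \<in> K" and x: "x \<in> domT"
  shows "kip y x = cinner y (T x)"
proof -
  have xK: "x \<in> K" using x by (rule domT_K)
  define M where "M = knorm x + embedding_const * norm (T x) + 1"
  have M: "M > 0"
    using embedding_const_pos xK by (auto simp: M_def intro!: add_nonneg_pos add_nonneg_nonneg)
  have "cmod (kip y x - cinner y (T x)) \<le> e" if e: "e > 0" for e
  proof -
    from e M have "e / M > 0" by simp
    then obtain z where z: "z \<in> domT" "knorm (z - y) < e / M" using domT_dense[OF y] by blast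
    have zK: "z - y \<in> K" using z domT_K y by auto
    have "kip z x = cinner z (T x)" using z x by (simp add: kip_domT T_sym)
    then have "kip y x - cinner y (T x) = cinner (z - y) (T x) - kip (z - y) x"
      using z y xK domT_K by (simp add: kf.ip_diff_left cinner_simps)
    then have "cmod (kip y x - cinner y (T x)) \<le> cmod (cinner (z - y) (T x)) + cmod (kip (z - y) x)"
      by (metis norm_triangle_ineq4)
    also have "\<dots> \<le> norm (z - y) * norm (T x) + knorm (z - y) * knorm x"
      using H.Cauchy_Schwarz_ip[of "z - y" "T x"] kip_le[OF zK xK] by simp
    also have "\<dots> \<le> embedding_const * knorm (z - y) * norm (T x) + knorm (z - y) * knorm x"
      using norm_le_knorm[OF zK] by (intro add_right_mono mult_right_mono) auto
    also have "\<dots> \<le> knorm (z - y) * M"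
      using zK by (simp add: M_def algebra_simps)
    also have "\<dots> \<le> e" using z(2) M by (simp add: field_simps)
    finally show ?thesis .
  qed
  then show ?thesis using field_le_epsilon[of "cmod (kip y x - cinner y (T x))" 0] by simp
qed

text \<open>
  On \<open>domT\<close> the topology of \<open>K\<close> is controlled by the graph norm of \<open>T\<close>: by \<open>kip_T\<close> the square
  of the norm of \<open>x\<close> in \<open>K\<close> is \<open>(J x, T x)\<close>, and \<open>J\<close> preserves the norm of \<open>K\<close>.
\<close>

lemma knorm_le:
  assumes x: "x \<in> domT"
  shows "knorm x \<le> embedding_const * norm (T x)"
proof -
  have xK: "x \<in> K" using x by (rule domT_K)
  have "(knorm x)\<^sup>2 = Re (cinner (J x) (T x))"
    using xK x by (simp add: kj.nrm_sq J_form_def kip_T)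
  also have "\<dots> \<le> norm (J x) * norm (T x)"
    using H.Cauchy_Schwarz_ip[of "J x" "T x"] complex_Re_le_cmod order_trans by fastforce
  also have "\<dots> \<le> (embedding_const * knorm x) * norm (T x)"
    using norm_le_knorm[OF J_in[OF xK]] xK by (intro mult_right_mono) (auto simp: knorm_J)
  finally have "knorm x * knorm x \<le> knorm x * (embedding_const * norm (T x))"
    by (simp add: power2_eq_square mult_ac)
  then show ?thesis
    using kj.nrm_nonneg[OF xK] embedding_const_pos by (cases "knorm x = 0") auto
qed

definition Tinv :: "'h \<Rightarrow> 'h" where
  "Tinv = (SOME B. bounded_operator UNIV cinner B \<and> (\<forall>y. B y \<in> domT \<and> T (B y) = y) \<and> (\<forall>x\<in>domT. B (T x) = x))"

lemma Tinv: "bounded_operator UNIV cinner Tinv \<and> (\<forall>y. Tinv y \<in> domT \<and> T (Tinv y) = y) \<and> (\<forall>x\<in>domT. Tinv (T x) = x)"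
proof -
  have "\<exists>B. bounded_operator UNIV cinner B \<and> (\<forall>y. B y \<in> domT \<and> T (B y) = y) \<and> (\<forall>x\<in>domT. B (T x) = x)"
    using binv by (simp add: boundedly_invertible_def)
  from someI_ex[OF this] show ?thesis unfolding Tinv_def .
qed

lemma Tinv_dom [simp]: "Tinv y \<in> domT" and T_Tinv [simp]: "T (Tinv y) = y"
  and Tinv_T [simp]: "x \<in> domT \<Longrightarrow> Tinv (T x) = x"
  and Tinv_add: "Tinv (x + y) = Tinv x + Tinv y" and Tinv_scale: "Tinv (c *\<^sub>C x) = c *\<^sub>C Tinv x"
  using Tinv by (auto simp: bounded_operator_def linear_operator_def)

lemma Tinv_K [simp]: "Tinv y \<in> K" by (rule domT_K) simp

lemma knorm_Tinv: "knorm (Tinv y) \<le> embedding_const * norm y"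
  using knorm_le[of "Tinv y"] by simp

lemma kip_Tinv: "y \<in> K \<Longrightarrow> kip y (Tinv z) = cinner y z"
  using kip_T[of y "Tinv z"] by simp

lemma kip_Tinv_left: "y \<in> K \<Longrightarrow> kip (Tinv z) y = cinner z y"
  using kip_Tinv[of y z] kf.ip_commute[of y "Tinv z"] cinner_commute[of z y] by simp

subsection \<open>The operator \<open>A\<close>\<close>

lemma in_domA: "x \<in> domA \<longleftrightarrow> x \<in> domT \<and> T x \<in> K"
  by (simp add: domA)

lemma A_eq: "x \<in> domA \<Longrightarrow> A x = T x"
  by (simp add: A)

lemma domA_sub: "csubspace domA"
  unfolding cvec.subspace_def domA
  using domT_sub kf.S_sub T_scale[of 0 0]
  by (auto simp: cvec.subspace_def T_add T_scale)

lemma domA_K: "domA \<subseteq> K" using domT_K by (auto simp: in_domA)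

lemma A_linear: "linear_operator K domA A"
  unfolding linear_operator_def
  using domA_sub domA_K cvec.subspace_add[OF domA_sub] cvec.subspace_scale[OF domA_sub]
  by (auto simp: A_eq in_domA T_add T_scale)

text \<open>
  Let \<open>P = E (window n)\<close>. The bounded operator \<open>T P\<close> is symmetric, because its range is contained in that
  of \<open>P\<close>. As \<open>T\<close> itself is symmetric, \<open>(T P x, v) = (x, T P v) = (T x, P v) = (P T x, v)\<close> for all \<open>v\<close>.
\<close>

lemma E_window_T:
  assumes x: "x \<in> domT"
  shows "T (E (window n) x) = E (window n) (T x)"
proof -
  have sym: "cinner (T (E (window n) u)) v = cinner u (T (E (window n) v))" for u v
  proof -
    have "T (E (window n) u) = E (window n) (T (E (window n) u))" for u
    proof -
      have bb: "bounded_borel (\<lambda>t. indicator (window n) t * complex_of_real t)"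
        using bounded_borel_times_window[of "\<lambda>_. 1" n] by simp
      have "E (window n) (T (E (window n) u))
          = fcalc (\<lambda>t. indicator (window n) t * (indicator (window n) t * complex_of_real t)) u"
        using T_E_window[of n u] fcalc_E[OF _ bb, of "window n" u] by simp
      also have "(\<lambda>t. indicator (window n) t * (indicator (window n) t * complex_of_real t))
          = (\<lambda>t. indicator (window n) t * complex_of_real t)"
        by (auto simp: indicator_def fun_eq_iff)
      finally show ?thesis using T_E_window[of n u] by simp
    qed
    then have "cinner (T (E (window n) u)) v = cinner (T (E (window n) u)) (E (window n) v)"
      by (metis E_sym borel_closed closed_atLeastAtMost)
    also have "\<dots> = cinner (E (window n) u) (T (E (window n) v))"
      using T_E_window by (intro T_sym) auto
    also have "\<dots> = cinner u (T (E (window n) v))"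
      using \<open>\<And>u. T (E (window n) u) = E (window n) (T (E (window n) u))\<close>
      by (metis E_sym borel_closed closed_atLeastAtMost)
    finally show ?thesis .
  qed
  have eq: "cinner (T (E (window n) x)) v = cinner (E (window n) (T x)) v" for v
    using sym[of x v] T_sym[OF x, of "E (window n) v"] T_E_window[of n v] E_sym[of "window n" "T x" v]
    by simp
  have "cinner (T (E (window n) x) - E (window n) (T x)) v = 0" for v
    by (simp add: H.ip_diff_left eq)
  from this[of "T (E (window n) x) - E (window n) (T x)"]
  show ?thesis by (simp add: cinner_self)
qed

text \<open>
  For \<open>y \<in> domT\<close> the truncations \<open>E (window n) y\<close> lie in \<open>domA\<close> and converge to \<open>y\<close> in the graph
  norm of \<open>T\<close>, hence in \<open>K\<close>, because \<open>T\<close> commutes with \<open>E (window n)\<close>.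
\<close>

lemma domA_dense: "ip_topology K (J_form kip J) closure_of domA = K"
  unfolding kj.closure_of_ip[OF domA_K]
proof (intro ballI allI impI)
  fix x e assume x: "x \<in> K" and e: "(0 :: real) < e"
  obtain y where y: "y \<in> domT" "knorm (y - x) < e / 2" using domT_dense[OF x, of "e / 2"] e by auto
  let ?y = "\<lambda>n. E (window n) y"
  have dom: "?y n \<in> domT" for n using T_E_window by blast
  have domA: "?y n \<in> domA" for n
    using dom E_window_T[OF y(1)] T_E_window[of n "T y"] by (simp add: in_domA domT_K)
  have "(\<lambda>n. embedding_const * norm (E (window n) (T y) - T y)) \<longlonglongrightarrow> embedding_const * norm (T y - T y)"
    by (intro tendsto_intros E_window_tendsto)
  then have "(\<lambda>n. embedding_const * norm (E (window n) (T y) - T y)) \<longlonglongrightarrow> 0" by simp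
  then obtain n where n: "embedding_const * norm (E (window n) (T y) - T y) < e / 2"
    using e eventually_happens'[OF sequentially_bot order_tendstoD(2)[of _ 0 sequentially "e / 2"]] by auto
  have "?y n - y \<in> domT" using dom y(1) by (rule csubspace_minus[OF domT_sub])
  from knorm_le[OF this] have 1: "knorm (?y n - y) < e / 2"
    using n by (simp add: T_diff[OF dom y(1)] E_window_T[OF y(1)])
  have "knorm (?y n - x) \<le> knorm (?y n - y) + knorm (y - x)"
    using kj.nrm_triangle[of "?y n - y" "y - x"] dom y(1) x domT_K by auto
  with 1 y(2) have "knorm (?y n - x) < e" by simp
  with domA show "\<exists>y\<in>domA. knorm (y - x) < e" by blast
qed

lemma JA_linear: "linear_operator K domA (J \<circ> A)"
  unfolding linear_operator_def
  using A_linear by (auto simp: linear_operator_def J_add J_scale image_subset_iff)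

lemma A_densely_defined: "densely_defined K (J_form kip J) domA A"
  by (simp add: densely_defined_def A_linear domA_dense)

text \<open>
  The everywhere defined operator \<open>Tinv \<circ> J\<close> inverts \<open>J \<circ> A\<close>. If \<open>(y, z)\<close> is in the graph of the adjoint,
  testing with \<open>x = Tinv g\<close> gives \<open>[g, y] = (g, J z) = [g, Tinv (J z)]\<close> for all \<open>g \<in> K\<close>, so \<open>y = Tinv (J z)\<close>.
\<close>

lemma A_J_self_adjoint: "J_self_adjoint K kip J domA A"
proof -
  have "adjoint_graph K (J_form kip J) domA (J \<circ> A) = (\<lambda>x. (x, (J \<circ> A) x)) ` domA"
  proof (intro set_eqI iffI; clarify)
    fix y z assume "(y, z) \<in> adjoint_graph K (J_form kip J) domA (J \<circ> A)"
    then have y: "y \<in> K" and z: "z \<in> K"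
      and adj: "\<And>x. x \<in> domA \<Longrightarrow> kip (J (J (A x))) y = kip (J x) z"
      by (auto simp: adjoint_graph_def J_form_def)
    have "y - Tinv (J z) = 0"
    proof (rule kip_zeroD)
      show "y - Tinv (J z) \<in> K" using y by auto
      fix g assume g: "g \<in> K"
      have dom: "Tinv g \<in> domA" using g by (simp add: in_domA)
      have "kip g y = kip (J (Tinv g)) z" using adj[OF dom] g by (simp add: A_eq[OF dom])
      also have "\<dots> = cinner g (J z)" using z by (simp add: J_sym kip_Tinv_left)
      also have "\<dots> = kip g (Tinv (J z))" using g by (simp add: kip_Tinv)
      finally show "kip g (y - Tinv (J z)) = 0" using y g by (simp add: kf.ip_diff_right)
    qed
    then have "y = Tinv (J z)" by simp
    moreover from this have "y \<in> domA" using z by (simp add: in_domA)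
    ultimately show "(y, z) \<in> (\<lambda>x. (x, (J \<circ> A) x)) ` domA" using z by (auto simp: A_eq image_iff)
  next
    fix y assume y: "y \<in> domA"
    then have yK: "y \<in> K" "y \<in> domT" "T y \<in> K" by (auto simp: in_domA domT_K)
    have "kip (J (J (A x))) y = kip (J x) (J (A y))" if x: "x \<in> domA" for x
    proof -
      have xK: "x \<in> K" "x \<in> domT" "T x \<in> K" using x by (auto simp: in_domA domT_K)
      have "kip (T x) y = cinner (T x) (T y)" using xK yK by (simp add: kip_T)
      also have "\<dots> = kip x (T y)" using kip_Tinv_left[of "T y" "T x"] xK yK by simp
      finally show ?thesis using xK yK by (simp add: A_eq[OF x] A_eq[OF y] J_sym)
    qed
    then show "(y, (J \<circ> A) y) \<in> adjoint_graph K (J_form kip J) domA (J \<circ> A)"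
      using yK by (auto simp: adjoint_graph_def J_form_def A_eq[OF y])
  qed
  then show ?thesis
    by (simp add: J_self_adjoint_def self_adjoint_def densely_defined_def A_linear JA_linear domA_dense)
qed

lemma A_J_non_negative: "J_non_negative K kip J domA A"
proof -
  have "J_form kip J ((J \<circ> A) x) x \<in> \<real>\<^sub>\<ge>\<^sub>0" if x: "x \<in> domA" for x
  proof -
    have xK: "x \<in> domT" "T x \<in> K" using x by (auto simp: in_domA)
    have "J_form kip J ((J \<circ> A) x) x = cinner (T x) (T x)"
      using xK by (simp add: J_form_def A_eq[OF x] kip_T)
    then show ?thesis by (simp add: cinner_self)
  qed
  then show ?thesis by (simp add: J_non_negative_def A_densely_defined non_negative_def)
qed

lemma A_boundedly_invertible: "boundedly_invertible K (J_form kip J) domA A"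
  unfolding boundedly_invertible_def
proof (intro exI conjI ballI)
  show "bounded_operator K (J_form kip J) Tinv"
    unfolding bounded_operator_def linear_operator_def
  proof (intro conjI exI ballI)
    fix x assume x: "x \<in> K"
    have "knorm (Tinv x) \<le> embedding_const * norm x" by (rule knorm_Tinv)
    also have "\<dots> \<le> embedding_const * (embedding_const * knorm x)" using embedding_const_pos norm_le_knorm[OF x] by simp
    finally show "knorm (Tinv x) \<le> embedding_const * embedding_const * knorm x" by (simp add: mult_ac)
  qed (use kf.S_sub in \<open>auto simp: Tinv_add Tinv_scale\<close>)
qed (auto simp: A_eq in_domA)

subsection \<open>The operators \<open>E (\<Delta>)\<close> in \<open>K\<close>\<close>

lemma E_bounded_set:
  assumes B: "B \<in> sets borel" "bounded B"
  shows "E B f \<in> domT" and "\<exists>M. \<forall>f. norm (T (E B f)) \<le> M * norm f"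
proof -
  obtain M where M: "\<And>t. t \<in> B \<Longrightarrow> \<bar>t\<bar> \<le> M" using B(2) by (auto simp: bounded_real)
  have le: "cmod (complex_of_real t * indicator B t) \<le> \<bar>M\<bar>" for t
    using M[of t] by (auto simp: indicator_def)
  then have bb: "bounded_borel (\<lambda>t. complex_of_real t * indicator B t)"
    using B(1) by (intro bounded_borelI[of _ "\<bar>M\<bar>"] borel_measurable_times borel_measurable_indicator) auto
  show "E B f \<in> domT" using fcalc_in_domT[OF _ bb, of f] B(1) by (simp add: fcalc_indicator)
  have "norm (T (E B f)) \<le> \<bar>M\<bar> * norm f" for f
    using T_fcalc_eq[OF _ bb, of f] norm_fcalc_le[OF bb le, of f] B(1) by (simp add: fcalc_indicator)
  then show "\<exists>M. \<forall>f. norm (T (E B f)) \<le> M * norm f" by blast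
qed

lemma bounded_operator_E:
  assumes B: "B \<in> sets borel" "bounded B"
  shows "bounded_operator K (J_form kip J) (restrict (E B) K)"
    and "bounded_operator K (J_form kip J) (restrict (E (- B)) K)"
proof -
  have in_K: "E B f \<in> K" for f using E_bounded_set(1)[OF B] by (rule domT_K)
  obtain M where M: "\<And>f. norm (T (E B f)) \<le> M * norm f" using E_bounded_set(2)[OF B] by blast
  have bd: "knorm (E B x) \<le> embedding_const * \<bar>M\<bar> * embedding_const * knorm x" if x: "x \<in> K" for x
  proof -
    have "knorm (E B x) \<le> embedding_const * norm (T (E B x))" using E_bounded_set(1)[OF B] by (rule knorm_le)
    also have "\<dots> \<le> embedding_const * (\<bar>M\<bar> * norm x)"
      using embedding_const_pos order_trans[OF M[of x] mult_right_mono[OF abs_ge_self]] by simp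
    also have "\<dots> \<le> embedding_const * (\<bar>M\<bar> * (embedding_const * knorm x))"
      using embedding_const_pos norm_le_knorm[OF x] by (simp add: mult_left_mono)
    finally show ?thesis by (simp add: mult_ac)
  qed
  show "bounded_operator K (J_form kip J) (restrict (E B) K)"
    unfolding bounded_operator_def linear_operator_def
    using kf.S_sub in_K bd by (auto simp: E_add[OF B(1)] E_scale[OF B(1)])
  have "knorm (E (- B) x) \<le> (1 + embedding_const * \<bar>M\<bar> * embedding_const) * knorm x" if x: "x \<in> K" for x
    using kj.nrm_triangle[of x "- E B x"] kj.nrm_minus_commute[of 0 "E B x"] x in_K bd[OF x]
    by (simp add: E_compl[OF B(1)] algebra_simps)
  then show "bounded_operator K (J_form kip J) (restrict (E (- B)) K)"
    unfolding bounded_operator_def linear_operator_def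
    using kf.S_sub in_K
    by (auto simp: E_compl[OF B(1)] E_add[OF B(1)] E_scale[OF B(1)] cvec.scale_right_diff_distrib)
qed

subsection \<open>Convergence in \<open>K\<close>\<close>

text \<open>
  This criterion, a consequence of \<open>knorm_le\<close>, is the way in which all limits in \<open>K\<close> below are obtained.
\<close>

lemma limitin_K:
  assumes x: "\<forall>\<^sub>F i in F. x i \<in> domT" and a: "a \<in> domT"
    and lim: "((\<lambda>i. T (x i)) \<longlongrightarrow> T a) F"
  shows "limitin (krein_topology K kip J) x a F"
  unfolding krein_topology_def kj.limitin_ip
proof (intro conjI)
  show "a \<in> K" using a by (rule domT_K)
  show "\<forall>\<^sub>F i in F. x i \<in> K" using x by eventually_elim (rule domT_K)
  have "((\<lambda>i. embedding_const * norm (T (x i) - T a)) \<longlongrightarrow> embedding_const * norm (T a - T a)) F"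
    by (intro tendsto_intros lim)
  then have 0: "((\<lambda>i. embedding_const * norm (T (x i) - T a)) \<longlongrightarrow> 0) F" by simp
  show "((\<lambda>i. knorm (x i - a)) \<longlongrightarrow> 0) F"
  proof (rule Lim_null_comparison[OF _ 0])
    show "\<forall>\<^sub>F i in F. norm (knorm (x i - a)) \<le> embedding_const * norm (T (x i) - T a)"
      using x
    proof eventually_elim
      case (elim i)
      have d: "x i - a \<in> domT" using elim a by (rule csubspace_minus[OF domT_sub])
      show ?case
        using knorm_le[OF d] kj.nrm_nonneg[OF domT_K[OF d]] by (simp add: T_diff[OF elim a])
    qed
  qed
qed

lemma limitin_K_fcalc:
  fixes \<phi> :: "real \<Rightarrow> real \<Rightarrow> complex"
  assumes \<phi>: "\<forall>\<^sub>F e in at_right 0. bounded_borel (\<phi> e) \<and> bounded_borel (\<lambda>t. complex_of_real t * \<phi> e t)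
      \<and> (\<forall>t. cmod (complex_of_real t * \<phi> e t) \<le> M)"
    and \<psi>: "bounded_borel \<psi>" "bounded_borel (\<lambda>t. complex_of_real t * \<psi> t)"
    and pt: "\<And>t. ((\<lambda>e. \<phi> e t) \<longlongrightarrow> \<psi> t) (at_right 0)"
  shows "limitin (krein_topology K kip J) (\<lambda>e. fcalc (\<phi> e) f) (fcalc \<psi> f) (at_right 0)"
proof (rule limitin_K)
  show "\<forall>\<^sub>F e in at_right 0. fcalc (\<phi> e) f \<in> domT"
    using \<phi> by eventually_elim (auto intro: fcalc_in_domT)
  show "fcalc \<psi> f \<in> domT" using \<psi> by (rule fcalc_in_domT)
  have "((\<lambda>e. fcalc (\<lambda>t. complex_of_real t * \<phi> e t) f) \<longlongrightarrow> fcalc (\<lambda>t. complex_of_real t * \<psi> t) f) (at_right 0)"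
  proof (rule fcalc_tendsto_at_right_0[where \<phi> = "\<lambda>e t. complex_of_real t * \<phi> e t"])
    show "\<forall>\<^sub>F e in at_right 0. bounded_borel (\<lambda>t. complex_of_real t * \<phi> e t)
        \<and> (\<forall>t. cmod (complex_of_real t * \<phi> e t) \<le> M)"
      using \<phi> by eventually_elim auto
    show "((\<lambda>e. complex_of_real t * \<phi> e t) \<longlongrightarrow> complex_of_real t * \<psi> t) (at_right 0)" for t
      by (intro tendsto_intros pt)
  qed fact
  moreover have "\<forall>\<^sub>F e in at_right 0. fcalc (\<lambda>t. complex_of_real t * \<phi> e t) f = T (fcalc (\<phi> e) f)"
    using \<phi> by eventually_elim (auto simp: T_fcalc_eq)
  ultimately show "((\<lambda>e. T (fcalc (\<phi> e) f)) \<longlongrightarrow> T (fcalc \<psi> f)) (at_right 0)"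
    using T_fcalc_eq[OF \<psi>] by (simp add: Lim_transform_eventually)
qed

text \<open>
  The inverse of \<open>T - l\<close> maps \<open>K\<close> into \<open>domA\<close>: if \<open>T x - l x = f\<close> with \<open>f \<in> K\<close>, then
  \<open>T x = f + l x\<close> is in \<open>K\<close> as well.
\<close>

lemma resolvent_A:
  assumes l: "Im l \<noteq> 0" and f: "f \<in> K"
  shows "resolvent domA A l f = fcalc (\<lambda>t. 1 / (complex_of_real t - l)) f"
proof -
  define x where "x = fcalc (\<lambda>t. 1 / (complex_of_real t - l)) f"
  have x: "x \<in> domT" "T x - l *\<^sub>C x = f" using T_minus_fcalc[OF l, of f] by (auto simp: x_def)
  then have "T x = f + l *\<^sub>C x" by (simp add: algebra_simps)
  then have xA: "x \<in> domA" using x f domT_K by (simp add: in_domA)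
  have "inj_on (\<lambda>x. A x - l *\<^sub>C x) domA"
  proof (rule inj_onI)
    fix u v assume uv: "u \<in> domA" "v \<in> domA" "A u - l *\<^sub>C u = A v - l *\<^sub>C v"
    have dom: "u \<in> domT" "v \<in> domT" using uv by (auto simp: in_domA)
    have "T (u - v) = l *\<^sub>C (u - v)"
      using uv(3) by (simp add: A_eq[OF uv(1)] A_eq[OF uv(2)] T_diff[OF dom] cvec.scale_right_diff_distrib algebra_simps)
    from T_minus_inj[OF l csubspace_minus[OF domT_sub dom] this] show "u = v" by simp
  qed
  from inv_into_f_f[OF this xA] show ?thesis
    unfolding resolvent_def x_def[symmetric] using x(2) by (simp add: A_eq[OF xA])
qed

end

section \<open>The contour integral of a scalar resolvent\<close>

definition seg_int :: "complex \<Rightarrow> complex \<Rightarrow> real \<Rightarrow> complex" where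
  "seg_int p q t = integral {0..1} (\<lambda>s. (q - p) / (complex_of_real t - linepath p q s))"

lemma has_integral_seg_int:
  assumes "\<And>s. s \<in> {0..1} \<Longrightarrow> Im (linepath p q s) \<noteq> 0"
  shows "((\<lambda>s. (q - p) / (complex_of_real t - linepath p q s)) has_integral seg_int p q t) {0..1}"
proof -
  have "continuous_on {0..1} (\<lambda>s. (q - p) / (complex_of_real t - linepath p q s))"
    using of_real_neq_nonreal[OF assms] by (intro continuous_intros) auto
  then show ?thesis
    unfolding seg_int_def by (intro integrable_integral integrable_continuous_real)
qed

text \<open>
  The lower half of the contour is the mirror image of the upper half, traversed backwards. In the sum
  of both halves only the imaginary parts survive.
\<close>

lemma seg_int_cnj_reverse:
  assumes "\<And>s. s \<in> {0..1} \<Longrightarrow> Im (linepath p q s) \<noteq> 0"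
  shows "seg_int (cnj q) (cnj p) t = - cnj (seg_int p q t)"
proof -
  have "((\<lambda>s. cnj ((q - p) / (complex_of_real t - linepath p q s))) has_integral cnj (seg_int p q t)) {0..1}"
    using has_integral_linear[OF has_integral_seg_int[OF assms] bounded_linear_cnj, of t]
    by (simp add: comp_def)
  \<comment> \<open>The substitution of \<open>1 - s\<close> for \<open>s\<close>.\<close>
  from has_integral_affinity[OF this[folded cbox_interval], of "-1" 1]
  have "((\<lambda>s. cnj ((q - p) / (complex_of_real t - linepath p q (1 - s)))) has_integral cnj (seg_int p q t)) {0..1}"
    by (simp add: image_affinity_atLeastAtMost)
  then have "((\<lambda>s. - ((cnj p - cnj q) / (complex_of_real t - linepath (cnj q) (cnj p) s)))
      has_integral cnj (seg_int p q t)) {0..1}"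
    by (rule has_integral_eq[rotated])
      (simp add: linepath_def algebra_simps minus_divide_left)
  from integral_unique[OF has_integral_neg[OF this]] show ?thesis by (simp add: seg_int_def)
qed

text \<open>
  The imaginary parts have elementary antiderivatives in terms of \<open>arctan\<close>; branches of the complex logarithm do
  not enter.
\<close>

lemma Im_seg_int:
  assumes nz: "\<And>s. s \<in> {0..1} \<Longrightarrow> Im (linepath p q s) \<noteq> 0"
    and F: "\<And>s. s \<in> {0..1} \<Longrightarrow>
      (F has_real_derivative Im ((q - p) / (complex_of_real t - linepath p q s))) (at s)"
  shows "Im (seg_int p q t) = F 1 - F 0"
proof (rule has_integral_unique)
  show "((\<lambda>s. Im ((q - p) / (complex_of_real t - linepath p q s))) has_integral Im (seg_int p q t)) {0..1}"
    using has_integral_linear[OF has_integral_seg_int[OF nz] bounded_linear_Im, of t]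
    by (simp add: comp_def)
  show "((\<lambda>s. Im ((q - p) / (complex_of_real t - linepath p q s))) has_integral F 1 - F 0) {0..1}"
    using F by (intro fundamental_theorem_of_calculus)
      (auto simp: has_real_derivative_iff_has_vector_derivative[symmetric] intro: has_field_derivative_at_within)
qed

text \<open>
  For \<open>t = b\<close> the integrand is real, and both values of \<open>arctan\<close> are \<open>arctan 0\<close> by the convention for
  division by zero. So the formula includes the case that the line through the segment passes
  through \<open>t\<close>.
\<close>

lemma Im_seg_int_vertical:
  assumes y: "0 < y0" "0 < y1"
  shows "Im (seg_int (Complex b y0) (Complex b y1) t) = arctan (y1 / (t - b)) - arctan (y0 / (t - b))"
proof -
  define y where "y s = y0 + s * (y1 - y0)" for s
  have lp: "linepath (Complex b y0) (Complex b y1) s = Complex b (y s)" for s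
    by (simp add: linepath_def y_def complex_eq_iff algebra_simps)
  have ypos: "y s > 0" if "s \<in> {0..1}" for s
  proof -
    have "y s = (1 - s) * y0 + s * y1" by (simp add: y_def algebra_simps)
    then show ?thesis using that y
      by (cases "s = 0") (auto intro!: add_nonneg_pos mult_pos_pos mult_nonneg_nonneg)
  qed
  have "Im (seg_int (Complex b y0) (Complex b y1) t)
      = (\<lambda>s. arctan (y s / (t - b))) 1 - (\<lambda>s. arctan (y s / (t - b))) 0"
  proof (rule Im_seg_int)
    fix s :: real assume s: "s \<in> {0..1}"
    show "Im (linepath (Complex b y0) (Complex b y1) s) \<noteq> 0" using ypos[OF s] by (simp add: lp)
    have "Im ((Complex b y1 - Complex b y0) / (complex_of_real t - linepath (Complex b y0) (Complex b y1) s))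
        = (y1 - y0) * (t - b) / ((t - b)\<^sup>2 + (y s)\<^sup>2)"
      by (simp add: lp Im_divide)
    moreover have "((\<lambda>s. arctan (y s / (t - b))) has_real_derivative
        (y1 - y0) * (t - b) / ((t - b)\<^sup>2 + (y s)\<^sup>2)) (at s)"
    proof (cases "t = b")
      case False
      then have pos: "(t - b)\<^sup>2 + (y s)\<^sup>2 > 0" by (simp add: add_pos_nonneg)
      have "((\<lambda>s. arctan (y s / (t - b))) has_real_derivative
        inverse (1 + (y s / (t - b))\<^sup>2) * ((y1 - y0) / (t - b))) (at s)"
        unfolding y_def using False by (auto intro!: derivative_eq_intros)
      also have "inverse (1 + (y s / (t - b))\<^sup>2) * ((y1 - y0) / (t - b))
          = (y1 - y0) * (t - b) / ((t - b)\<^sup>2 + (y s)\<^sup>2)"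
      proof -
        have "1 + (y s / (t - b))\<^sup>2 = ((t - b)\<^sup>2 + (y s)\<^sup>2) / (t - b)\<^sup>2"
          using False by (simp add: power_divide add_divide_distrib)
        then show ?thesis using False pos by (simp add: power2_eq_square)
      qed
      finally show ?thesis .
    qed simp
    ultimately show "((\<lambda>s. arctan (y s / (t - b))) has_real_derivative
        Im ((Complex b y1 - Complex b y0) / (complex_of_real t - linepath (Complex b y0) (Complex b y1) s))) (at s)"
      by simp
  qed
  then show ?thesis by (simp add: y_def)
qed

lemma Im_seg_int_horizontal:
  "Im (seg_int (Complex b 1) (Complex a 1) t) = arctan (a - t) - arctan (b - t)"
proof -
  define x where "x s = b + s * (a - b)" for s
  have lp: "linepath (Complex b 1) (Complex a 1) s = Complex (x s) 1" for s
    by (simp add: linepath_def x_def complex_eq_iff algebra_simps)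
  have "Im (seg_int (Complex b 1) (Complex a 1) t) = (\<lambda>s. arctan (x s - t)) 1 - (\<lambda>s. arctan (x s - t)) 0"
  proof (rule Im_seg_int)
    fix s :: real
    show "Im (linepath (Complex b 1) (Complex a 1) s) \<noteq> 0" by (simp add: lp)
    have "Im ((Complex a 1 - Complex b 1) / (complex_of_real t - linepath (Complex b 1) (Complex a 1) s))
        = inverse (1 + (x s - t)\<^sup>2) * (a - b)"
      by (simp add: lp Im_divide divide_inverse power2_commute add.commute)
    moreover have "((\<lambda>s. arctan (x s - t)) has_real_derivative inverse (1 + (x s - t)\<^sup>2) * (a - b)) (at s)"
      unfolding x_def by (auto intro!: derivative_eq_intros)
    ultimately show "((\<lambda>s. arctan (x s - t)) has_real_derivative
        Im ((Complex a 1 - Complex b 1) / (complex_of_real t - linepath (Complex b 1) (Complex a 1) s))) (at s)"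
      by simp
  qed
  then show ?thesis by (simp add: x_def)
qed

text \<open>
  The normalized contour integral of \<open>1 / (t - l)\<close>, as \<open>contour_seg_int\<close> will show. For \<open>\<delta> = 0\<close>
  it is the indicator function of \<open>[a, b]\<close> with the value \<open>1 / 2\<close> at the end points (if \<open>a < b\<close>), which is the
  limit for \<open>\<delta>\<close> tending to \<open>0\<close>.
\<close>

definition smooth_jump :: "real \<Rightarrow> real \<Rightarrow> real \<Rightarrow> real \<Rightarrow> real" where
  "smooth_jump \<delta> a b t =
     (sgn (b - t) - sgn (a - t)) / 2 - (arctan (\<delta> / (b - t)) - arctan (\<delta> / (a - t))) / pi"

lemma arctan_plus_arctan_inverse: "arctan x + arctan (1 / x) = sgn x * (pi / 2)"
  using Transcendental.arctan_inverse[of x] by (cases "x = 0") auto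

text \<open>
  Up to sign, the vertical segments contribute \<open>arctan (1 / s) - arctan (\<delta> / s)\<close> and the horizontal ones \<open>arctan s\<close>, where
  \<open>s\<close> is \<open>b - t\<close> or \<open>a - t\<close>; the terms without \<open>\<delta>\<close> combine to \<open>sgn s (\<pi> / 2)\<close>.
\<close>

lemma contour_seg_int:
  assumes \<delta>: "0 < \<delta>" "\<delta> < 1" and ab: "a \<le> b"
  shows "(\<Sum>(p, q)\<leftarrow>contour a b \<delta>. seg_int p q t)
    = - 2 * of_real pi * \<i> * of_real (smooth_jump \<delta> a b t)"
proof -
  have im: "Im (linepath p q s) > 0" if "s \<in> {0..1}" "Im p > 0" "Im q > 0" for p q s
    using that by (cases "s = 0") (auto simp: linepath_def intro!: add_nonneg_pos)
  have rev: "seg_int (cnj q) (cnj p) t = - cnj (seg_int p q t)" if "Im p > 0" "Im q > 0" for p q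
    using im[OF _ that] by (intro seg_int_cnj_reverse) force
  define V where "V = seg_int (Complex b \<delta>) (Complex b 1) t"
  define H where "H = seg_int (Complex b 1) (Complex a 1) t"
  define W where "W = seg_int (Complex a 1) (Complex a \<delta>) t"
  have "(\<Sum>(p, q)\<leftarrow>contour a b \<delta>. seg_int p q t)
      = V + (H + (W + (- cnj W + (- cnj H + - cnj V))))"
    using \<delta> ab rev[of "Complex b \<delta>" "Complex b 1"] rev[of "Complex b 1" "Complex a 1"]
      rev[of "Complex a 1" "Complex a \<delta>"]
    by (simp add: contour_def V_def H_def W_def complex_cnj)
  also have "\<dots> = 2 * \<i> * of_real (Im V + Im H + Im W)"
    by (simp add: complex_eq_iff)
  also have "Im V + Im H + Im W = - pi * smooth_jump \<delta> a b t"
  proof -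
    have neg: "arctan (y / (t - x)) = - arctan (y / (x - t))" for x y
      using arctan_minus[of "y / (x - t)"] by (simp add: minus_divide_right)
    have "Im V + Im H + Im W = - (arctan (b - t) + arctan (1 / (b - t))) + (arctan (a - t) + arctan (1 / (a - t)))
        + arctan (\<delta> / (b - t)) - arctan (\<delta> / (a - t))"
      using \<delta> by (simp add: V_def H_def W_def Im_seg_int_vertical Im_seg_int_horizontal neg)
    also have "\<dots> = - pi * smooth_jump \<delta> a b t"
      unfolding arctan_plus_arctan_inverse by (simp add: smooth_jump_def field_simps)
    finally show ?thesis .
  qed
  finally show ?thesis by simp
qed

text \<open>
  The bounds for dominated convergence. The factor \<open>t\<close> is there because limits in \<open>K\<close> are controlled by
  \<open>T\<close>. It is harmless since \<open>|arctan (\<delta> / (c - t))|\<close> is at most \<open>\<delta> / |c - t|\<close>.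
\<close>

lemma abs_times_smooth_jump_le:
  assumes \<delta>: "0 \<le> \<delta>" "\<delta> \<le> 1"
  shows "\<bar>smooth_jump \<delta> a b t\<bar> \<le> 5"
    and "\<bar>t * smooth_jump \<delta> a b t\<bar> \<le> 3 * (\<bar>a\<bar> + \<bar>b\<bar>) + 2"
proof -
  have at: "\<bar>arctan x\<bar> \<le> 2" for x
    using arctan_bounded[of x] pi_less_4 by linarith
  have div: "\<bar>x / pi\<bar> \<le> \<bar>x\<bar>" for x
  proof -
    have "\<bar>x\<bar> * 1 \<le> \<bar>x\<bar> * pi" using pi_gt3 by (intro mult_left_mono) auto
    then show ?thesis by (simp add: divide_le_eq)
  qed
  have "\<bar>(sgn (b - t) - sgn (a - t)) / 2\<bar> \<le> 1" by (simp add: sgn_if)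
  moreover have "\<bar>(arctan (\<delta> / (b - t)) - arctan (\<delta> / (a - t))) / pi\<bar> \<le> 4"
    using at[of "\<delta> / (b - t)"] at[of "\<delta> / (a - t)"]
    by (intro order_trans[OF div]) linarith
  ultimately show "\<bar>smooth_jump \<delta> a b t\<bar> \<le> 5" unfolding smooth_jump_def by linarith
  have tail: "\<bar>t * arctan (\<delta> / (c - t))\<bar> \<le> 2 * \<bar>c\<bar> + 1" for c
  proof -
    have "\<bar>c - t\<bar> * \<bar>arctan (\<delta> / (c - t))\<bar> \<le> \<bar>c - t\<bar> * \<bar>\<delta> / (c - t)\<bar>"
      by (intro mult_left_mono abs_arctan_le) auto
    also have "\<dots> \<le> 1" using \<delta> by (cases "c = t") auto
    finally have 1: "\<bar>c - t\<bar> * \<bar>arctan (\<delta> / (c - t))\<bar> \<le> 1" .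
    have 2: "\<bar>c\<bar> * \<bar>arctan (\<delta> / (c - t))\<bar> \<le> \<bar>c\<bar> * 2"
      using at by (intro mult_left_mono) auto
    have "\<bar>t * arctan (\<delta> / (c - t))\<bar> \<le> (\<bar>c\<bar> + \<bar>c - t\<bar>) * \<bar>arctan (\<delta> / (c - t))\<bar>"
      unfolding abs_mult by (intro mult_right_mono) auto
    with 1 2 show ?thesis by (simp add: distrib_right)
  qed
  have 1: "\<bar>t * ((sgn (b - t) - sgn (a - t)) / 2)\<bar> \<le> \<bar>a\<bar> + \<bar>b\<bar>"
    by (auto simp: sgn_if abs_mult abs_if split: if_splits)
  have 2: "\<bar>(t * arctan (\<delta> / (b - t)) - t * arctan (\<delta> / (a - t))) / pi\<bar> \<le> (2 * \<bar>b\<bar> + 1) + (2 * \<bar>a\<bar> + 1)"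
    using tail[of b] tail[of a] by (intro order_trans[OF div]) linarith
  have "t * smooth_jump \<delta> a b t = t * ((sgn (b - t) - sgn (a - t)) / 2)
      - (t * arctan (\<delta> / (b - t)) - t * arctan (\<delta> / (a - t))) / pi"
    by (simp add: smooth_jump_def right_diff_distrib)
  then have "\<bar>t * smooth_jump \<delta> a b t\<bar> \<le> \<bar>t * ((sgn (b - t) - sgn (a - t)) / 2)\<bar>
      + \<bar>(t * arctan (\<delta> / (b - t)) - t * arctan (\<delta> / (a - t))) / pi\<bar>"
    by (simp only: abs_triangle_ineq4)
  from order_trans[OF this add_mono[OF 1 2]]
  show "\<bar>t * smooth_jump \<delta> a b t\<bar> \<le> 3 * (\<bar>a\<bar> + \<bar>b\<bar>) + 2" by simp
qed

lemma bounded_borel_smooth_jump: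
  assumes \<delta>: "0 \<le> \<delta>" "\<delta> \<le> 1"
  shows "bounded_borel (\<lambda>t. complex_of_real (smooth_jump \<delta> a b t))"
    and "bounded_borel (\<lambda>t. complex_of_real t * complex_of_real (smooth_jump \<delta> a b t))"
    and "cmod (complex_of_real t * complex_of_real (smooth_jump \<delta> a b t)) \<le> 3 * (\<bar>a\<bar> + \<bar>b\<bar>) + 2"
proof -
  have [measurable]: "smooth_jump \<delta> a b \<in> borel_measurable borel"
    unfolding smooth_jump_def[abs_def] by measurable
  have m1: "(\<lambda>t. complex_of_real (smooth_jump \<delta> a b t)) \<in> borel_measurable borel"
    and m2: "(\<lambda>t. complex_of_real t * complex_of_real (smooth_jump \<delta> a b t)) \<in> borel_measurable borel"
    by measurable
  show "bounded_borel (\<lambda>t. complex_of_real (smooth_jump \<delta> a b t))"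
    using abs_times_smooth_jump_le(1)[OF \<delta>] by (intro bounded_borelI[OF m1, of 5]) simp
  show le: "cmod (complex_of_real t * complex_of_real (smooth_jump \<delta> a b t)) \<le> 3 * (\<bar>a\<bar> + \<bar>b\<bar>) + 2" for t
    using abs_times_smooth_jump_le(2)[OF \<delta>, of t a b] by (simp add: norm_mult abs_mult)
  show "bounded_borel (\<lambda>t. complex_of_real t * complex_of_real (smooth_jump \<delta> a b t))"
    using le by (rule bounded_borelI[OF m2])
qed

lemma smooth_jump_tendsto: "((\<lambda>\<delta>. smooth_jump \<delta> a b t) \<longlongrightarrow> smooth_jump 0 a b t) (at_right 0)"
proof -
  have lim: "((\<lambda>\<delta>. \<delta> / x) \<longlongrightarrow> 0 / x) (at_right (0 :: real))" for x :: real
    by (cases "x = 0") (auto intro!: tendsto_eq_intros)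
  show ?thesis unfolding smooth_jump_def by (intro tendsto_intros lim) auto
qed

section \<open>Intervals and their approximating end points\<close>

text \<open>
  The shift of an end point moves it out of \<open>\<Delta>\<close> if it belongs to \<open>\<Delta>\<close> and strictly inside otherwise.
  So each \<open>t\<close> finally differs from both shifted end points and lies between them exactly if \<open>t \<in> \<Delta>\<close>. An
  interval with coinciding ends is a single point and is widened by the shift, so that the shifted ends are in the right order.
\<close>

lemma smooth_jump_0_eventually:
  assumes \<Delta>: "\<Delta> \<in> bounded_intervals" "\<Delta> \<noteq> {}"
  shows "\<forall>\<^sub>F \<epsilon> in at_right 0. left_end \<Delta> \<epsilon> < right_end \<Delta> \<epsilon>"
    and "\<forall>\<^sub>F \<epsilon> in at_right 0. smooth_jump 0 (left_end \<Delta> \<epsilon>) (right_end \<Delta> \<epsilon>) t = indicator \<Delta> t"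
    and "0 < \<epsilon> \<Longrightarrow> \<epsilon> < 1 \<Longrightarrow> \<bar>left_end \<Delta> \<epsilon>\<bar> + \<bar>right_end \<Delta> \<epsilon>\<bar> \<le> \<bar>Inf \<Delta>\<bar> + \<bar>Sup \<Delta>\<bar> + 2"
proof -
  have "is_interval \<Delta>" and bdd: "bdd_below \<Delta>" "bdd_above \<Delta>"
    using \<Delta> by (simp_all add: bounded_intervals_def bounded_imp_bdd_below bounded_imp_bdd_above)
  then have ivl: "\<And>x y z. x \<in> \<Delta> \<Longrightarrow> z \<in> \<Delta> \<Longrightarrow> x \<le> y \<Longrightarrow> y \<le> z \<Longrightarrow> y \<in> \<Delta>"
    unfolding is_interval_1 by blast
  note inf = cInf_lower[OF _ bdd(1)] and sup = cSup_upper[OF _ bdd(2)]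
  have le: "Inf \<Delta> \<le> Sup \<Delta>" using \<Delta>(2) inf sup by force
  have sing: "Inf \<Delta> \<in> \<Delta> \<and> Sup \<Delta> \<in> \<Delta>" if "Inf \<Delta> = Sup \<Delta>"
  proof -
    obtain x where "x \<in> \<Delta>" using \<Delta>(2) by blast
    then have "x = Inf \<Delta>" using inf[of x] sup[of x] that by simp
    then show ?thesis using \<open>x \<in> \<Delta>\<close> that by simp
  qed
  have small: "\<forall>\<^sub>F \<epsilon> in at_right 0. 0 < \<epsilon> \<and> \<epsilon> < r" if "r > 0" for r :: real
    using eventually_at_right_real[OF that] by eventually_elim auto
  show lt: "\<forall>\<^sub>F \<epsilon> in at_right 0. left_end \<Delta> \<epsilon> < right_end \<Delta> \<epsilon>"
  proof (cases "Inf \<Delta> = Sup \<Delta>")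
    case True
    show ?thesis using small[of 1, simplified] by eventually_elim (use True sing in \<open>auto simp: left_end_def right_end_def\<close>)
  next
    case False
    then have "(Sup \<Delta> - Inf \<Delta>) / 2 > 0" using le by simp
    from small[OF this] show ?thesis
      by eventually_elim (use le in \<open>auto simp: left_end_def right_end_def\<close>)
  qed
  show "0 < \<epsilon> \<Longrightarrow> \<epsilon> < 1 \<Longrightarrow> \<bar>left_end \<Delta> \<epsilon>\<bar> + \<bar>right_end \<Delta> \<epsilon>\<bar> \<le> \<bar>Inf \<Delta>\<bar> + \<bar>Sup \<Delta>\<bar> + 2"
    by (auto simp: left_end_def right_end_def)
  show "\<forall>\<^sub>F \<epsilon> in at_right 0. smooth_jump 0 (left_end \<Delta> \<epsilon>) (right_end \<Delta> \<epsilon>) t = indicator \<Delta> t"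
  proof (cases "t \<in> \<Delta>")
    case True
    have "\<forall>\<^sub>F \<epsilon> in at_right 0. left_end \<Delta> \<epsilon> < t"
    proof (cases "Inf \<Delta> \<in> \<Delta>")
      case True
      show ?thesis using small[of 1, simplified]
        by eventually_elim (use True inf[OF \<open>t \<in> \<Delta>\<close>] in \<open>auto simp: left_end_def\<close>)
    next
      case False
      then have "t - Inf \<Delta> > 0" using inf[OF \<open>t \<in> \<Delta>\<close>] \<open>t \<in> \<Delta>\<close> by (cases "t = Inf \<Delta>") auto
      from small[OF this] show ?thesis by eventually_elim (use False in \<open>auto simp: left_end_def\<close>)
    qed
    moreover have "\<forall>\<^sub>F \<epsilon> in at_right 0. t < right_end \<Delta> \<epsilon>"
    proof (cases "Sup \<Delta> \<in> \<Delta>")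
      case True
      show ?thesis using small[of 1, simplified]
        by eventually_elim (use True sup[OF \<open>t \<in> \<Delta>\<close>] in \<open>auto simp: right_end_def\<close>)
    next
      case False
      then have "Sup \<Delta> - t > 0" using sup[OF \<open>t \<in> \<Delta>\<close>] \<open>t \<in> \<Delta>\<close> by (cases "t = Sup \<Delta>") auto
      from small[OF this] show ?thesis by eventually_elim (use False in \<open>auto simp: right_end_def\<close>)
    qed
    ultimately show ?thesis
      by eventually_elim (use True in \<open>auto simp: smooth_jump_def\<close>)
  next
    case False
    have "(\<forall>x\<in>\<Delta>. t \<le> x) \<or> (\<forall>x\<in>\<Delta>. x \<le> t)" using ivl False by (meson linear)
    then consider "t \<le> Inf \<Delta>" | "Sup \<Delta> \<le> t"
      using cInf_greatest[OF \<Delta>(2), of t] cSup_least[OF \<Delta>(2), of t] by blast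
    then have "\<forall>\<^sub>F \<epsilon> in at_right 0. t < left_end \<Delta> \<epsilon> \<or> right_end \<Delta> \<epsilon> < t"
    proof cases
      case 1
      show ?thesis
      proof (cases "Inf \<Delta> \<in> \<Delta>")
        case True
        then have "Inf \<Delta> - t > 0" using 1 False by (cases "t = Inf \<Delta>") auto
        from small[OF this] show ?thesis by eventually_elim (use True in \<open>auto simp: left_end_def\<close>)
      next
        case False
        show ?thesis using small[of 1, simplified] by eventually_elim (use False 1 in \<open>auto simp: left_end_def\<close>)
      qed
    next
      case 2
      show ?thesis
      proof (cases "Sup \<Delta> \<in> \<Delta>")
        case True
        then have "t - Sup \<Delta> > 0" using 2 False by (cases "t = Sup \<Delta>") auto
        from small[OF this] show ?thesis by eventually_elim (use True in \<open>auto simp: right_end_def\<close>)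
      next
        case False
        show ?thesis using small[of 1, simplified] by eventually_elim (use False 2 in \<open>auto simp: right_end_def\<close>)
      qed
    qed
    with lt show ?thesis
      by eventually_elim (use False in \<open>auto simp: smooth_jump_def\<close>)
  qed
qed

lemma bounded_intervals_borel: "\<Delta> \<in> bounded_intervals \<Longrightarrow> \<Delta> \<in> sets borel"
proof -
  assume "\<Delta> \<in> bounded_intervals"
  then have ivl: "x \<in> \<Delta>" if "a \<in> \<Delta>" "b \<in> \<Delta>" "a \<le> x" "x \<le> b" for a b x
    using that unfolding bounded_intervals_def is_interval_1 mem_Collect_eq by blast
  have "\<exists>a b. \<Delta> = {} \<or> \<Delta> = UNIV \<or> \<Delta> = {..<b} \<or> \<Delta> = {..b} \<or> \<Delta> = {a<..} \<or> \<Delta> = {a..} \<or>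
      \<Delta> = {a<..<b} \<or> \<Delta> = {a<..b} \<or> \<Delta> = {a..<b} \<or> \<Delta> = {a..b}"
    using ivl by (rule interval_cases)
  then show ?thesis by auto
qed

section \<open>Contour integrals in the Krein space\<close>

lemma norm_linepath_le:
  fixes p q :: complex
  assumes "s \<in> {0..1}"
  shows "cmod (linepath p q s) \<le> cmod p + cmod q"
proof -
  have "cmod (linepath p q s) \<le> (1 - s) * cmod p + s * cmod q"
    using assms norm_triangle_ineq[of "(1 - s) *\<^sub>R p" "s *\<^sub>R q"] by (simp add: linepath_def)
  also have "\<dots> \<le> 1 * cmod p + 1 * cmod q"
    using assms by (intro add_mono mult_right_mono) auto
  finally show ?thesis by simp
qed

lemma norm_times_resolvent_fun_le:
  assumes \<delta>: "0 < \<delta>" "\<delta> \<le> \<bar>Im l\<bar>"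
  shows "cmod (1 / (complex_of_real t - l)) \<le> 1 / \<delta>"
    and "cmod (complex_of_real t * (1 / (complex_of_real t - l))) \<le> 1 + cmod l / \<delta>"
proof -
  have "cmod (1 / (complex_of_real t - l)) \<le> 1 / \<bar>Im l\<bar>" using \<delta> by (intro resolvent_fun_le) auto
  also have "\<dots> \<le> 1 / \<delta>" using \<delta> by (simp add: frac_le)
  finally show 1: "cmod (1 / (complex_of_real t - l)) \<le> 1 / \<delta>" .
  have "cmod (complex_of_real t * (1 / (complex_of_real t - l)))
      \<le> 1 + cmod (l * (1 / (complex_of_real t - l)))"
    using times_resolvent_fun[of l t] \<delta> norm_triangle_ineq[of 1 "l * (1 / (complex_of_real t - l))"] by simp
  also have "\<dots> \<le> 1 + cmod l * (1 / \<delta>)"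
    unfolding norm_mult using 1 by (intro add_left_mono mult_left_mono) auto
  finally show "cmod (complex_of_real t * (1 / (complex_of_real t - l))) \<le> 1 + cmod l / \<delta>" by simp
qed

instance bcontfun :: (metric_space, banach) banach ..

text \<open>
  The integrand of a segment integral, multiplied by \<open>t\<close>, is a Lipschitz continuous path in the
  Banach space of bounded continuous functions of \<open>t\<close>. Integration in that space commutes with bounded
  linear maps. Two of these are of interest: evaluation at a point, which identifies the
  integral, and the functional calculus, which turns the integral of functions into one of vectors.
\<close>

lemma seg_kernel_has_integral:
  fixes p q :: complex and \<delta> :: real
  assumes \<delta>: "0 < \<delta>" and Im: "\<And>s. s \<in> {0..1} \<Longrightarrow> \<delta> \<le> \<bar>Im (linepath p q s)\<bar>"
  defines "k \<equiv> \<lambda>s t. (q - p) * (complex_of_real t * (1 / (complex_of_real t - linepath p q s)))"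
  obtains B :: "real \<Rightarrow> real \<Rightarrow>\<^sub>C complex" and b :: "real \<Rightarrow>\<^sub>C complex"
  where "(B has_integral b) {0..1}"
    and "\<And>s. s \<in> {0..1} \<Longrightarrow> apply_bcontfun (B s) = k s"
    and "\<And>t. apply_bcontfun b t = complex_of_real t * seg_int p q t"
proof -
  define R where "R = cmod p + cmod q"
  have nz: "Im (linepath p q s) \<noteq> 0" if "s \<in> {0..1}" for s using Im[OF that] \<delta> by auto
  have lR: "cmod (linepath p q s) \<le> R" if "s \<in> {0..1}" for s
    unfolding R_def by (rule norm_linepath_le[OF that])
  define M where "M = 1 + R / \<delta>"
  have M: "cmod (complex_of_real t * (1 / (complex_of_real t - linepath p q s))) \<le> M" if s: "s \<in> {0..1}" for s t
  proof -
    have "1 + cmod (linepath p q s) / \<delta> \<le> M" using lR[OF s] \<delta> by (simp add: M_def divide_right_mono)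
    with norm_times_resolvent_fun_le(2)[OF \<delta> Im[OF s], of t] show ?thesis by linarith
  qed
  define B where "B s = Bcontfun (k s)" for s
  have B: "apply_bcontfun (B s) = k s" if s: "s \<in> {0..1}" for s
  proof -
    have "k s \<in> bcontfun"
    proof (rule bcontfun_normI)
      show "continuous_on UNIV (k s)"
        unfolding k_def using of_real_neq_nonreal[OF nz[OF s]] by (intro continuous_intros) auto
      show "norm (k s t) \<le> cmod (q - p) * M" for t
        unfolding k_def norm_mult[of "q - p"] using M[OF s] by (intro mult_left_mono) auto
    qed
    then show ?thesis by (simp add: B_def Bcontfun_inverse)
  qed
  define L where "L = cmod (q - p) * (M * (cmod (q - p) * (1 / \<delta>)))"
  have M0: "M \<ge> 0" using order_trans[OF norm_ge_zero M[of 0 0]] by simp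
  have "L-lipschitz_on {0..1} B"
  proof (rule lipschitz_onI)
    show "0 \<le> L" using \<delta> M0 by (simp add: L_def)
    fix s s' :: real assume s: "s \<in> {0..1}" and s': "s' \<in> {0..1}"
    show "dist (B s) (B s') \<le> L * dist s s'"
    proof (rule dist_bound)
      fix t
      define l l' where "l = linepath p q s" and "l' = linepath p q s'"
      have d: "complex_of_real t - l \<noteq> 0" "complex_of_real t - l' \<noteq> 0"
        using of_real_neq_nonreal nz s s' by (auto simp: l_def l'_def)
      have ll: "l - l' = (s - s') *\<^sub>R (q - p)"
        by (simp add: l_def l'_def linepath_def algebra_simps)
      then have lln: "cmod (l - l') \<le> \<bar>s - s'\<bar> * cmod (q - p)" by simp
      have "k s t - k s' t = (q - p) * ((complex_of_real t * (1 / (complex_of_real t - l))) * ((l - l') * (1 / (complex_of_real t - l'))))"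
        using d by (simp add: k_def l_def[symmetric] l'_def[symmetric] field_simps)
      also have "cmod \<dots> \<le> cmod (q - p) * (M * ((\<bar>s - s'\<bar> * cmod (q - p)) * (1 / \<delta>)))"
        unfolding norm_mult[of "q - p"] norm_mult[of "complex_of_real t * (1 / (complex_of_real t - l))"] norm_mult[of "l - l'"]
        using M[OF s, of t, folded l_def] norm_times_resolvent_fun_le(1)[OF \<delta> Im[OF s'], of t, folded l'_def] lln M0
        by (intro mult_left_mono mult_mono) auto
      finally show "dist (apply_bcontfun (B s) t) (apply_bcontfun (B s') t) \<le> L * dist s s'"
        by (simp add: B[OF s] B[OF s'] dist_norm L_def mult_ac)
    qed
  qed
  then have "B integrable_on {0..1}"
    by (rule integrable_continuous_real[OF lipschitz_on_continuous_on])
  then obtain b where b: "(B has_integral b) {0..1}" by blast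
  have "apply_bcontfun b t = complex_of_real t * seg_int p q t" for t
  proof (rule has_integral_unique)
    have "bounded_linear (\<lambda>b. apply_bcontfun b t :: complex)"
      by (rule bounded_linear_intro[of _ 1]) (auto simp: norm_bounded)
    from has_integral_linear[OF b this]
    show "((\<lambda>s. apply_bcontfun (B s) t) has_integral apply_bcontfun b t) {0..1}" by (simp add: comp_def)
    have "((\<lambda>s. complex_of_real t * ((q - p) / (complex_of_real t - linepath p q s)))
        has_integral complex_of_real t * seg_int p q t) {0..1}"
      by (intro has_integral_mult_right has_integral_seg_int nz)
    then show "((\<lambda>s. apply_bcontfun (B s) t) has_integral complex_of_real t * seg_int p q t) {0..1}"
      by (rule has_integral_eq[rotated]) (simp add: B k_def)
  qed
  with b B that show thesis by blast
qed

lemma bounded_borel_bcontfun: "bounded_borel (apply_bcontfun b)" for b :: "real \<Rightarrow>\<^sub>C complex"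
  by (rule bounded_borelI[OF borel_measurable_continuous_onI norm_bounded]) simp

lemma (in spectral) bounded_linear_fcalc_bcontfun:
  "bounded_linear (\<lambda>b :: real \<Rightarrow>\<^sub>C complex. fcalc (apply_bcontfun b) f)"
proof (rule bounded_linear_intro)
  fix b b' :: "real \<Rightarrow>\<^sub>C complex" and r :: real
  show "fcalc (apply_bcontfun (b + b')) f = fcalc (apply_bcontfun b) f + fcalc (apply_bcontfun b') f"
    using fcalc_add[OF bounded_borel_bcontfun bounded_borel_bcontfun, of b b' f]
    by (simp add: plus_bcontfun.rep_eq)
  show "fcalc (apply_bcontfun (r *\<^sub>R b)) f = r *\<^sub>R fcalc (apply_bcontfun b) f"
    using fcalc_scale[OF bounded_borel_bcontfun, of "complex_of_real r" b f]
    by (simp add: scaleR_bcontfun.rep_eq scaleR_conv_of_real scaleR_scaleC)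
  show "norm (fcalc (apply_bcontfun b) f) \<le> norm b * norm f"
    by (rule norm_fcalc_le[OF bounded_borel_bcontfun norm_bounded])
qed

context krein_setting
begin

lemma T_sum:
  assumes "\<And>i. i \<in> S \<Longrightarrow> x i \<in> domT"
  shows "sum x S \<in> domT \<and> T (sum x S) = (\<Sum>i\<in>S. T (x i))"
  using assms
proof (induction S rule: infinite_finite_induct)
  case (insert i S)
  then show ?case using cvec.subspace_add[OF domT_sub] by (simp add: T_add)
qed (use cvec.subspace_0[OF domT_sub] T_scale[of 0 0] in auto)

text \<open>
  By \<open>limitin_K\<close> the Riemann sums need to converge in \<open>H\<close> after application of \<open>T\<close>. Then they
  are Riemann sums of the integral provided by \<open>seg_kernel_has_integral\<close>.
\<close>

lemma has_segment_integral_resolvent: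
  assumes f: "f \<in> K" and \<delta>: "0 < \<delta>" and Im: "\<And>s. s \<in> {0..1} \<Longrightarrow> \<delta> \<le> \<bar>Im (linepath p q s)\<bar>"
  shows "bounded_borel (\<lambda>t. complex_of_real t * seg_int p q t)"
    and "has_segment_integral (krein_topology K kip J) (\<lambda>l. resolvent domA A l f) (p, q)
      (Tinv (fcalc (\<lambda>t. complex_of_real t * seg_int p q t) f))"
proof -
  define k where "k s t = (q - p) * (complex_of_real t * (1 / (complex_of_real t - linepath p q s)))" for s t
  obtain B :: "real \<Rightarrow> real \<Rightarrow>\<^sub>C complex" and b :: "real \<Rightarrow>\<^sub>C complex"
    where int: "(B has_integral b) {0..1}" and B: "\<And>s. s \<in> {0..1} \<Longrightarrow> apply_bcontfun (B s) = k s"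
      and b: "\<And>t. apply_bcontfun b t = complex_of_real t * seg_int p q t"
    using seg_kernel_has_integral[OF \<delta> Im] unfolding k_def[abs_def] by blast
  have b': "(\<lambda>t. complex_of_real t * seg_int p q t) = apply_bcontfun b" using b by auto
  show "bounded_borel (\<lambda>t. complex_of_real t * seg_int p q t)" unfolding b' by (rule bounded_borel_bcontfun)
  define g where "g s = (q - p) *\<^sub>C resolvent domA A (linepath p q s) f" for s
  have g: "g s \<in> domT \<and> T (g s) = fcalc (apply_bcontfun (B s)) f" if s: "s \<in> {0..1}" for s
  proof -
    have nz: "Im (linepath p q s) \<noteq> 0" using Im[OF s] \<delta> by auto
    note bb = bounded_borel_resolvent[OF nz] bounded_borel_times_resolvent[OF nz]
    have "g s = (q - p) *\<^sub>C fcalc (\<lambda>t. 1 / (complex_of_real t - linepath p q s)) f"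
      by (simp only: g_def resolvent_A[OF nz f])
    then show ?thesis
      using fcalc_in_domT[OF bb] T_fcalc_eq[OF bb] cvec.subspace_scale[OF domT_sub] fcalc_scale[OF bb(2)]
      by (simp only: T_scale B[OF s] k_def[abs_def])
  qed
  have "((\<lambda>s. fcalc (apply_bcontfun (B s)) f) has_integral fcalc (apply_bcontfun b) f) (cbox 0 (1 :: real))"
    using has_integral_linear[OF int bounded_linear_fcalc_bcontfun[of f]] by (simp add: comp_def)
  then have lim: "((\<lambda>P. \<Sum>(s, I)\<in>P. measure lborel I *\<^sub>R fcalc (apply_bcontfun (B s)) f) \<longlongrightarrow> fcalc (apply_bcontfun b) f)
      (division_filter (cbox 0 1))"
    unfolding has_integral_cbox .
  let ?S = "\<lambda>P. \<Sum>(s, I)\<in>P. measure lborel I *\<^sub>R g s"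
  have S: "\<forall>\<^sub>F P in division_filter (cbox 0 (1 :: real)). ?S P \<in> domT \<and>
      T (?S P) = (\<Sum>(s, I)\<in>P. measure lborel I *\<^sub>R fcalc (apply_bcontfun (B s)) f)"
    using eventually_division_filter_tagged_division
  proof eventually_elim
    case (elim P)
    have dom: "measure lborel I *\<^sub>R g s \<in> domT \<and>
        T (measure lborel I *\<^sub>R g s) = measure lborel I *\<^sub>R fcalc (apply_bcontfun (B s)) f"
      if "(s, I) \<in> P" for s I
    proof -
      have "s \<in> {0..1}" using tagged_division_ofD(2,3)[OF elim that] by auto
      from g[OF this] show ?thesis
        using csubspace_scaleR[OF domT_sub] by (simp add: scaleR_scaleC T_scale)
    qed
    have "T (?S P) = (\<Sum>x\<in>P. T (case x of (s, I) \<Rightarrow> measure lborel I *\<^sub>R g s))" "?S P \<in> domT"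
      using T_sum[of P "\<lambda>(s, I). measure lborel I *\<^sub>R g s"] dom by auto
    moreover have "(\<Sum>x\<in>P. T (case x of (s, I) \<Rightarrow> measure lborel I *\<^sub>R g s))
        = (\<Sum>(s, I)\<in>P. measure lborel I *\<^sub>R fcalc (apply_bcontfun (B s)) f)"
      using dom by (intro sum.cong) auto
    ultimately show ?case by simp
  qed
  show "has_segment_integral (krein_topology K kip J) (\<lambda>l. resolvent domA A l f) (p, q)
      (Tinv (fcalc (\<lambda>t. complex_of_real t * seg_int p q t) f))"
    unfolding has_segment_integral_def b' fst_conv snd_conv g_def[symmetric]
  proof (rule limitin_K)
    show "\<forall>\<^sub>F P in division_filter (cbox 0 1). ?S P \<in> domT" using S by eventually_elim simp
    show "Tinv (fcalc (apply_bcontfun b) f) \<in> domT" by simp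
    show "((\<lambda>P. T (?S P)) \<longlongrightarrow> T (Tinv (fcalc (apply_bcontfun b) f))) (division_filter (cbox 0 1))"
      unfolding T_Tinv
      by (rule Lim_transform_eventually[OF lim]) (use S in eventually_elim, simp)
  qed
qed

lemma Tinv_sum_list: "sum_list (map (\<lambda>i. Tinv (x i)) is) = Tinv (sum_list (map x is))"
  using Tinv_scale[of 0 0] by (induction "is") (auto simp: Tinv_add)

text \<open>
  The sum over the six segments is taken inside the functional calculus, where it is the elementary function of
  \<open>contour_seg_int\<close> times \<open>t\<close>; \<open>Tinv\<close> removes the factor \<open>t\<close>.
\<close>

lemma has_chain_integral_resolvent:
  assumes f: "f \<in> K" and \<delta>: "0 < \<delta>" "\<delta> < 1" and ab: "a \<le> b"
  shows "has_chain_integral (krein_topology K kip J) (\<lambda>l. resolvent domA A l f) (contour a b \<delta>)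
    ((- 2 * of_real pi * \<i>) *\<^sub>C fcalc (\<lambda>t. complex_of_real (smooth_jump \<delta> a b t)) f)"
proof -
  let ?k = "\<lambda>pq t. complex_of_real t * (case pq of (p, q) \<Rightarrow> seg_int p q t)"
  have im: "\<delta> \<le> \<bar>Im (linepath p q s)\<bar>" if pq: "(p, q) \<in> set (contour a b \<delta>)" and s: "s \<in> {0..1}" for p q s
  proof -
    have pos: "\<delta> \<le> (1 - s) * u + s * v" if "\<delta> \<le> u" "\<delta> \<le> v" for u v
    proof -
      have "(1 - s) * \<delta> + s * \<delta> \<le> (1 - s) * u + s * v"
        using that s by (intro add_mono mult_left_mono) auto
      then show ?thesis by (simp add: algebra_simps)
    qed
    have "(\<delta> \<le> Im p \<and> \<delta> \<le> Im q) \<or> (\<delta> \<le> - Im p \<and> \<delta> \<le> - Im q)"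
      using pq ab \<delta> by (auto simp: contour_def)
    then show ?thesis
      using pos[of "Im p" "Im q"] pos[of "- Im p" "- Im q"] by (auto simp: linepath_def)
  qed
  have bb: "bounded_borel (?k pq)"
    and seg: "has_segment_integral (krein_topology K kip J) (\<lambda>l. resolvent domA A l f) pq (Tinv (fcalc (?k pq) f))"
    if "pq \<in> set (contour a b \<delta>)" for pq
    using has_segment_integral_resolvent[OF f \<delta>(1), of "fst pq" "snd pq"] im[of "fst pq" "snd pq"] that
    by (simp_all add: case_prod_unfold)
  let ?\<phi>s = "map ?k (contour a b \<delta>)" and ?j = "\<lambda>t. complex_of_real (smooth_jump \<delta> a b t)"
  have jump: "bounded_borel ?j" "bounded_borel (\<lambda>t. complex_of_real t * ?j t)"
    using \<delta> by (auto intro!: bounded_borel_smooth_jump)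
  have "(\<Sum>pq\<leftarrow>contour a b \<delta>. fcalc (?k pq) f) = fcalc (\<lambda>t. \<Sum>\<phi>\<leftarrow>?\<phi>s. \<phi> t) f"
  proof -
    have "bounded_borel \<phi>" if "\<phi> \<in> set ?\<phi>s" for \<phi> using that bb unfolding set_map by blast
    from fcalc_sum_list[OF this, of ?\<phi>s f] show ?thesis by (simp add: comp_def)
  qed
  also have "(\<lambda>t. \<Sum>\<phi>\<leftarrow>?\<phi>s. \<phi> t) = (\<lambda>t. (- 2 * of_real pi * \<i>) * (complex_of_real t * ?j t))"
    using contour_seg_int[OF \<delta> ab]
    by (simp add: comp_def sum_list_const_mult mult_ac fun_eq_iff)
  also have "fcalc \<dots> f = (- 2 * of_real pi * \<i>) *\<^sub>C T (fcalc ?j f)"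
    by (simp only: fcalc_scale[OF jump(2)] T_fcalc_eq[OF jump])
  finally have sum: "(\<Sum>pq\<leftarrow>contour a b \<delta>. Tinv (fcalc (?k pq) f)) = (- 2 * of_real pi * \<i>) *\<^sub>C fcalc ?j f"
    using fcalc_in_domT[OF jump] by (simp only: Tinv_sum_list Tinv_scale Tinv_T)
  have "list_all2 (has_segment_integral (krein_topology K kip J) (\<lambda>l. resolvent domA A l f)) (contour a b \<delta>)
      (map (\<lambda>pq. Tinv (fcalc (?k pq) f)) (contour a b \<delta>))"
    using seg by (simp add: list_all2_map2 list_all2_same)
  with sum[symmetric] show ?thesis unfolding has_chain_integral_def by (intro exI conjI)
qed

section \<open>The eigenspectral function\<close>

lemma eigenspectral_limit_E:
  assumes \<Delta>: "\<Delta> \<in> bounded_intervals" "\<Delta> \<noteq> {}" and f: "f \<in> K"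
  shows "eigenspectral_limit (krein_topology K kip J) domA A \<Delta> f (E \<Delta> f)"
proof -
  let ?j = "\<lambda>\<delta> \<epsilon> t. complex_of_real (smooth_jump \<delta> (left_end \<Delta> \<epsilon>) (right_end \<Delta> \<epsilon>) t)"
  let ?X = "krein_topology K kip J"
  have borel: "\<Delta> \<in> sets borel" using \<Delta>(1) by (rule bounded_intervals_borel)
  have small: "\<forall>\<^sub>F \<epsilon> in at_right (0 :: real). 0 < \<epsilon> \<and> \<epsilon> < 1"
    using eventually_at_right_real[of 0 1] by simp
  have inner: "limitin ?X (\<lambda>\<delta>. fcalc (?j \<delta> \<epsilon>) f) (fcalc (?j 0 \<epsilon>) f) (at_right 0)" for \<epsilon>
  proof (rule limitin_K_fcalc)
    show "\<forall>\<^sub>F \<delta> in at_right 0. bounded_borel (?j \<delta> \<epsilon>) \<and> bounded_borel (\<lambda>t. complex_of_real t * ?j \<delta> \<epsilon> t) \<and>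
        (\<forall>t. cmod (complex_of_real t * ?j \<delta> \<epsilon> t) \<le> 3 * (\<bar>left_end \<Delta> \<epsilon>\<bar> + \<bar>right_end \<Delta> \<epsilon>\<bar>) + 2)"
      using small
    proof eventually_elim
      case (elim \<delta>)
      then have "0 \<le> \<delta>" "\<delta> \<le> 1" by auto
      from bounded_borel_smooth_jump[OF this, where a = "left_end \<Delta> \<epsilon>" and b = "right_end \<Delta> \<epsilon>"]
      show ?case by blast
    qed
    show "bounded_borel (?j 0 \<epsilon>)" "bounded_borel (\<lambda>t. complex_of_real t * ?j 0 \<epsilon> t)"
      by (auto intro!: bounded_borel_smooth_jump)
    show "((\<lambda>\<delta>. ?j \<delta> \<epsilon> t) \<longlongrightarrow> ?j 0 \<epsilon> t) (at_right 0)" for t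
      by (intro tendsto_of_real smooth_jump_tendsto)
  qed
  obtain N where N: "\<And>t. t \<in> \<Delta> \<Longrightarrow> \<bar>t\<bar> \<le> N"
    using \<Delta>(1) by (auto simp: bounded_intervals_def bounded_real)
  have outer: "limitin ?X (\<lambda>\<epsilon>. fcalc (?j 0 \<epsilon>) f) (fcalc (indicator \<Delta>) f) (at_right 0)"
  proof (rule limitin_K_fcalc)
    show "\<forall>\<^sub>F \<epsilon> in at_right 0. bounded_borel (?j 0 \<epsilon>) \<and> bounded_borel (\<lambda>t. complex_of_real t * ?j 0 \<epsilon> t) \<and>
        (\<forall>t. cmod (complex_of_real t * ?j 0 \<epsilon> t) \<le> 3 * (\<bar>Inf \<Delta>\<bar> + \<bar>Sup \<Delta>\<bar> + 2) + 2)"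
      using small
    proof eventually_elim
      case (elim \<epsilon>)
      have "cmod (complex_of_real t * ?j 0 \<epsilon> t) \<le> 3 * (\<bar>Inf \<Delta>\<bar> + \<bar>Sup \<Delta>\<bar> + 2) + 2" for t
        using bounded_borel_smooth_jump(3)[of 0 t "left_end \<Delta> \<epsilon>" "right_end \<Delta> \<epsilon>"]
          smooth_jump_0_eventually(3)[OF \<Delta>, of \<epsilon>] elim by simp
      then show ?case by (auto intro!: bounded_borel_smooth_jump)
    qed
    show "bounded_borel (indicator \<Delta>)" using borel by simp
    show "bounded_borel (\<lambda>t. complex_of_real t * indicator \<Delta> t)"
      using N borel by (intro bounded_borelI[of _ "\<bar>N\<bar>"] borel_measurable_times borel_measurable_indicator)
        (force simp: indicator_def)+
    show "((\<lambda>\<epsilon>. ?j 0 \<epsilon> t) \<longlongrightarrow> indicator \<Delta> t) (at_right 0)" for t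
    proof (rule tendsto_eventually)
      show "\<forall>\<^sub>F \<epsilon> in at_right 0. ?j 0 \<epsilon> t = indicator \<Delta> t"
        using smooth_jump_0_eventually(2)[OF \<Delta>, of t] by eventually_elim (simp add: indicator_def)
    qed
  qed
  show ?thesis
    unfolding eigenspectral_limit_def
  proof (intro exI conjI)
    show "limitin ?X (\<lambda>\<epsilon>. fcalc (?j 0 \<epsilon>) f) (E \<Delta> f) (at_right 0)"
      using outer borel by (simp add: fcalc_indicator)
    show "\<forall>\<^sub>F \<epsilon> in at_right 0. \<exists>I. (\<forall>\<^sub>F \<delta> in at_right 0. has_chain_integral ?X (\<lambda>l. resolvent domA A l f)
          (contour (left_end \<Delta> \<epsilon>) (right_end \<Delta> \<epsilon>) \<delta>) (I \<delta>)) \<and>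
        limitin ?X (\<lambda>\<delta>. (- 1 / (2 * of_real pi * \<i>)) *\<^sub>C I \<delta>) (fcalc (?j 0 \<epsilon>) f) (at_right 0)"
      using smooth_jump_0_eventually(1)[OF \<Delta>]
    proof eventually_elim
      case (elim \<epsilon>)
      let ?I = "\<lambda>\<delta>. (- 2 * of_real pi * \<i>) *\<^sub>C fcalc (?j \<delta> \<epsilon>) f"
      have "\<forall>\<^sub>F \<delta> in at_right 0. has_chain_integral ?X (\<lambda>l. resolvent domA A l f)
          (contour (left_end \<Delta> \<epsilon>) (right_end \<Delta> \<epsilon>) \<delta>) (?I \<delta>)"
        by (rule eventually_mono[OF small]) (use elim f in \<open>intro has_chain_integral_resolvent, auto\<close>)
      moreover have "(- 1 / (2 * of_real pi * \<i>)) *\<^sub>C ?I \<delta> = fcalc (?j \<delta> \<epsilon>) f" for \<delta>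
        by (simp add: scaleC_scaleC scaleC_one)
      ultimately show ?case using inner[of \<epsilon>] by (intro exI[of _ ?I]) simp
    qed
  qed
qed

lemma eigenspectral_function_E:
  "eigenspectral_function K kip J domA A (\<lambda>\<Delta>. restrict (E \<Delta>) K)"
  unfolding eigenspectral_function_def
proof (intro conjI ballI impI)
  show "krein_space K kip" using compl by (simp add: krein_space_completion_def)
  show "bounded_operator K (J_form kip J) (restrict (E \<Delta>) K)" if "\<Delta> \<in> Sigma_semiring" for \<Delta>
    using that bounded_operator_E bounded_intervals_borel
    unfolding Sigma_semiring_def by (auto simp: bounded_intervals_def)
  show "restrict (E {}) K f = 0" if "f \<in> K" for f using that by simp
  show "eigenspectral_limit (krein_topology K kip J) domA A \<Delta> f (restrict (E \<Delta>) K f)"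
    if "\<Delta> \<in> bounded_intervals" "\<Delta> \<noteq> {}" "f \<in> K" for \<Delta> f
    using eigenspectral_limit_E[OF that] that by simp
  show "restrict (E \<Delta>) K f = f - restrict (E (- \<Delta>)) K f"
    if \<Delta>: "\<Delta> \<in> Sigma_semiring" and unbounded: "\<not> bounded \<Delta>" and f: "f \<in> K" for \<Delta> f
  proof -
    have "\<Delta> \<notin> bounded_intervals" using unbounded by (simp add: bounded_intervals_def)
    then obtain \<Delta>' where \<Delta>': "\<Delta>' \<in> bounded_intervals" and eq: "\<Delta> = - \<Delta>'"
      using \<Delta> unfolding Sigma_semiring_def by blast
    show ?thesis using f E_compl[OF bounded_intervals_borel[OF \<Delta>'], of f] by (simp add: eq)
  qed
qed (fact fs A_J_self_adjoint A_J_non_negative A_boundedly_invertible)+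

end

theorem theorem5p6:
  fixes T :: "'h::chilbert_space \<Rightarrow> 'h" and domT :: "'h set"
    and E :: "real set \<Rightarrow> 'h \<Rightarrow> 'h"
    and K :: "'h set" and kip :: "'h \<Rightarrow> 'h \<Rightarrow> complex" and J :: "'h \<Rightarrow> 'h"
    and A :: "'h \<Rightarrow> 'h" and domA :: "'h set"
  assumes "self_adjoint UNIV cinner domT T"
    and "boundedly_invertible UNIV cinner domT T"
    and "spectral_measure E"
    and "spectral_representation E domT T"
    and "krein_space_completion K kip J domT T"
    and "continuous_map (krein_topology K kip J) euclidean (\<lambda>x. x)"
    and "domA = {x \<in> domT. T x \<in> K}"
    and "A = restrict T domA"
  shows "eigenspectral_function K kip J domA A (\<lambda>\<Delta>. restrict (E \<Delta>) K)"
proof -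
  interpret krein_setting E domT T K kip J A domA
    using assms by unfold_locales
  show ?thesis by (rule eigenspectral_function_E)
qed

end
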